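(* Let $\mathcal M(R,F)$ be a quantum matrix algebra of BMW-type. Then its characteristic subalgebra $\mathcal C(R,F)$ is generated by the set $\{g,p_i\}_{i\ge0}$, where $g$ is the 2-contraction and $p_i$ are the power sums.
   Context: Operators. $V$ is a complex vector space of finite dimension $N$ with a fixed basis (operators on $V^{\otimes n}$ are matrices), $I$ the identity, $P$ the flip on $V\otimes V$. For $X\in\mathrm{End}(V^{\otimes 2})$, $X_{mr}$ is $X$ acting in the tensor factors $m,r$ and trivially elsewhere, $X_m:=X_{m\,m+1}$; for an $N\times N$ matrix $Y$, $Y_m$ is $Y$ in factor $m$. $\mathrm{Tr}_{(i)}$ is the trace over the $i$-th factor. $X$ is skew invertible if there is $\Psi_X\in\mathrm{End}(V^{\otimes2})$ with $\mathrm{Tr}_{(2)}X_{12}(\Psi_X)_{23}=\mathrm{Tr}_{(2)}(\Psi_X)_{12}X_{23}=P_{13}$; then $C_X:=\mathrm{Tr}_{(1)}(\Psi_X)_{12}$, $D_X:=\mathrm{Tr}_{(2)}(\Psi_X)_{12}$, and $X$ is strict skew invertible if $C_X$ or $D_X$ is invertible. An R-matrix is an invertible $R\in\mathrm{End}(V^{\otimes 2})$ with $R_1R_2R_1=R_2R_1R_2$; it gives representations $\rho_R$ of the braid groups $\mathcal B_n$ (generators $\sigma_1,\dots,\sigma_{n-1}$, $\mathcal B_1=\{1\}$) and of $\mathbb C\mathcal B_n$ on $V^{\otimes n}$, $\sigma_i\mapsto R_i$. A pair $\{R,F\}$ is compatible if $R_1F_2F_1=F_2F_1R_2$ and $R_2F_1F_2=F_1F_2R_1$.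 For skew invertible $R$ the R-trace over spaces $i_1,\dots,i_s$ is $\mathrm{Tr}_{R(i_1,\dots,i_s)}X:=\mathrm{Tr}_{(i_1,\dots,i_s)}\big((D_R)_{i_1}\cdots(D_R)_{i_s}X\big)$. BMW-type. Let $q\in\mathbb C\setminus\{0,\pm1\}$, $\mu\in\mathbb C\setminus\{0,q,-q^{-1}\}$, $\eta:=\frac{(q-\mu)(q^{-1}+\mu)}{\mu(q-q^{-1})}$. An R-matrix $R$ is of BMW-type if its minimal polynomial relation is $(qI-R)(q^{-1}I+R)(\mu I-R)=0$ and $K:=\mu^{-1}(q-q^{-1})^{-1}(qI-R)(q^{-1}I+R)$ satisfies $K_2K_1=R_1^{\pm1}R_2^{\pm1}K_1$ and $K_1K_2K_1=K_1$. Quantum matrix algebra. Let $\{R,F\}$ be a compatible pair of strict skew invertible R-matrices. For an $N\times N$ matrix $M$ put $M_{\overline1}:=M_1$, $M_{\overline i}:=F_{i-1}M_{\overline{i-1}}F_{i-1}^{-1}$. $\mathcal M(R,F)$ is the unital associative $\mathbb C$-algebra generated by the entries $M_a^b$ of $M$ with relations $R_1M_{\overline1}M_{\overline2}=M_{\overline1}M_{\overline2}R_1$; it is of BMW-type if $R$ is. The characteristic subalgebra $\mathcal C(R,F)\subset\mathcal M(R,F)$ is the linear span of $1$ and all elements $ch(\alpha):=\mathrm{Tr}_{R(1,\dots,n)}(M_{\overline1}\cdots M_{\overline n}\,\rho_R(\alpha))$, $\alpha\in\mathbb C\mathcal B_n$, $n\ge1$; it is a commutative subalgebra. Here $g:=\eta^{-1}\mathrm{Tr}_{R(1,2)}(M_{\overline1}M_{\overline2}K_1)$,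 $p_0:=\mathrm{Tr}_RI=\mu\eta$, $p_1:=\mathrm{Tr}_RM$, $p_i:=ch(\sigma_{i-1}\cdots\sigma_2\sigma_1)=ch(\sigma_1\sigma_2\cdots\sigma_{i-1})$ for $i\ge2$. *)

theory Defs
  imports
    Complex_Main
    "HOL-Library.Poly_Mapping"
    "HOL-Computational_Algebra.Polynomial"
    "HOL-Algebra.Algebraic_Closure_Type"
begin

section \<open>Operators on tensor powers\<close>

text \<open>
  \<open>V\<close> is the complex vector space whose fixed basis is indexed by the finite type \<open>'v\<close>, so that
  \<open>N = CARD('v)\<close>. The induced basis of the \<open>n\<close>-th tensor power is indexed by the lists of length
  \<open>n\<close> over \<open>'v\<close>. A matrix with entries in \<open>'a\<close> is a function of a row and a column multi-index;
  it belongs to \<open>ops n\<close> if it vanishes as soon as one of the two does not have length \<open>n\<close>, so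
  equality in \<open>ops n\<close> is equality of matrices. Tensor factors are numbered from 1.
\<close>

type_synonym ('v, 'a) op = "'v list \<Rightarrow> 'v list \<Rightarrow> 'a"

definition ops :: "nat \<Rightarrow> ('v, 'a::zero) op set" where
  "ops n = {A. \<forall>xs ys. length xs \<noteq> n \<or> length ys \<noteq> n \<longrightarrow> A xs ys = 0}"

definition op_one :: "nat \<Rightarrow> ('v, 'a::zero_neq_one) op" where
  "op_one n xs ys = (if length xs = n \<and> xs = ys then 1 else 0)"

text \<open>The entries are multiplied in the order of the factors, as they may be noncommutative.\<close>

definition op_mult :: "('v::finite, 'a::semiring_0) op \<Rightarrow> ('v, 'a) op \<Rightarrow> ('v, 'a) op"
    (infixl \<open>\<star>\<close> 70) where
  "(A \<star> B) xs ys = (\<Sum>zs | length zs = length ys. A xs zs * B zs ys)"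

definition End :: "nat \<Rightarrow> ('v::finite, complex) op monoid" where
  "End n = \<lparr>carrier = ops n, monoid.mult = op_mult, one = op_one n\<rparr>"

definition op_prod :: "nat \<Rightarrow> ('v::finite, 'a::semiring_1) op list \<Rightarrow> ('v, 'a) op" where
  "op_prod n As = foldr op_mult As (op_one n)"

text \<open>\<open>leg1 n m B\<close> is $B_m$ and \<open>leg2 n m r A\<close> is $A_{mr}$, both acting on the \<open>n\<close>-th tensor power.\<close>

definition leg1 :: "nat \<Rightarrow> nat \<Rightarrow> ('v, 'a::zero) op \<Rightarrow> ('v, 'a) op" where
  "leg1 n m B xs ys =
     (if length xs = n \<and> length ys = n \<and> (\<forall>k<n. k \<noteq> m - 1 \<longrightarrow> xs ! k = ys ! k)
      then B [xs ! (m - 1)] [ys ! (m - 1)] else 0)"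

definition leg2 :: "nat \<Rightarrow> nat \<Rightarrow> nat \<Rightarrow> ('v, 'a::zero) op \<Rightarrow> ('v, 'a) op" where
  "leg2 n m r A xs ys =
     (if length xs = n \<and> length ys = n \<and>
         (\<forall>k<n. k \<noteq> m - 1 \<and> k \<noteq> r - 1 \<longrightarrow> xs ! k = ys ! k)
      then A [xs ! (m - 1), xs ! (r - 1)] [ys ! (m - 1), ys ! (r - 1)] else 0)"

abbreviation adj :: "nat \<Rightarrow> nat \<Rightarrow> ('v, 'a::zero) op \<Rightarrow> ('v, 'a) op" where
  "adj n m A \<equiv> leg2 n m (Suc m) A"

definition flip :: "('v, complex) op" where
  "flip xs ys = (if length xs = 2 \<and> ys = rev xs then 1 else 0)"

definition op_trace :: "nat \<Rightarrow> ('v::finite, 'a::comm_monoid_add) op \<Rightarrow> 'a" where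
  "op_trace n A = (\<Sum>xs | length xs = n. A xs xs)"

text \<open>The trace over the \<open>i\<close>-th factor; the remaining factors are renumbered in increasing order.\<close>

definition ptrace :: "nat \<Rightarrow> ('v::finite, 'a::comm_monoid_add) op \<Rightarrow> ('v, 'a) op" where
  "ptrace i A xs ys =
     (\<Sum>a\<in>UNIV. A (take (i - 1) xs @ a # drop (i - 1) xs) (take (i - 1) ys @ a # drop (i - 1) ys))"


section \<open>R-matrices\<close>

definition is_skew_inverse :: "('v::finite, complex) op \<Rightarrow> ('v, complex) op \<Rightarrow> bool" where
  "is_skew_inverse A \<Psi> \<longleftrightarrow> \<Psi> \<in> ops 2 \<and>
     ptrace 2 (leg2 3 1 2 A \<star> leg2 3 2 3 \<Psi>) = flip \<and>
     ptrace 2 (leg2 3 1 2 \<Psi> \<star> leg2 3 2 3 A) = flip"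

definition skew_invertible :: "('v::finite, complex) op \<Rightarrow> bool" where
  "skew_invertible A \<longleftrightarrow> (\<exists>\<Psi>. is_skew_inverse A \<Psi>)"

definition skew_inverse :: "('v::finite, complex) op \<Rightarrow> ('v, complex) op" where
  "skew_inverse A = (THE \<Psi>. is_skew_inverse A \<Psi>)"

definition C_op :: "('v::finite, complex) op \<Rightarrow> ('v, complex) op" where
  "C_op A = ptrace 1 (skew_inverse A)"

definition D_op :: "('v::finite, complex) op \<Rightarrow> ('v, complex) op" where
  "D_op A = ptrace 2 (skew_inverse A)"

definition strict_skew_invertible :: "('v::finite, complex) op \<Rightarrow> bool" where
  "strict_skew_invertible A \<longleftrightarrow>
     skew_invertible A \<and> (C_op A \<in> Units (End 1) \<or> D_op A \<in> Units (End 1))"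

definition R_matrix :: "('v::finite, complex) op \<Rightarrow> bool" where
  "R_matrix R \<longleftrightarrow> R \<in> Units (End 2) \<and>
     adj 3 1 R \<star> adj 3 2 R \<star> adj 3 1 R = adj 3 2 R \<star> adj 3 1 R \<star> adj 3 2 R"

definition compatible_pair :: "('v::finite, complex) op \<Rightarrow> ('v, complex) op \<Rightarrow> bool" where
  "compatible_pair R F \<longleftrightarrow>
     adj 3 1 R \<star> adj 3 2 F \<star> adj 3 1 F = adj 3 2 F \<star> adj 3 1 F \<star> adj 3 2 R \<and>
     adj 3 2 R \<star> adj 3 1 F \<star> adj 3 2 F = adj 3 1 F \<star> adj 3 2 F \<star> adj 3 1 R"

definition poly_op :: "nat \<Rightarrow> complex poly \<Rightarrow> ('v::finite, complex) op \<Rightarrow> ('v, complex) op" where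
  "poly_op n p A xs ys = (\<Sum>i\<le>Polynomial.degree p. Polynomial.coeff p i * (A [^]\<^bsub>End n\<^esub> i) xs ys)"

definition is_minimal_poly :: "nat \<Rightarrow> complex poly \<Rightarrow> ('v::finite, complex) op \<Rightarrow> bool" where
  "is_minimal_poly n p A \<longleftrightarrow> Polynomial.lead_coeff p = 1 \<and> poly_op n p A = (\<lambda>_ _. 0) \<and>
     (\<forall>f. f \<noteq> 0 \<and> poly_op n f A = (\<lambda>_ _. 0) \<longrightarrow> Polynomial.degree p \<le> Polynomial.degree f)"

definition BMW_eta :: "complex \<Rightarrow> complex \<Rightarrow> complex" where
  "BMW_eta q \<mu> = (q - \<mu>) * (inverse q + \<mu>) / (\<mu> * (q - inverse q))"

definition BMW_K :: "complex \<Rightarrow> complex \<Rightarrow> ('v::finite, complex) op \<Rightarrow> ('v, complex) op" where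
  "BMW_K q \<mu> R xs ys = inverse \<mu> * inverse (q - inverse q) *
     ((\<lambda>xs ys. q * op_one 2 xs ys - R xs ys) \<star>
      (\<lambda>xs ys. inverse q * op_one 2 xs ys + R xs ys)) xs ys"

definition BMW_type :: "complex \<Rightarrow> complex \<Rightarrow> ('v::finite, complex) op \<Rightarrow> bool" where
  "BMW_type q \<mu> R \<longleftrightarrow> R_matrix R \<and>
     is_minimal_poly 2 ([:q, -1:] * [:inverse q, 1:] * [:\<mu>, -1:]) R \<and>
     (let K = BMW_K q \<mu> R; R' = inv\<^bsub>End 2\<^esub> R;
          K1 = adj 3 1 K; K2 = adj 3 2 K
      in K2 \<star> K1 = adj 3 1 R \<star> adj 3 2 R \<star> K1 \<and>
         K2 \<star> K1 = adj 3 1 R' \<star> adj 3 2 R' \<star> K1 \<and>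
         K1 \<star> K2 \<star> K1 = K1)"


section \<open>Braid groups and their representations\<close>

text \<open>
  Braid words are lists of pairs \<open>(i, e)\<close>, standing for $\sigma_i$ if \<open>e\<close> is true and for
  $\sigma_i^{-1}$ otherwise. The braid group on \<open>n\<close> strands is the set of classes of braid words
  modulo the congruence given by Artin's presentation.
\<close>

type_synonym braid_word = "(nat \<times> bool) list"

definition braid_words :: "nat \<Rightarrow> braid_word set" where
  "braid_words n = {w. \<forall>(i, e) \<in> set w. 1 \<le> i \<and> i < n}"

inductive braid_step :: "braid_word \<Rightarrow> braid_word \<Rightarrow> bool" where
  cancel: "braid_step (u @ [(i, e), (i, \<not> e)] @ v) (u @ v)"
| far: "i + 2 \<le> j \<Longrightarrow>
    braid_step (u @ [(i, True), (j, True)] @ v) (u @ [(j, True), (i, True)] @ v)"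
| artin: "braid_step (u @ [(i, True), (Suc i, True), (i, True)] @ v)
    (u @ [(Suc i, True), (i, True), (Suc i, True)] @ v)"

definition braid_eq :: "nat \<Rightarrow> (braid_word \<times> braid_word) set" where
  "braid_eq n = ({(u, v). u \<in> braid_words n \<and> v \<in> braid_words n \<and>
                          (braid_step u v \<or> braid_step v u)})\<^sup>* \<inter>
                (braid_words n \<times> braid_words n)"

definition braid_group :: "nat \<Rightarrow> braid_word set set" where
  "braid_group n = braid_words n // braid_eq n"

definition braid :: "nat \<Rightarrow> braid_word \<Rightarrow> braid_word set" where
  "braid n w = braid_eq n `` {w}"

text \<open>The underlying vector space of $\mathbb{C}\mathcal{B}_n$: finitely supported functions on the group.\<close>

definition braid_algebra :: "nat \<Rightarrow> (braid_word set \<Rightarrow>\<^sub>0 complex) set" where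
  "braid_algebra n = {\<alpha>. Poly_Mapping.keys \<alpha> \<subseteq> braid_group n}"

definition rho_word :: "('v::finite, complex) op \<Rightarrow> nat \<Rightarrow> braid_word \<Rightarrow> ('v, complex) op" where
  "rho_word R n w = op_prod n (map (\<lambda>(i, e). adj n i (if e then R else inv\<^bsub>End 2\<^esub> R)) w)"

text \<open>\<open>rho_word R n\<close> is constant on each braid \<open>b\<close> when \<open>R\<close> is an R-matrix, whence \<open>the_elem\<close>.\<close>

definition rho :: "('v::finite, complex) op \<Rightarrow> nat \<Rightarrow> (braid_word set \<Rightarrow>\<^sub>0 complex) \<Rightarrow>
    ('v, complex) op" where
  "rho R n \<alpha> xs ys =
     (\<Sum>b\<in>Poly_Mapping.keys \<alpha>. Poly_Mapping.lookup \<alpha> b * the_elem (rho_word R n ` b) xs ys)"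


section \<open>Free algebras\<close>

text \<open>
  The free unital associative complex algebra on \<open>'g\<close> is the monoid algebra of the free monoid.
  \<^typ>\<open>'a \<Rightarrow>\<^sub>0 'b\<close> is a monoid algebra for an additively written, possibly noncommutative monoid,
  so concatenation of words is written as addition.
\<close>

datatype 'g free_monoid = FM "'g list"

instantiation free_monoid :: (type) monoid_add
begin

definition "0 = FM []"

fun plus_free_monoid :: "'a free_monoid \<Rightarrow> 'a free_monoid \<Rightarrow> 'a free_monoid" where
  "FM xs + FM ys = FM (xs @ ys)"

instance
proof
  fix a b c :: "'a free_monoid"
  show "a + b + c = a + (b + c)"
    by (cases a; cases b; cases c) simp
  show "0 + a = a" "a + 0 = a"
    by (cases a; simp add: zero_free_monoid_def)+
qed

end

type_synonym 'g free_algebra = "'g free_monoid \<Rightarrow>\<^sub>0 complex"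

definition const :: "complex \<Rightarrow> 'g free_algebra" where
  "const c = Poly_Mapping.single 0 c"

definition gen :: "'g \<Rightarrow> 'g free_algebra" where
  "gen x = Poly_Mapping.single (FM [x]) 1"

definition const_op :: "('v, complex) op \<Rightarrow> ('v, 'g free_algebra) op" where
  "const_op A xs ys = const (A xs ys)"


section \<open>Quantum matrix algebras\<close>

text \<open>
  The generator \<open>gen (a, b)\<close> is the entry of the matrix \<open>M\<close> in row \<open>a\<close> and column \<open>b\<close>. Matrices over
  the quantum matrix algebra are handled through their lifts to the free algebra; \<open>qma_class\<close> is
  the projection.
\<close>

type_synonym 'v qfree = "('v \<times> 'v) free_algebra"

definition M_op :: "('v, 'v qfree) op" where
  "M_op xs ys = (if length xs = 1 \<and> length ys = 1 then gen (hd xs, hd ys) else 0)"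

text \<open>\<open>M_bar F n i\<close> is $M_{\overline{i}}$ on the \<open>n\<close>-th tensor power; it is meant for \<open>i \<ge> 1\<close> only.\<close>

fun M_bar :: "('v::finite, complex) op \<Rightarrow> nat \<Rightarrow> nat \<Rightarrow> ('v, 'v qfree) op" where
  "M_bar F n 0 = undefined"
| "M_bar F n (Suc 0) = leg1 n 1 M_op"
| "M_bar F n (Suc (Suc i)) =
     const_op (adj n (Suc i) F) \<star> M_bar F n (Suc i) \<star> const_op (adj n (Suc i) (inv\<^bsub>End 2\<^esub> F))"

definition M_prod :: "('v::finite, complex) op \<Rightarrow> nat \<Rightarrow> ('v, 'v qfree) op" where
  "M_prod F n = op_prod n (map (M_bar F n) [1..<Suc n])"

definition qma_relations ::
    "('v::finite, complex) op \<Rightarrow> ('v, complex) op \<Rightarrow> 'v qfree set" where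
  "qma_relations R F =
     {(const_op (adj 2 1 R) \<star> M_bar F 2 1 \<star> M_bar F 2 2) xs ys -
      (M_bar F 2 1 \<star> M_bar F 2 2 \<star> const_op (adj 2 1 R)) xs ys | xs ys.
      length xs = 2 \<and> length ys = 2}"

definition qma_ideal :: "('v::finite, complex) op \<Rightarrow> ('v, complex) op \<Rightarrow> 'v qfree set" where
  "qma_ideal R F = Idl\<^bsub>ring_of_type_algebra\<^esub> (qma_relations R F)"

definition QMA :: "('v::finite, complex) op \<Rightarrow> ('v, complex) op \<Rightarrow> 'v qfree set ring" where
  "QMA R F = ring_of_type_algebra Quot qma_ideal R F"

definition qma_class ::
    "('v::finite, complex) op \<Rightarrow> ('v, complex) op \<Rightarrow> 'v qfree \<Rightarrow> 'v qfree set" where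
  "qma_class R F x = qma_ideal R F +>\<^bsub>ring_of_type_algebra\<^esub> x"

definition qma_scalars ::
    "('v::finite, complex) op \<Rightarrow> ('v, complex) op \<Rightarrow> 'v qfree set set" where
  "qma_scalars R F = range (\<lambda>c. qma_class R F (const c))"

text \<open>
  In HOL-Algebra, \<open>subalgebra K W Q\<close> only says that \<open>W\<close> is an additive subgroup of \<open>Q\<close> closed under
  multiplication by elements of \<open>K\<close>, that is, a linear subspace if \<open>K\<close> is the set of scalars.
\<close>

definition qma_span :: "('v::finite, complex) op \<Rightarrow> ('v, complex) op \<Rightarrow>
    'v qfree set set \<Rightarrow> 'v qfree set set" where
  "qma_span R F S = \<Inter>{W. subalgebra (qma_scalars R F) W (QMA R F) \<and> S \<subseteq> W}"

definition qma_generated :: "('v::finite, complex) op \<Rightarrow> ('v, complex) op \<Rightarrow>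
    'v qfree set set \<Rightarrow> 'v qfree set set" where
  "qma_generated R F S =
     \<Inter>{A. subring A (QMA R F) \<and> subalgebra (qma_scalars R F) A (QMA R F) \<and> S \<subseteq> A}"

text \<open>\<open>R_trace R n\<close> is the R-trace over all the spaces \<open>1, \<dots>, n\<close>.\<close>

definition R_trace :: "('v::finite, complex) op \<Rightarrow> nat \<Rightarrow> ('v, 'v qfree) op \<Rightarrow> 'v qfree" where
  "R_trace R n A =
     op_trace n (op_prod n (map (\<lambda>i. const_op (leg1 n i (D_op R))) [1..<Suc n]) \<star> A)"

definition ch :: "('v::finite, complex) op \<Rightarrow> ('v, complex) op \<Rightarrow> nat \<Rightarrow>
    (braid_word set \<Rightarrow>\<^sub>0 complex) \<Rightarrow> 'v qfree set" where
  "ch R F n \<alpha> = qma_class R F (R_trace R n (M_prod F n \<star> const_op (rho R n \<alpha>)))"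

definition char_subalgebra ::
    "('v::finite, complex) op \<Rightarrow> ('v, complex) op \<Rightarrow> 'v qfree set set" where
  "char_subalgebra R F =
     qma_span R F (insert \<one>\<^bsub>QMA R F\<^esub> {ch R F n \<alpha> | n \<alpha>. 1 \<le> n \<and> \<alpha> \<in> braid_algebra n})"

definition two_contraction :: "complex \<Rightarrow> complex \<Rightarrow> ('v::finite, complex) op \<Rightarrow>
    ('v, complex) op \<Rightarrow> 'v qfree set" where
  "two_contraction q \<mu> R F = qma_class R F
     (const (inverse (BMW_eta q \<mu>)) *
      R_trace R 2 (M_bar F 2 1 \<star> M_bar F 2 2 \<star> const_op (adj 2 1 (BMW_K q \<mu> R))))"

text \<open>For \<open>i \<ge> 2\<close> the braid is $\sigma_{i-1} \cdots \sigma_2 \sigma_1$.\<close>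

definition power_sum :: "('v::finite, complex) op \<Rightarrow> ('v, complex) op \<Rightarrow> nat \<Rightarrow>
    'v qfree set" where
  "power_sum R F i =
     (if i = 0 then qma_class R F (R_trace R 1 (op_one 1))
      else if i = 1 then qma_class R F (R_trace R 1 M_op)
      else ch R F i
        (Poly_Mapping.single (braid i (map (\<lambda>k. (k, True)) (rev [1..<i]))) 1))"

end

(*
  The map ch is a trace on words in the R_i: the R-trace satisfies Tr_R(R_i Y) = Tr_R(Y R_i), as D_R (x) D_R
  commutes with R, and R_i commutes with M_1 ... M_n in the quantum matrix algebra. It is also multiplicative on
  juxtaposed braids, because Tr_R(2) F_1 Y_1 F_1^{-1} = Tr_R(Y) I for compatible {R, F}. So the characteristic
  subalgebra is closed under multiplication, and only the BMW algebra remains to be reduced modulo commutators.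
  Let W_k be its subalgebra on k strands. From W_{k+1} = W_k + W_k R_k W_k + W_k K_k W_k one gets, by cyclicity, three kinds of
  words: y in W_{n-1}, which gives p_1 ch(y); R_{n-1} ... R_k y with y in W_k, which gives p_{n-k+1} ch(y) when y
  is in W_{k-1}; and words where a K_k meets R_{k+1}, to which R_{k+1} K_k = R_k^{-1} K_{k+1} K_k applies until the
  word has become K_{n-1} y with y in W_{n-1}. Finally K = K^2 / eta and the fact that K_{n-1} y K_{n-1} is a
  combination of a K_{n-1} b with a, b in W_{n-2} turn the latter into g ch(y') with y' in W_{n-2}.
*)

theory Submission
  imports Defs
begin

section \<open>Operators on tensor powers\<close>

text \<open>The entries of M do not commute, so the trace over matrices in them is not cyclic.
  Cyclicity survives because only the R_i, whose entries are scalars, are carried around the trace;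
  this is the one place where the relations of the algebra act. Multiplicativity is already an
  identity in the free algebra. Hence the computations take place on lifts, and the relations enter
  through \<open>\<tau>_commute\<close>. Both facts about D_R have one source, the identity Tr_(3)
  D_3 G_2 R_1 G_2^{-1} = I, a linear system that skew invertibility solves; G is F, R or R^{-1}. The
  reduction in the BMW algebra is phrased for a predicate closed under sums, scalars and cyclic
  exchange. It is later read as membership of ch(y) in an arbitrary subalgebra containing the
  generators. The induction is on the number of strands: words of any length on n strands are
  controlled by the decomposition of W_{k+1}, which leaves at most one letter of index k. Inverses
  of the R_i are polynomials in R_i by the cubic relation, so the algebra generated by the R_i
  contains the images of all braids.\<close>

lemma finite_length_eq [simp]: "finite {xs :: 'v::finite list. length xs = n}"
  using finite_lists_length_eq[of "UNIV :: 'v set" n] by simp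

lemma sum_length_Suc:
  "(\<Sum>xs | length xs = Suc n. f xs) = (\<Sum>a\<in>UNIV. \<Sum>xs | length xs = n. f (a # xs :: 'v::finite list))"
proof -
  have "(\<Sum>xs | length xs = Suc n. f xs) = sum f ((\<lambda>(a, xs). a # xs) ` (UNIV \<times> {xs. length xs = n}))"
    by (rule sum.cong) (auto simp: length_Suc_conv image_iff)
  also have "\<dots> = (\<Sum>(a, xs)\<in>UNIV \<times> {xs. length xs = n}. f (a # xs))"
    by (subst sum.reindex) (auto simp: inj_on_def case_prod_unfold)
  finally show ?thesis by (simp add: sum.cartesian_product)
qed

lemma sum_length_2: "(\<Sum>xs | length xs = 2. f xs) = (\<Sum>a\<in>UNIV. \<Sum>b\<in>UNIV. f [a, b :: 'v::finite])"
  by (simp add: sum_length_Suc numeral_2_eq_2)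

lemma sum_length_snoc:
  "(\<Sum>xs | length xs = Suc n. f xs) = (\<Sum>xs | length xs = n. \<Sum>a\<in>UNIV. f (xs @ [a :: 'v::finite]))"
proof -
  have "(\<Sum>xs | length xs = Suc n. f xs) = sum f ((\<lambda>(xs, a). xs @ [a]) ` ({xs. length xs = n} \<times> UNIV))"
    by (rule sum.cong) (auto simp: length_Suc_conv_rev image_iff)
  also have "\<dots> = (\<Sum>(xs, a)\<in>{xs. length xs = n} \<times> UNIV. f (xs @ [a]))"
    by (subst sum.reindex) (auto simp: inj_on_def case_prod_unfold)
  finally show ?thesis by (simp add: sum.cartesian_product)
qed

text \<open>Both sides range over pairs of lists of the one length \<open>length ys\<close>, so the
  law holds for arbitrary functions; the ring structure on \<open>mat\<close> rests on this.\<close>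

lemma op_mult_assoc: "A \<star> B \<star> C = A \<star> (B \<star> C)"
proof (intro ext)
  fix xs ys
  show "(A \<star> B \<star> C) xs ys = (A \<star> (B \<star> C)) xs ys"
    unfolding op_mult_def sum_distrib_left sum_distrib_right
    by (subst sum.swap) (auto intro!: sum.cong simp: mult.assoc)
qed

lemma op_one_right: "A \<in> ops n \<Longrightarrow> A \<star> op_one n = (A :: ('v::finite, 'a::semiring_1) op)"
proof (intro ext)
  fix xs ys :: "'v list" assume A: "A \<in> ops n"
  have "(A \<star> op_one n) xs ys = (\<Sum>zs | length zs = length ys. if zs = ys then A xs ys * op_one n ys ys else 0)"
    unfolding op_mult_def by (rule sum.cong) (auto simp: op_one_def)
  then show "(A \<star> op_one n) xs ys = A xs ys"
    using A by (auto simp: op_one_def ops_def)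
qed

lemma op_one_left: "A \<in> ops n \<Longrightarrow> op_one n \<star> A = (A :: ('v::finite, 'a::semiring_1) op)"
proof (intro ext)
  fix xs ys :: "'v list" assume A: "A \<in> ops n"
  have "(op_one n \<star> A) xs ys = (\<Sum>zs | length zs = length ys. if zs = xs then op_one n xs xs * A xs ys else 0)"
    unfolding op_mult_def by (rule sum.cong) (auto simp: op_one_def)
  then show "(op_one n \<star> A) xs ys = A xs ys"
    using A by (auto simp: op_one_def ops_def)
qed

lemma op_one_in_ops [simp]: "op_one n \<in> ops n"
  by (auto simp: ops_def op_one_def)

lemma op_mult_in_ops: "A \<in> ops n \<Longrightarrow> B \<in> ops n \<Longrightarrow> A \<star> B \<in> ops n"
  by (auto simp: ops_def op_mult_def)

lemma ops_eqI:
  assumes "A \<in> ops n" "B \<in> ops n"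
    and "\<And>xs ys. length xs = n \<Longrightarrow> length ys = n \<Longrightarrow> A xs ys = B xs ys"
  shows "A = B"
proof (intro ext)
  fix xs ys show "A xs ys = B xs ys"
    using assms by (cases "length xs = n \<and> length ys = n") (auto simp: ops_def)
qed

text \<open>\<open>place n k p A\<close> lets \<open>A\<close> act on the factors $k+1, \dots, k+p$ of the \<open>n\<close>-th tensor power.\<close>

definition place :: "nat \<Rightarrow> nat \<Rightarrow> nat \<Rightarrow> ('v, 'a::zero) op \<Rightarrow> ('v, 'a) op" where
  "place n k p A xs ys =
     (if length xs = n \<and> length ys = n \<and> take k xs = take k ys \<and> drop (k + p) xs = drop (k + p) ys
      then A (take p (drop k xs)) (take p (drop k ys)) else 0)"

lemma place_in_ops [simp]: "place n k p A \<in> ops n"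
  by (auto simp: ops_def place_def)

lemma place_append:
  "\<lbrakk>length u = k; length u' = k; length v = p; length v' = p; length (u @ v @ w) = n; length (u' @ v' @ w') = n\<rbrakk>
   \<Longrightarrow> place n k p A (u @ v @ w) (u' @ v' @ w') = (if u = u' \<and> w = w' then A v v' else 0)"
  by (auto simp: place_def)

lemma split_list3:
  assumes "length xs = n" "k + p \<le> n"
  obtains u v w where "xs = u @ v @ w" "length u = k" "length v = p" "length w = n - (k + p)"
proof -
  have "xs = take k xs @ take p (drop k xs) @ drop (k + p) xs"
    by (metis append_take_drop_id drop_drop add.commute)
  with assms show thesis
    by (intro that) auto
qed

text \<open>\<open>place\<close> vanishes unless the outer parts agree, so the sum over lists of
  length n collapses to the p inner positions.\<close>

lemma sum_place_right:
  assumes "length u = k" "length v = p" "length w = n - (k + p)" "k + p \<le> n"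
  shows "(place n k p A \<star> B) (u @ v @ w) ys = (if length ys = n then \<Sum>z | length z = p. A v z * B (u @ z @ w) ys else 0)"
proof (cases "length ys = n")
  case True
  have "(place n k p A \<star> B) (u @ v @ w) ys =
      (\<Sum>zs\<in>(\<lambda>z. u @ z @ w) ` {z. length z = p}. place n k p A (u @ v @ w) zs * B zs ys)"
    unfolding op_mult_def
  proof (rule sum.mono_neutral_right)
    show "\<forall>zs\<in>{zs. length zs = length ys} - (\<lambda>z. u @ z @ w) ` {z. length z = p}. place n k p A (u @ v @ w) zs * B zs ys = 0"
    proof
      fix zs assume zs: "zs \<in> {zs. length zs = length ys} - (\<lambda>z. u @ z @ w) ` {z. length z = p}"
      then obtain u' v' w' where "zs = u' @ v' @ w'" "length u' = k" "length v' = p" "length w' = n - (k + p)"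
        using True by (auto intro: split_list3[OF _ assms(4), of zs])
      then show "place n k p A (u @ v @ w) zs * B zs ys = 0"
        using assms zs True by (auto simp: place_append)
    qed
  qed (use assms True in auto)
  also have "\<dots> = (\<Sum>z | length z = p. A v z * B (u @ z @ w) ys)"
    by (subst sum.reindex) (use assms in \<open>auto simp: inj_on_def place_append\<close>)
  finally show ?thesis using True by simp
qed (auto simp: op_mult_def place_def)

lemma sum_place_left:
  assumes "length u = k" "length v = p" "length w = n - (k + p)" "k + p \<le> n"
  shows "(B \<star> place n k p A) xs (u @ v @ w) = (\<Sum>z | length z = p. B xs (u @ z @ w) * A z v)"
proof -
  have len: "length (u @ v @ w) = n" using assms by simp
  have "(B \<star> place n k p A) xs (u @ v @ w) =
      (\<Sum>zs\<in>(\<lambda>z. u @ z @ w) ` {z. length z = p}. B xs zs * place n k p A zs (u @ v @ w))"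
    unfolding op_mult_def len
  proof (rule sum.mono_neutral_right)
    show "\<forall>zs\<in>{zs. length zs = n} - (\<lambda>z. u @ z @ w) ` {z. length z = p}. B xs zs * place n k p A zs (u @ v @ w) = 0"
    proof
      fix zs assume zs: "zs \<in> {zs. length zs = n} - (\<lambda>z. u @ z @ w) ` {z. length z = p}"
      then have "length zs = n" by simp
      from split_list3[OF this assms(4)] obtain u' v' w'
        where "zs = u' @ v' @ w'" "length u' = k" "length v' = p" "length w' = n - (k + p)" .
      then show "B xs zs * place n k p A zs (u @ v @ w) = 0"
        using assms zs by (auto simp: place_append)
    qed
  qed (use assms in auto)
  also have "\<dots> = (\<Sum>z | length z = p. B xs (u @ z @ w) * A z v)"
    by (subst sum.reindex) (use assms in \<open>auto simp: inj_on_def place_append\<close>)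
  finally show ?thesis .
qed

lemma place_mult:
  assumes "k + p \<le> n"
  shows "place n k p (A \<star> B) = place n k p A \<star> place n k p B"
proof (rule ops_eqI[of _ n])
  fix xs ys :: "'a list" assume len: "length xs = n" "length ys = n"
  obtain u v w where xs: "xs = u @ v @ w" "length u = k" "length v = p" "length w = n - (k + p)"
    by (rule split_list3[OF len(1) assms])
  obtain u' v' w' where ys: "ys = u' @ v' @ w'" "length u' = k" "length v' = p" "length w' = n - (k + p)"
    by (rule split_list3[OF len(2) assms])
  show "place n k p (A \<star> B) xs ys = (place n k p A \<star> place n k p B) xs ys"
    using assms len unfolding xs(1) 
    by (subst sum_place_right) (auto simp: xs ys place_append op_mult_def intro!: sum.cong)
qed (auto intro: op_mult_in_ops)

lemma place_one: "k + p \<le> n \<Longrightarrow> place n k p (op_one p) = op_one n"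
proof (rule ops_eqI[of _ n])
  fix xs ys :: "'a list" assume "k + p \<le> n" and len: "length xs = n" "length ys = n"
  then show "place n k p (op_one p) xs ys = (op_one n xs ys :: 'b)"
    by (elim split_list3[of xs n k p] split_list3[of ys n k p]) (auto simp: place_append op_one_def)
qed auto

lemma place_all: "A \<in> ops n \<Longrightarrow> place n 0 n A = A"
  by (rule ops_eqI[of _ n]) (auto simp: place_def)

lemma place_place:
  assumes "k + p \<le> n" "j + r \<le> p"
  shows "place n k p (place p j r A) = place n (k + j) r A"
proof (rule ops_eqI[of _ n])
  fix xs ys :: "'a list" assume len: "length xs = n" "length ys = n"
  obtain u v w where xs: "xs = u @ v @ w" "length u = k" "length v = p" "length w = n - (k + p)"
    by (rule split_list3[OF len(1) assms(1)])
  obtain u' v' w' where ys: "ys = u' @ v' @ w'" "length u' = k" "length v' = p" "length w' = n - (k + p)"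
    by (rule split_list3[OF len(2) assms(1)])
  obtain a b c where v: "v = a @ b @ c" "length a = j" "length b = r" "length c = p - (j + r)"
    by (rule split_list3[OF xs(3) assms(2)])
  obtain a' b' c' where v': "v' = a' @ b' @ c'" "length a' = j" "length b' = r" "length c' = p - (j + r)"
    by (rule split_list3[OF ys(3) assms(2)])
  have "place n k p (place p j r A) (u @ v @ w) (u' @ v' @ w') =
      (if u = u' \<and> w = w' then place p j r A (a @ b @ c) (a' @ b' @ c') else 0)"
    by (subst place_append) (use assms xs ys v v' in auto)
  also have "place p j r A (a @ b @ c) (a' @ b' @ c') = (if a = a' \<and> c = c' then A b b' else 0)"
    by (rule place_append) (use assms xs ys v v' in auto)
  also have "(if u = u' \<and> w = w' then if a = a' \<and> c = c' then A b b' else 0 else 0) =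
      place n (k + j) r A ((u @ a) @ b @ (c @ w)) ((u' @ a') @ b' @ (c' @ w'))"
    by (subst place_append) (use assms xs ys v v' in auto)
  finally show "place n k p (place p j r A) xs ys = place n (k + j) r A xs ys"
    by (simp add: xs ys v v')
qed auto

text \<open>Disjoint factors produce the entries of A and B in opposite orders on the two sides,
  hence \<open>comm\<close>. It is met whenever one of the two operators has scalar entries.\<close>

lemma place_commute:
  fixes A B :: "('v::finite, 'a::semiring_0) op"
  assumes "k + p \<le> l" "l + r \<le> n" and comm: "\<And>a b c d. A a b * B c d = B c d * A a b"
  shows "place n k p A \<star> place n l r B = place n l r B \<star> place n k p A"
proof (rule ops_eqI[of _ n])
  fix xs ys :: "'v list" assume len: "length xs = n" "length ys = n"
  define m where "m = l - (k + p)"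
  have l: "l = k + p + m" using assms by (simp add: m_def)
  have split: "\<exists>a x b y c. xs = a @ x @ b @ y @ c \<and> length a = k \<and> length x = p \<and> length b = m \<and> length y = r
     \<and> length c = n - (l + r)" if len: "length xs = n" for xs :: "'v list"
  proof -
    obtain u y c where u: "xs = u @ y @ c" "length u = l" "length y = r" "length c = n - (l + r)"
      by (rule split_list3[OF len assms(2)])
    obtain a x b where "u = a @ x @ b" "length a = k" "length x = p" "length b = l - (k + p)"
      by (rule split_list3[OF u(2) assms(1)])
    with u show ?thesis
      by (intro exI[of _ a] exI[of _ x] exI[of _ b] exI[of _ y] exI[of _ c]) (simp add: m_def)
  qed
  obtain a x b y c where xs: "xs = a @ x @ b @ y @ c" and
    xsl: "length a = k" "length x = p" "length b = m" "length y = r" "length c = n - (l + r)"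
    using split[OF len(1)] by blast
  obtain a' x' b' y' c' where ys: "ys = a' @ x' @ b' @ y' @ c'" and
    ysl: "length a' = k" "length x' = p" "length b' = m" "length y' = r" "length c' = n - (l + r)"
    using split[OF len(2)] by blast
  have "(place n k p A \<star> place n l r B) (a @ x @ (b @ y @ c)) (a' @ x' @ b' @ y' @ c') =
    (\<Sum>z | length z = p. A x z * place n l r B ((a @ z @ b) @ y @ c) ((a' @ x' @ b') @ y' @ c'))"
    by (subst sum_place_right) (use xsl ysl assms l in auto)
  also have "\<dots> = (\<Sum>z | length z = p. if z = x' then (if a = a' \<and> b = b' \<and> c = c' then A x x' * B y y' else 0) else 0)"
    by (rule sum.cong[OF refl], subst place_append) (use xsl ysl assms l in auto)
  also have "\<dots> = (if a = a' \<and> b = b' \<and> c = c' then B y y' * A x x' else 0)"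
    using ysl by (simp add: comm)
  also have "\<dots> = (\<Sum>z | length z = r. if z = y' then (if a = a' \<and> b = b' \<and> c = c' then B y y' * A x x' else 0) else 0)"
    using ysl by simp
  also have "\<dots> = (\<Sum>z | length z = r. B y z * place n k p A (a @ x @ (b @ z @ c)) (a' @ x' @ (b' @ y' @ c')))"
    by (rule sum.cong[OF refl], subst place_append) (use xsl ysl assms l in auto)
  also have "\<dots> = (place n l r B \<star> place n k p A) ((a @ x @ b) @ y @ c) (a' @ x' @ b' @ y' @ c')"
    by (subst sum_place_right) (use xsl ysl assms l in auto)
  finally show "(place n k p A \<star> place n l r B) xs ys = (place n l r B \<star> place n k p A) xs ys"
    by (simp add: xs ys)
qed (auto intro: op_mult_in_ops)

lemma adj_eq_place: "1 \<le> i \<Longrightarrow> i < n \<Longrightarrow> adj n i A = place n (i - 1) 2 A"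
proof (rule ops_eqI[of _ n])
  fix xs ys :: "'a list" assume i: "1 \<le> i" "i < n" and len: "length xs = n" "length ys = n"
  have "take 2 (drop (i - 1) zs) = [zs ! (i - 1), zs ! i]" if "length zs = n" for zs :: "'a list"
    using that i by (intro nth_equalityI) (auto simp: nth_Cons less_2_cases_iff split: nat.split)
  moreover have "(\<forall>k<n. k \<noteq> i - 1 \<and> k \<noteq> i \<longrightarrow> xs ! k = ys ! k) \<longleftrightarrow>
    take (i - 1) xs = take (i - 1) ys \<and> drop (i - 1 + 2) xs = drop (i - 1 + 2) ys" (is "?L \<longleftrightarrow> ?R")
  proof
    assume ?L
    then show ?R using len i by (auto intro!: nth_equalityI)
  next
    assume R: ?R
    have "xs ! k = ys ! k" if "k < n" "k \<noteq> i - 1" "k \<noteq> i" for k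
    proof (cases "k < i - 1")
      case True
      then show ?thesis using R by (metis nth_take)
    next
      case False
      then have "k = i - 1 + 2 + (k - Suc i)" using that i by simp
      then show ?thesis using R len that i
        by (metis (no_types, lifting) Suc_leI add_leE nat_less_le nth_drop not_less_eq_eq le_add1 order_less_imp_le)
    qed
    then show ?L by blast
  qed
  ultimately show "adj n i A xs ys = place n (i - 1) 2 A xs ys"
    using len i by (simp add: leg2_def place_def)
qed (auto simp: ops_def leg2_def place_def)

lemma leg1_eq_place: "1 \<le> i \<Longrightarrow> i \<le> n \<Longrightarrow> leg1 n i A = place n (i - 1) 1 A"
proof (rule ops_eqI[of _ n])
  fix xs ys :: "'a list" assume i: "1 \<le> i" "i \<le> n" and len: "length xs = n" "length ys = n"
  have i': "i - 1 + 1 \<le> n" using i by simp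
  obtain u v w where xs: "xs = u @ v @ w" "length u = i - 1" "length v = 1" "length w = n - (i - 1 + 1)"
    by (rule split_list3[OF len(1) i'])
  obtain u' v' w' where ys: "ys = u' @ v' @ w'" "length u' = i - 1" "length v' = 1" "length w' = n - (i - 1 + 1)"
    by (rule split_list3[OF len(2) i'])
  obtain a b where ab: "v = [a]" "v' = [b]"
    using xs ys by (auto simp: length_Suc_conv)
  have "(\<forall>k<n. k \<noteq> i - 1 \<longrightarrow> xs ! k = ys ! k) \<longleftrightarrow> u = u' \<and> w = w'" (is "?L \<longleftrightarrow> ?R")
  proof
    assume L: ?L
    have "u ! k = u' ! k" if "k < i - 1" for k
      using L[rule_format, of k] that i xs ys by (simp add: nth_append)
    moreover have "w ! k = w' ! k" if "k < length w" for k
    proof -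
      have "xs ! (i + k) = ys ! (i + k)" using L[rule_format, of "i + k"] that i xs by simp
      then have "((u @ [a]) @ w) ! (length (u @ [a]) + k) = ((u' @ [b]) @ w') ! (length (u' @ [b]) + k)"
        using i xs ys ab by simp
      then show ?thesis by (simp only: nth_append_length_plus)
    qed
    ultimately show ?R using xs ys by (auto intro!: nth_equalityI)
  next
    assume ?R
    then show ?L using xs ys i ab by (auto simp: nth_append nth_Cons')
  qed
  moreover have "place n (i - 1) 1 A (u @ v @ w) (u' @ v' @ w') = (if u = u' \<and> w = w' then A v v' else 0)"
    by (rule place_append) (use len xs ys in auto)
  ultimately show "leg1 n i A xs ys = place n (i - 1) 1 A xs ys"
    using len i by (simp add: leg1_def xs ys ab nth_append)
qed (auto simp: ops_def leg1_def place_def)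

lemma op_prod_Cons: "op_prod n (A # As) = A \<star> op_prod n As"
  by (simp add: op_prod_def)

lemma op_prod_in_ops: "set As \<subseteq> ops n \<Longrightarrow> op_prod n As \<in> ops n"
  by (induction As) (auto simp: op_prod_def intro: op_mult_in_ops)

lemma op_prod_append:
  "set Bs \<subseteq> ops n \<Longrightarrow> op_prod n (As @ Bs) = op_prod n As \<star> (op_prod n Bs :: ('v::finite, 'a::semiring_1) op)"
  using op_prod_in_ops[of Bs n]
  by (induction As) (auto simp: op_prod_def op_one_left op_mult_assoc)

lemma op_prod_place:
  "k + p \<le> n \<Longrightarrow> op_prod n (map (place n k p) As) = place n k p (op_prod p As)"
  by (induction As) (auto simp: op_prod_def place_one place_mult)

lemma op_prod_commute:
  fixes A :: "('v::finite, 'a::semiring_1) op"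
  assumes "A \<in> ops n" "\<And>B. B \<in> set Bs \<Longrightarrow> A \<star> B = B \<star> A"
  shows "A \<star> op_prod n Bs = op_prod n Bs \<star> A"
  using assms(2)
proof (induction Bs)
  case Nil
  then show ?case using assms(1) by (simp add: op_prod_def op_one_left op_one_right)
next
  case (Cons B Bs)
  then have "A \<star> B = B \<star> A" "A \<star> op_prod n Bs = op_prod n Bs \<star> A" by auto
  then show ?case by (metis op_prod_Cons op_mult_assoc)
qed

text \<open>Iterating \<open>wtrace (D_op R)\<close> yields the R-trace.\<close>

definition wtrace :: "('v::finite, 'a::semiring_1) op \<Rightarrow> ('v, 'a) op \<Rightarrow> ('v, 'a) op" where
  "wtrace D A xs ys = (\<Sum>a\<in>UNIV. \<Sum>b\<in>UNIV. D [b] [a] * A (xs @ [a]) (ys @ [b]))"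

lemma wtrace_in_ops: "A \<in> ops (Suc n) \<Longrightarrow> wtrace D A \<in> ops n"
  by (auto simp: ops_def wtrace_def)

text \<open>The entries of D stand leftmost in \<open>wtrace\<close>, so A must pass them to come
  out on the left; in \<open>wtrace_right\<close> the entries of B are at the far end
  already.\<close>

lemma wtrace_left:
  fixes A B :: "('v::finite, 'a::semiring_1) op"
  assumes "A \<in> ops n" "B \<in> ops (Suc n)" and comm: "\<And>xs ys c d. D c d * A xs ys = A xs ys * D c d"
  shows "wtrace D (place (Suc n) 0 n A \<star> B) = A \<star> wtrace D B"
proof (rule ops_eqI[of _ n])
  fix xs ys :: "'v list" assume len: "length xs = n" "length ys = n"
  have "(place (Suc n) 0 n A \<star> B) (xs @ [a]) (ys @ [b]) = (\<Sum>z | length z = n. A xs z * B (z @ [a]) (ys @ [b]))" for a b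
    using sum_place_right[of "[]" 0 xs n "[a]" "Suc n" A B "ys @ [b]"] len by simp
  then have "wtrace D (place (Suc n) 0 n A \<star> B) xs ys =
    (\<Sum>a\<in>UNIV. \<Sum>b\<in>UNIV. \<Sum>z | length z = n. D [b] [a] * (A xs z * B (z @ [a]) (ys @ [b])))"
    by (simp add: wtrace_def sum_distrib_left)
  also have "\<dots> = (\<Sum>a\<in>UNIV. \<Sum>z | length z = n. \<Sum>b\<in>UNIV. D [b] [a] * (A xs z * B (z @ [a]) (ys @ [b])))"
    by (rule sum.cong[OF refl], rule sum.swap)
  also have "\<dots> = (\<Sum>z | length z = n. \<Sum>a\<in>UNIV. \<Sum>b\<in>UNIV. D [b] [a] * (A xs z * B (z @ [a]) (ys @ [b])))"
    by (rule sum.swap)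
  also have "\<dots> = (A \<star> wtrace D B) xs ys"
    using len by (simp add: op_mult_def wtrace_def sum_distrib_left comm flip: mult.assoc)
  finally show "wtrace D (place (Suc n) 0 n A \<star> B) xs ys = (A \<star> wtrace D B) xs ys" .
qed (use assms in \<open>auto intro!: wtrace_in_ops op_mult_in_ops\<close>)

lemma wtrace_right:
  fixes A B :: "('v::finite, 'a::semiring_1) op"
  assumes "A \<in> ops (Suc n)" "B \<in> ops n"
  shows "wtrace D (A \<star> place (Suc n) 0 n B) = wtrace D A \<star> B"
proof (rule ops_eqI[of _ n])
  fix xs ys :: "'v list" assume len: "length xs = n" "length ys = n"
  have "(A \<star> place (Suc n) 0 n B) (xs @ [a]) (ys @ [b]) = (\<Sum>z | length z = n. A (xs @ [a]) (z @ [b]) * B z ys)" for a b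
    using sum_place_left[of "[]" 0 ys n "[b]" "Suc n" A B "xs @ [a]"] len by simp
  then have "wtrace D (A \<star> place (Suc n) 0 n B) xs ys =
    (\<Sum>a\<in>UNIV. \<Sum>b\<in>UNIV. \<Sum>z | length z = n. D [b] [a] * A (xs @ [a]) (z @ [b]) * B z ys)"
    by (simp add: wtrace_def sum_distrib_left mult.assoc)
  also have "\<dots> = (\<Sum>a\<in>UNIV. \<Sum>z | length z = n. \<Sum>b\<in>UNIV. D [b] [a] * A (xs @ [a]) (z @ [b]) * B z ys)"
    by (rule sum.cong[OF refl], rule sum.swap)
  also have "\<dots> = (\<Sum>z | length z = n. \<Sum>a\<in>UNIV. \<Sum>b\<in>UNIV. D [b] [a] * A (xs @ [a]) (z @ [b]) * B z ys)"
    by (rule sum.swap)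
  also have "\<dots> = (wtrace D A \<star> B) xs ys"
    using len by (simp add: op_mult_def wtrace_def sum_distrib_right)
  finally show "wtrace D (A \<star> place (Suc n) 0 n B) xs ys = (wtrace D A \<star> B) xs ys" .
qed (use assms in \<open>auto intro!: wtrace_in_ops op_mult_in_ops\<close>)

definition tensor_power :: "('v::finite, 'a::semiring_1) op \<Rightarrow> nat \<Rightarrow> ('v, 'a) op" where
  "tensor_power D n = op_prod n (map (\<lambda>i. leg1 n i D) [1..<Suc n])"

lemma leg1_place: "1 \<le> i \<Longrightarrow> i \<le> n \<Longrightarrow> leg1 (Suc n) i D = place (Suc n) 0 n (leg1 n i D)"
  by (simp add: leg1_eq_place place_place)

lemma leg1_in_ops [simp]: "leg1 n i D \<in> ops n"
  by (auto simp: ops_def leg1_def)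

lemma leg2_in_ops [simp]: "leg2 n i j D \<in> ops n"
  by (auto simp: ops_def leg2_def)

lemma tensor_power_in_ops [simp]: "tensor_power D n \<in> ops n"
  unfolding tensor_power_def by (intro op_prod_in_ops) auto

lemma tensor_power_Suc:
  "D \<in> ops 1 \<Longrightarrow> tensor_power D (Suc n) = place (Suc n) 0 n (tensor_power D n) \<star> place (Suc n) n 1 D"
proof -
  have "tensor_power D (Suc n) = op_prod (Suc n) (map (\<lambda>i. leg1 (Suc n) i D) [1..<Suc n]) \<star> leg1 (Suc n) (Suc n) D"
  proof -
    have *: "[1..<Suc (Suc n)] = [1..<Suc n] @ [Suc n]" by simp
    show ?thesis
      unfolding tensor_power_def * map_append
      by (subst op_prod_append) (auto simp: op_prod_Cons op_prod_def[of _ "[]"] op_one_right)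
  qed
  also have "map (\<lambda>i. leg1 (Suc n) i D) [1..<Suc n] = map (place (Suc n) 0 n) (map (\<lambda>i. leg1 n i D) [1..<Suc n])"
    by (auto simp: leg1_place)
  finally show ?thesis
    by (simp add: op_prod_place leg1_eq_place[of "Suc n" "Suc n"] tensor_power_def del: upt_Suc map_map)
qed

lemma tensor_power_snoc:
  assumes "D \<in> ops 1" "length xs = n" "length ys = n"
  shows "tensor_power D (Suc n) (xs @ [a]) (ys @ [b]) = tensor_power D n xs ys * D [a] [b]"
proof -
  have "tensor_power D (Suc n) (xs @ [a]) (ys @ [b]) =
      (\<Sum>z | length z = n. tensor_power D n xs z * place (Suc n) n 1 D (z @ [a] @ []) (ys @ [b] @ []))"
    unfolding tensor_power_Suc[OF assms(1)]
    using sum_place_right[of "[]" 0 xs n "[a]" "Suc n" "tensor_power D n" _ "ys @ [b]"] assms by simp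
  also have "\<dots> = (\<Sum>z | length z = n. if z = ys then tensor_power D n xs ys * D [a] [b] else 0)"
    by (rule sum.cong[OF refl], subst place_append) (use assms in auto)
  finally show ?thesis using assms by simp
qed

text \<open>The tensor power of D is a product over the positions, so the last pair of indices can
  be summed first. That sum is one \<open>wtrace\<close>; the other factors follow by
  induction.\<close>

lemma op_trace_wtrace:
  fixes D A :: "('v::finite, 'a::semiring_1) op"
  assumes "D \<in> ops 1"
  shows "op_trace n (tensor_power D n \<star> A) = (wtrace D ^^ n) A [] []"
proof (induction n arbitrary: A)
  case 0
  then show ?case by (simp add: op_trace_def op_mult_def tensor_power_def op_prod_def op_one_def)
next
  case (Suc n)
  have "op_trace (Suc n) (tensor_power D (Suc n) \<star> A) =
    (\<Sum>xs | length xs = n. \<Sum>b\<in>UNIV. \<Sum>ys | length ys = n. \<Sum>a\<in>UNIV.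
       tensor_power D n xs ys * (D [b] [a] * A (ys @ [a]) (xs @ [b])))"
    unfolding op_trace_def op_mult_def sum_length_snoc
    using assms by (auto simp: sum_length_snoc tensor_power_snoc mult.assoc intro!: sum.cong)
  also have "\<dots> = (\<Sum>xs | length xs = n. \<Sum>ys | length ys = n. \<Sum>b\<in>UNIV. \<Sum>a\<in>UNIV.
       tensor_power D n xs ys * (D [b] [a] * A (ys @ [a]) (xs @ [b])))"
    by (rule sum.cong[OF refl], rule sum.swap)
  also have "\<dots> = (\<Sum>xs | length xs = n. \<Sum>ys | length ys = n. \<Sum>a\<in>UNIV. \<Sum>b\<in>UNIV.
       tensor_power D n xs ys * (D [b] [a] * A (ys @ [a]) (xs @ [b])))"
    by (rule sum.cong[OF refl], rule sum.cong[OF refl], rule sum.swap)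
  also have "\<dots> = op_trace n (tensor_power D n \<star> wtrace D A)"
    unfolding op_trace_def op_mult_def wtrace_def by (auto simp: sum_distrib_left intro!: sum.cong)
  finally show ?case by (simp add: Suc funpow_swap1)
qed

section \<open>Skew inverses and the matrix D_R\<close>

lemma ptrace_2_legs:
  fixes A B :: "('v::finite, 'a::semiring_1) op"
  shows "ptrace 2 (leg2 3 1 2 A \<star> leg2 3 2 3 B) [a, f] [c, g] = (\<Sum>b\<in>UNIV. \<Sum>e\<in>UNIV. A [a, b] [c, e] * B [e, f] [b, g])"
proof -
  have leg: "leg2 3 1 2 A = place 3 0 2 A" "leg2 3 2 3 B = place 3 1 2 B" for A B :: "('v, 'a) op"
    using adj_eq_place[of 1 3 A] adj_eq_place[of 2 3 B] by (simp_all add: numeral_2_eq_2 numeral_3_eq_3)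
  have "(place 3 0 2 A \<star> place 3 1 2 B) [a, b, f] [c, b, g] = (\<Sum>e\<in>UNIV. A [a, b] [c, e] * B [e, f] [b, g])" for b
  proof -
    have "(place 3 0 2 A \<star> place 3 1 2 B) ([] @ [a, b] @ [f]) [c, b, g] =
      (\<Sum>z | length z = 2. A [a, b] z * place 3 1 2 B (z @ [f]) [c, b, g])"
      by (subst sum_place_right) auto
    also have "\<dots> = (\<Sum>d\<in>UNIV. \<Sum>e\<in>UNIV. A [a, b] [d, e] * place 3 1 2 B ([d] @ [e, f] @ []) ([c] @ [b, g] @ []))"
      by (simp add: sum_length_2)
    also have "\<dots> = (\<Sum>d\<in>UNIV. if d = c then \<Sum>e\<in>UNIV. A [a, b] [c, e] * B [e, f] [b, g] else 0)"
    proof (rule sum.cong[OF refl])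
      fix d
      show "(\<Sum>e\<in>UNIV. A [a, b] [d, e] * place 3 1 2 B ([d] @ [e, f] @ []) ([c] @ [b, g] @ [])) =
        (if d = c then \<Sum>e\<in>UNIV. A [a, b] [c, e] * B [e, f] [b, g] else 0)"
        by (subst place_append) auto
    qed
    finally show ?thesis by simp
  qed
  then show ?thesis
    unfolding leg by (simp add: ptrace_def)
qed

lemma flip_pair: "flip [a, f] [c, g] = (if a = g \<and> f = c then 1 else 0)"
  by (auto simp: flip_def)

lemma skew_inverse_index:
  assumes "is_skew_inverse A \<Psi>"
  shows "(\<Sum>b\<in>UNIV. \<Sum>e\<in>UNIV. A [a, b] [c, e] * \<Psi> [e, f] [b, g]) = (if a = g \<and> f = c then 1 else 0)"
    and "(\<Sum>b\<in>UNIV. \<Sum>e\<in>UNIV. \<Psi> [a, b] [c, e] * A [e, f] [b, g]) = (if a = g \<and> f = c then 1 else 0)"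
  using assms unfolding is_skew_inverse_def by (simp_all only: flip: ptrace_2_legs flip_pair)

lemma sum_swap_pairs:
  "(\<Sum>a\<in>A. \<Sum>b\<in>B. \<Sum>c\<in>C. \<Sum>d\<in>D. f a b c d) = (\<Sum>c\<in>C. \<Sum>d\<in>D. \<Sum>a\<in>A. \<Sum>b\<in>B. f a b c d)"
proof -
  have "(\<Sum>a\<in>A. \<Sum>b\<in>B. \<Sum>c\<in>C. \<Sum>d\<in>D. f a b c d) = (\<Sum>a\<in>A. \<Sum>c\<in>C. \<Sum>b\<in>B. \<Sum>d\<in>D. f a b c d)"
    by (rule sum.cong[OF refl], rule sum.swap)
  also have "\<dots> = (\<Sum>c\<in>C. \<Sum>a\<in>A. \<Sum>b\<in>B. \<Sum>d\<in>D. f a b c d)"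
    by (rule sum.swap)
  also have "\<dots> = (\<Sum>c\<in>C. \<Sum>a\<in>A. \<Sum>d\<in>D. \<Sum>b\<in>B. f a b c d)"
    by (rule sum.cong[OF refl], rule sum.cong[OF refl], rule sum.swap)
  also have "\<dots> = (\<Sum>c\<in>C. \<Sum>d\<in>D. \<Sum>a\<in>A. \<Sum>b\<in>B. f a b c d)"
    by (rule sum.cong[OF refl], rule sum.swap)
  finally show ?thesis .
qed

text \<open>Grouping the indices of A as (a, c) against (b, e) turns the partial trace in the
  definition of \<Psi> into a product of matrices. So \<Psi> is an ordinary inverse of the
  rearranged A, and a linear system with these coefficients can be solved for h.\<close>

lemma skew_cancel:
  assumes "is_skew_inverse A \<Psi>" "\<And>a c. (\<Sum>b\<in>UNIV. \<Sum>e\<in>UNIV. A [a, b] [c, e] * h e b) = t a c"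
  shows "h x y = (\<Sum>b\<in>UNIV. \<Sum>e\<in>UNIV. \<Psi> [x, b] [y, e] * t e b)"
proof -
  have "(\<Sum>b\<in>UNIV. \<Sum>e\<in>UNIV. \<Psi> [x, b] [y, e] * t e b) =
    (\<Sum>b\<in>UNIV. \<Sum>e\<in>UNIV. \<Sum>b'\<in>UNIV. \<Sum>e'\<in>UNIV. \<Psi> [x, b] [y, e] * A [e, b'] [b, e'] * h e' b')"
    unfolding assms(2)[symmetric] sum_distrib_left mult.assoc ..
  also have "\<dots> = (\<Sum>b'\<in>UNIV. \<Sum>e'\<in>UNIV. (\<Sum>b\<in>UNIV. \<Sum>e\<in>UNIV. \<Psi> [x, b] [y, e] * A [e, b'] [b, e']) * h e' b')"
    unfolding sum_distrib_right by (rule sum_swap_pairs)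
  also have "\<dots> = (\<Sum>b'\<in>UNIV. \<Sum>e'\<in>UNIV. if b' = y then if e' = x then h x y else 0 else 0)"
    unfolding skew_inverse_index(2)[OF assms(1)] by (intro sum.cong) auto
  also have "\<dots> = h x y"
    by (subst sum.swap) simp
  finally show ?thesis by simp
qed

text \<open>For fixed b and d the entries of \<Psi> and of \<Psi>' solve the same linear system, to
  which \<open>skew_cancel\<close> gives only one solution. This justifies the \<open>THE\<close> in
  \<open>skew_inverse\<close>.\<close>

lemma skew_inverse_unique:
  assumes "is_skew_inverse A \<Psi>" "is_skew_inverse A \<Psi>'"
  shows "\<Psi> = \<Psi>'"
proof (rule ops_eqI[of _ 2])
  fix xs ys :: "'a list" assume "length xs = 2" "length ys = 2"
  then obtain a b c d where "xs = [a, b]" "ys = [c, d]"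
    by (auto simp: numeral_2_eq_2 length_Suc_conv)
  moreover have "\<Psi> [a, b] [c, d] = \<Psi>' [a, b] [c, d]"
    using skew_cancel[OF assms(1), of "\<lambda>x y. \<Psi>' [x, b] [y, d]" "\<lambda>a c. if a = d \<and> b = c then 1 else 0" a c,
      OF skew_inverse_index(1)[OF assms(2)]]
      skew_cancel[OF assms(1), of "\<lambda>x y. \<Psi> [x, b] [y, d]" "\<lambda>a c. if a = d \<and> b = c then 1 else 0" a c,
      OF skew_inverse_index(1)[OF assms(1)]] by simp
  ultimately show "\<Psi> xs ys = \<Psi>' xs ys" by simp
qed (use assms in \<open>auto simp: is_skew_inverse_def\<close>)

lemma skew_inverse: "skew_invertible A \<Longrightarrow> is_skew_inverse A (skew_inverse A)"
  unfolding skew_inverse_def skew_invertible_def by (metis theI skew_inverse_unique)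

lemma D_op_in_ops: "skew_invertible A \<Longrightarrow> D_op A \<in> ops 1"
proof -
  have len: "length (take 1 zs @ a # drop 1 zs) = Suc (length zs)" for zs :: "'a list" and a
    by (cases zs) auto
  assume "skew_invertible A"
  then have "skew_inverse A \<in> ops 2"
    using skew_inverse[of A] by (simp add: is_skew_inverse_def)
  then show ?thesis
    using len by (auto simp: D_op_def ptrace_def ops_def intro!: sum.neutral)
qed

lemma D_op_index: "D_op A [e] [b] = (\<Sum>f\<in>UNIV. skew_inverse A [e, f] [b, f])"
  by (simp add: D_op_def ptrace_def)

text \<open>This is Tr_(2) R_12 D_2 = I: put g = f in the defining identity of the skew inverse and
  sum over f.\<close>

lemma D_op_trace:
  assumes "skew_invertible A"
  shows "(\<Sum>b\<in>UNIV. \<Sum>e\<in>UNIV. A [a, b] [c, e] * D_op A [e] [b]) = (if a = c then 1 else 0)"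
proof -
  have "(\<Sum>b\<in>UNIV. \<Sum>e\<in>UNIV. A [a, b] [c, e] * D_op A [e] [b]) =
    (\<Sum>f\<in>UNIV. \<Sum>b\<in>UNIV. \<Sum>e\<in>UNIV. A [a, b] [c, e] * skew_inverse A [e, f] [b, f])"
  proof -
    have "(\<Sum>b\<in>UNIV. \<Sum>e\<in>UNIV. A [a, b] [c, e] * D_op A [e] [b]) =
      (\<Sum>b\<in>UNIV. \<Sum>f\<in>UNIV. \<Sum>e\<in>UNIV. A [a, b] [c, e] * skew_inverse A [e, f] [b, f])"
      unfolding D_op_index sum_distrib_left by (rule sum.cong[OF refl], rule sum.swap)
    then show ?thesis by (simp only:) (rule sum.swap)
  qed
  also have "\<dots> = (\<Sum>f\<in>UNIV. if f = a then if a = c then 1 else 0 else 0)"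
    unfolding skew_inverse_index(1)[OF skew_inverse[OF assms]] by (intro sum.cong) auto
  finally show ?thesis by simp
qed

lemma sum_rearrange5:
  "(\<Sum>a\<in>A. \<Sum>b\<in>B. \<Sum>c\<in>C. \<Sum>d\<in>D. \<Sum>e\<in>E. f a b c d e) = (\<Sum>c\<in>C. \<Sum>e\<in>E. \<Sum>a\<in>A. \<Sum>b\<in>B. \<Sum>d\<in>D. f a b c d e)"
proof -
  have "(\<Sum>a\<in>A. \<Sum>b\<in>B. \<Sum>c\<in>C. \<Sum>d\<in>D. \<Sum>e\<in>E. f a b c d e) = (\<Sum>a\<in>A. \<Sum>b\<in>B. \<Sum>c\<in>C. \<Sum>e\<in>E. \<Sum>d\<in>D. f a b c d e)"
    by (rule sum.cong[OF refl], rule sum.cong[OF refl], rule sum.cong[OF refl], rule sum.swap)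
  then show ?thesis by (simp only:) (rule sum_swap_pairs)
qed

section \<open>Partial traces of conjugated operators\<close>

lemma conj_index:
  fixes G A G' :: "('v::finite, 'a::semiring_1) op"
  assumes "length u = n" "length u' = n"
  shows "(place (n + 2) n 2 G \<star> place (n + 2) 0 (n + 1) A \<star> place (n + 2) n 2 G') (u @ [c, a]) (u' @ [d, b]) =
    (\<Sum>c1\<in>UNIV. \<Sum>e\<in>UNIV. \<Sum>d1\<in>UNIV. G [c, a] [c1, e] * (A (u @ [c1]) (u' @ [d1]) * G' [d1, e] [d, b]))"
proof -
  let ?A = "place (n + 2) 0 (n + 1) A" and ?G' = "place (n + 2) n 2 G'"
  have "(?A \<star> ?G') (u @ [c1, e]) (u' @ [d, b]) = (\<Sum>d1\<in>UNIV. A (u @ [c1]) (u' @ [d1]) * G' [d1, e] [d, b])" for c1 e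
  proof -
    have "(?A \<star> ?G') (u @ [c1, e]) (u' @ [d, b] @ []) =
        (\<Sum>z | length z = 2. ?A (u @ [c1, e]) (u' @ z @ []) * G' z [d, b])"
      by (subst sum_place_left) (use assms in auto)
    also have "\<dots> = (\<Sum>d1\<in>UNIV. \<Sum>e1\<in>UNIV. ?A ([] @ (u @ [c1]) @ [e]) ([] @ (u' @ [d1]) @ [e1]) * G' [d1, e1] [d, b])"
      by (simp add: sum_length_2)
    also have "\<dots> = (\<Sum>d1\<in>UNIV. \<Sum>e1\<in>UNIV. if e = e1 then A (u @ [c1]) (u' @ [d1]) * G' [d1, e] [d, b] else 0)"
      by (subst place_append) (use assms in \<open>auto intro!: sum.cong simp: if_distrib[of "\<lambda>x. x * _"] cong: if_cong\<close>)
    finally show ?thesis by simp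
  qed
  moreover have "(place (n + 2) n 2 G \<star> (?A \<star> ?G')) (u @ [c, a] @ []) (u' @ [d, b]) =
      (\<Sum>z | length z = 2. G [c, a] z * (?A \<star> ?G') (u @ z @ []) (u' @ [d, b]))"
    by (subst sum_place_right) (use assms in auto)
  ultimately show ?thesis
    by (simp add: op_mult_assoc sum_length_2 sum_distrib_left)
qed

text \<open>\<open>star\<close> is the coordinate form of Tr_(2) D_2 G X_1 G' = Tr(D X) I for X a
  matrix unit. An operator A on n factors is treated as such an X in its last factor, its other
  indices being parameters. \<open>comm\<close> lets the entries of G' pass those of A.\<close>

lemma wtrace_conj:
  fixes G A G' D :: "('v::finite, 'a::semiring_1) op"
  assumes n: "1 \<le> n" and A: "A \<in> ops n"
    and star: "\<And>c d c1 d1. (\<Sum>a\<in>UNIV. \<Sum>b\<in>UNIV. \<Sum>e\<in>UNIV. D [b] [a] * G [c, a] [c1, e] * G' [d1, e] [d, b]) =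
      (if c = d then D [d1] [c1] else 0)"
    and comm: "\<And>xs ys x. G' xs ys * x = x * G' xs ys"
  shows "wtrace D (adj (Suc n) n G \<star> place (Suc n) 0 n A \<star> adj (Suc n) n G') = place n 0 (n - 1) (wtrace D A)"
proof -
  obtain m where m: "n = Suc m" using n by (cases n) auto
  have adj: "adj (Suc n) n B = place (m + 2) m 2 B" for B :: "('v, 'a) op"
    using n by (simp add: adj_eq_place m)
  have [simp]: "place (Suc n) 0 n A = place (m + 2) 0 (m + 1) A" by (simp add: m)
  show ?thesis
  proof (rule ops_eqI[of _ n])
    fix xs ys :: "'v list" assume "length xs = n" "length ys = n"
    then obtain u c u' d where xs: "xs = u @ [c]" "length u = m" and ys: "ys = u' @ [d]" "length u' = m"
      by (auto simp: m length_Suc_conv_rev)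
    have "wtrace D (adj (Suc n) n G \<star> place (Suc n) 0 n A \<star> adj (Suc n) n G') xs ys =
      (\<Sum>a\<in>UNIV. \<Sum>b\<in>UNIV. \<Sum>c1\<in>UNIV. \<Sum>e\<in>UNIV. \<Sum>d1\<in>UNIV.
         D [b] [a] * G [c, a] [c1, e] * G' [d1, e] [d, b] * A (u @ [c1]) (u' @ [d1]))"
      using conj_index[OF xs(2) ys(2), of G A G']
      by (simp add: wtrace_def adj xs ys sum_distrib_left mult.assoc comm)
    also have "\<dots> = (\<Sum>c1\<in>UNIV. \<Sum>d1\<in>UNIV. (\<Sum>a\<in>UNIV. \<Sum>b\<in>UNIV. \<Sum>e\<in>UNIV.
         D [b] [a] * G [c, a] [c1, e] * G' [d1, e] [d, b]) * A (u @ [c1]) (u' @ [d1]))"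
      unfolding sum_distrib_right by (rule sum_rearrange5)
    also have "\<dots> = (if c = d then wtrace D A u u' else 0)"
      by (simp add: star wtrace_def)
    also have "\<dots> = place n 0 (n - 1) (wtrace D A) ([] @ u @ [c]) ([] @ u' @ [d])"
      by (subst place_append) (use xs ys m in auto)
    finally show "wtrace D (adj (Suc n) n G \<star> place (Suc n) 0 n A \<star> adj (Suc n) n G') xs ys =
        place n 0 (n - 1) (wtrace D A) xs ys"
      by (simp add: xs ys)
  qed (auto intro!: wtrace_in_ops op_mult_in_ops simp: m)
qed

lemma ops2_eqI:
  assumes "A \<in> ops 2" "B \<in> ops 2" "\<And>a b c d. A [a, b] [c, d] = B [a, b] [c, d]"
  shows "A = B"
proof (rule ops_eqI[OF assms(1,2)])
  fix xs ys :: "'a list" assume "length xs = 2" "length ys = 2"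
  then show "A xs ys = B xs ys" using assms(3) by (auto simp: numeral_2_eq_2 length_Suc_conv)
qed

text \<open>
  The compatibility relation turns $\mathrm{Tr}_{(3)} D_3 G_2 R_1 G_2'$ into
  $G_1' (\mathrm{Tr}_{(3)} D_3 R_2) G_1 = I$, and the components of \<open>R\<close> can be cancelled by skew invertibility.
\<close>

lemma wtrace_star:
  fixes R G G' :: "('v::finite, complex) op"
  assumes R: "skew_invertible R" and G: "G \<in> ops 2" "G' \<in> ops 2" "G' \<star> G = op_one 2"
    and rel: "adj 3 2 G \<star> adj 3 1 R \<star> adj 3 2 G' = adj 3 1 G' \<star> adj 3 2 R \<star> adj 3 1 G"
  shows "(\<Sum>a\<in>UNIV. \<Sum>b\<in>UNIV. \<Sum>e\<in>UNIV. D_op R [b] [a] * G [c, a] [c1, e] * G' [d1, e] [d, b]) =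
      (if c = d then D_op R [d1] [c1] else 0)"
proof -
  let ?D = "D_op R"
  define \<phi> where "\<phi> d1 c1 = (\<Sum>a\<in>UNIV. \<Sum>b\<in>UNIV. \<Sum>e\<in>UNIV. ?D [b] [a] * G [c, a] [c1, e] * G' [d1, e] [d, b])" for d1 c1
  have 1: "wtrace ?D (adj 3 2 R) = op_one 2"
  proof (rule ops2_eqI)
    show "wtrace ?D (adj 3 2 R) \<in> ops 2"
      by (rule wtrace_in_ops) (simp add: numeral_3_eq_3 numeral_2_eq_2)
    fix x c y d :: 'v
    have "adj 3 2 R [x, c, a] [y, d, b] = (if x = y then R [c, a] [d, b] else 0)" for a b
      using place_append[of "[x]" 1 "[y]" "[c, a]" 2 "[d, b]" "[]" 3 "[]" R] adj_eq_place[of 2 3 R] by simp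
    then have "wtrace ?D (adj 3 2 R) [x, c] [y, d] = (if x = y then \<Sum>a\<in>UNIV. \<Sum>b\<in>UNIV. R [c, a] [d, b] * ?D [b] [a] else 0)"
      by (simp add: wtrace_def mult.commute)
    also have "\<dots> = op_one 2 [x, c] [y, d]"
      by (simp add: D_op_trace[OF R] op_one_def)
    finally show "wtrace ?D (adj 3 2 R) [x, c] [y, d] = op_one 2 [x, c] [y, d]" .
  qed auto
  have adj1: "adj 3 1 A = place (Suc 2) 0 2 A" for A :: "('v, complex) op"
    by (simp add: adj_eq_place numeral_3_eq_3 numeral_2_eq_2)
  have "wtrace ?D (adj 3 1 G' \<star> adj 3 2 R \<star> adj 3 1 G) = wtrace ?D (adj 3 1 G' \<star> adj 3 2 R) \<star> G"
    unfolding adj1 by (rule wtrace_right) (use G in \<open>auto intro: op_mult_in_ops simp: numeral_3_eq_3\<close>)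
  also have "wtrace ?D (adj 3 1 G' \<star> adj 3 2 R) = G' \<star> wtrace ?D (adj 3 2 R)"
    unfolding adj1 by (rule wtrace_left) (use G in \<open>auto intro: op_mult_in_ops simp: numeral_3_eq_3\<close>)
  finally have one: "wtrace ?D (adj 3 2 G \<star> adj 3 1 R \<star> adj 3 2 G') = op_one 2"
    unfolding rel by (simp only: 1 op_one_right[OF G(2)] G(3))
  have adj: "adj 3 1 A = place (1 + 2) 0 (1 + 1) A" "adj 3 2 A = place (1 + 2) 1 2 A" for A :: "('v, complex) op"
    by (simp_all add: adj_eq_place numeral_3_eq_3 numeral_2_eq_2)
  have "(\<Sum>c1\<in>UNIV. \<Sum>d1\<in>UNIV. R [x, c1] [y, d1] * \<phi> d1 c1) = (if x = y \<and> c = d then 1 else 0)" for x y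
  proof -
    have "wtrace ?D (adj 3 2 G \<star> adj 3 1 R \<star> adj 3 2 G') [x, c] [y, d] =
      (\<Sum>a\<in>UNIV. \<Sum>b\<in>UNIV. \<Sum>c1\<in>UNIV. \<Sum>e\<in>UNIV. \<Sum>d1\<in>UNIV.
         R [x, c1] [y, d1] * (?D [b] [a] * G [c, a] [c1, e] * G' [d1, e] [d, b]))"
      unfolding adj wtrace_def using conj_index[of "[x]" 1 "[y]" G R G' c _ d]
      by (simp add: sum_distrib_left mult_ac)
    also have "\<dots> = (\<Sum>c1\<in>UNIV. \<Sum>d1\<in>UNIV. R [x, c1] [y, d1] * \<phi> d1 c1)"
      unfolding \<phi>_def sum_distrib_left by (rule sum_rearrange5)
    finally show ?thesis unfolding one by (simp add: op_one_def)
  qed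
  note \<phi> = skew_cancel[OF skew_inverse[OF R] this]
  \<comment> \<open>By \<open>D_op_trace\<close> the expected value solves the system that \<phi>
    has just been shown to solve.\<close>
  have "(\<Sum>c1\<in>UNIV. \<Sum>d1\<in>UNIV. R [x, c1] [y, d1] * (if c = d then ?D [d1] [c1] else 0)) =
      (if x = y \<and> c = d then 1 else 0)" for x y
    using D_op_trace[OF R, of x y] by (cases "c = d") auto
  note D = skew_cancel[OF skew_inverse[OF R] this]
  have "\<phi> d1 c1 = (if c = d then ?D [d1] [c1] else 0)"
    by (rule trans[OF \<phi> D[symmetric]])
  then show ?thesis
    unfolding \<phi>_def .
qed

lemma tensor_power_2: "D \<in> ops 1 \<Longrightarrow> tensor_power D 2 [a, b] [c, d] = D [a] [c] * D [b] [d]"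
  using tensor_power_snoc[of D "[a]" 1 "[c]" b d] tensor_power_snoc[of D "[]" 0 "[]" a c]
  by (simp add: numeral_2_eq_2) (simp add: tensor_power_def op_prod_def op_one_def)

text \<open>\<open>wtrace_star\<close> for (G, G') = (R, R') and for (R', R) gives two linear
  systems with coefficients R. Their solutions express R' D_2 and D_2 R' through the skew inverse
  and one D. Multiplied by the second D, both become the same sum of terms D \<Psi> D.\<close>

lemma tensor_power_2_commute_inverse:
  fixes R R' :: "('v::finite, complex) op"
  assumes R: "skew_invertible R" "R \<in> ops 2" and R': "R' \<in> ops 2" "R \<star> R' = op_one 2" "R' \<star> R = op_one 2"
    and rel: "adj 3 2 R \<star> adj 3 1 R \<star> adj 3 2 R' = adj 3 1 R' \<star> adj 3 2 R \<star> adj 3 1 R"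
      "adj 3 2 R' \<star> adj 3 1 R \<star> adj 3 2 R = adj 3 1 R \<star> adj 3 2 R \<star> adj 3 1 R'"
  shows "tensor_power (D_op R) 2 \<star> R' = R' \<star> tensor_power (D_op R) 2"
proof (rule ops2_eqI)
  let ?D = "D_op R" and ?\<Psi> = "skew_inverse R"
  note cancel = skew_cancel[OF skew_inverse[OF R(1)]]
  have R'D: "(\<Sum>b\<in>UNIV. R' [d1, x] [d, b] * ?D [b] [y]) = (\<Sum>b\<in>UNIV. ?D [d1] [b] * ?\<Psi> [x, b] [y, d])" for d1 x d y
  proof -
    have "(\<Sum>a\<in>UNIV. \<Sum>e\<in>UNIV. R [c, a] [c1, e] * (\<Sum>b\<in>UNIV. R' [d1, e] [d, b] * ?D [b] [a])) =
      (if c = d then ?D [d1] [c1] else 0)" for c c1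
    proof -
      have "(\<Sum>a\<in>UNIV. \<Sum>e\<in>UNIV. R [c, a] [c1, e] * (\<Sum>b\<in>UNIV. R' [d1, e] [d, b] * ?D [b] [a])) =
        (\<Sum>a\<in>UNIV. \<Sum>b\<in>UNIV. \<Sum>e\<in>UNIV. ?D [b] [a] * R [c, a] [c1, e] * R' [d1, e] [d, b])"
        by (simp add: sum_distrib_left mult_ac) (rule sum.cong[OF refl], rule sum.swap)
      then show ?thesis using wtrace_star[OF R R'(1,3) rel(1)] by simp
    qed
    note cancel[OF this, of x y]
    then show ?thesis by (simp add: if_distrib[of "(*) _"] mult.commute cong: if_cong)
  qed
  have DR': "(\<Sum>a\<in>UNIV. ?D [x] [a] * R' [c, a] [c1, y]) = (\<Sum>e\<in>UNIV. ?\<Psi> [x, c] [y, e] * ?D [e] [c1])" for x c c1 y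
  proof -
    have "(\<Sum>e\<in>UNIV. \<Sum>b\<in>UNIV. R [d1, e] [d, b] * (\<Sum>a\<in>UNIV. ?D [b] [a] * R' [c, a] [c1, e])) =
      (if c = d then ?D [d1] [c1] else 0)" for d1 d
    proof -
      have "(\<Sum>e\<in>UNIV. \<Sum>b\<in>UNIV. R [d1, e] [d, b] * (\<Sum>a\<in>UNIV. ?D [b] [a] * R' [c, a] [c1, e])) =
        (\<Sum>e\<in>UNIV. \<Sum>b\<in>UNIV. \<Sum>a\<in>UNIV. ?D [b] [a] * R' [c, a] [c1, e] * R [d1, e] [d, b])"
        by (simp add: sum_distrib_left mult_ac)
      also have "\<dots> = (\<Sum>b\<in>UNIV. \<Sum>e\<in>UNIV. \<Sum>a\<in>UNIV. ?D [b] [a] * R' [c, a] [c1, e] * R [d1, e] [d, b])"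
        by (rule sum.swap)
      also have "\<dots> = (\<Sum>b\<in>UNIV. \<Sum>a\<in>UNIV. \<Sum>e\<in>UNIV. ?D [b] [a] * R' [c, a] [c1, e] * R [d1, e] [d, b])"
        by (rule sum.cong[OF refl], rule sum.swap)
      also have "\<dots> = (\<Sum>a\<in>UNIV. \<Sum>b\<in>UNIV. \<Sum>e\<in>UNIV. ?D [b] [a] * R' [c, a] [c1, e] * R [d1, e] [d, b])"
        by (rule sum.swap)
      finally show ?thesis using wtrace_star[OF R(1) R'(1) R(2) R'(2) rel(2)] by simp
    qed
    note cancel[OF this, of x y]
    then show ?thesis by (simp add: if_distrib[of "(*) _"] cong: if_cong) (subst sum.swap, simp)
  qed
  have D: "?D \<in> ops 1" by (rule D_op_in_ops[OF R(1)])
  fix a b c d :: 'v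
  have "(tensor_power ?D 2 \<star> R') [a, b] [c, d] = (\<Sum>x\<in>UNIV. ?D [a] [x] * (\<Sum>y\<in>UNIV. ?D [b] [y] * R' [x, y] [c, d]))"
    by (simp add: op_mult_def sum_length_Suc tensor_power_2[OF D] sum_distrib_left mult.assoc)
  also have "\<dots> = (\<Sum>x\<in>UNIV. \<Sum>e\<in>UNIV. ?D [a] [x] * ?\<Psi> [b, x] [d, e] * ?D [e] [c])"
    by (simp add: DR' sum_distrib_left mult.assoc)
  also have "\<dots> = (\<Sum>e\<in>UNIV. (\<Sum>x\<in>UNIV. ?D [a] [x] * ?\<Psi> [b, x] [d, e]) * ?D [e] [c])"
    unfolding sum_distrib_right by (rule sum.swap)
  also have "\<dots> = (R' \<star> tensor_power ?D 2) [a, b] [c, d]"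
    by (simp add: op_mult_def sum_length_Suc tensor_power_2[OF D] sum_distrib_left sum_distrib_right mult_ac flip: R'D)
  finally show "(tensor_power ?D 2 \<star> R') [a, b] [c, d] = (R' \<star> tensor_power ?D 2) [a, b] [c, d]" .
qed (use R' in \<open>auto intro: op_mult_in_ops\<close>)

section \<open>The R-trace of quantum matrices\<close>

lemma const_simps: "const 0 = 0" "const 1 = 1" "const (a + b) = const a + const b" "const (a * b) = const a * const b"
  by (simp_all add: const_def single_add mult_single)

lemma const_sum: "const (sum f A) = (\<Sum>x\<in>A. const (f x))"
  by (induction A rule: infinite_finite_induct) (auto simp: const_simps)

lemma const_central: "const c * x = x * const c"
proof (induction x rule: Poly_Mapping.update_induct)
  case const
  then show ?case by simp
next
  case (update x k v)
  have "Poly_Mapping.update k v x = x + Poly_Mapping.single k v"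
    using update by (intro poly_mapping_eqI)
      (auto simp: lookup_update lookup_add lookup_single when_def in_keys_iff)
  moreover have "const c * Poly_Mapping.single k v = Poly_Mapping.single k v * const c"
    by (simp add: const_def mult_single mult.commute)
  ultimately show ?case using update by (simp add: algebra_simps)
qed

lemma const_op_mult: "const_op (A \<star> B) = const_op A \<star> const_op B"
  by (intro ext) (simp add: const_op_def op_mult_def const_sum const_simps)

lemma const_op_place: "const_op (place n k p A) = place n k p (const_op A)"
  by (intro ext) (auto simp: const_op_def place_def const_simps)

lemma const_op_leg: "const_op (leg1 n i A) = leg1 n i (const_op A)" "const_op (leg2 n i j A) = leg2 n i j (const_op A)"
  by (intro ext; auto simp: const_op_def leg1_def leg2_def const_simps(1))+

lemma const_op_one: "const_op (op_one n) = op_one n"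
  by (intro ext) (auto simp: const_op_def op_one_def const_simps)

lemma const_op_in_ops: "A \<in> ops n \<Longrightarrow> const_op A \<in> ops n"
  by (auto simp: ops_def const_op_def const_simps)

lemma const_op_central: "const_op A xs ys * x = x * const_op A xs ys"
  by (simp add: const_op_def const_central)

lemma adj_mult: "1 \<le> i \<Longrightarrow> i < n \<Longrightarrow> adj n i (A \<star> B) = adj n i A \<star> adj n i B"
  by (simp add: adj_eq_place place_mult)

lemma adj_one: "1 \<le> i \<Longrightarrow> i < n \<Longrightarrow> adj n i (op_one 2) = op_one n"
  by (simp add: adj_eq_place place_one)

lemma adj_lift3:
  assumes "1 \<le> i" "Suc i < n"
  shows "place n (i - 1) 3 (adj 3 1 A) = adj n i A" "place n (i - 1) 3 (adj 3 2 A) = adj n (Suc i) A"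
proof -
  have "adj 3 1 A = place 3 0 2 A" "adj 3 2 A = place 3 1 2 A"
    using adj_eq_place[of 1 3 A] adj_eq_place[of 2 3 A] by simp_all
  then show "place n (i - 1) 3 (adj 3 1 A) = adj n i A" "place n (i - 1) 3 (adj 3 2 A) = adj n (Suc i) A"
    using assms by (simp_all only: adj_eq_place) (subst place_place; simp)+
qed

lemma adj_lift:
  assumes "adj 3 1 A \<star> adj 3 2 B \<star> adj 3 1 C = adj 3 2 A' \<star> adj 3 1 B' \<star> adj 3 2 C'" and i: "1 \<le> i" "Suc i < n"
  shows "adj n i A \<star> adj n (Suc i) B \<star> adj n i C = adj n (Suc i) A' \<star> adj n i B' \<star> adj n (Suc i) C'"
proof -
  have "place n (i - 1) 3 (adj 3 1 A \<star> adj 3 2 B \<star> adj 3 1 C) = place n (i - 1) 3 (adj 3 2 A' \<star> adj 3 1 B' \<star> adj 3 2 C')"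
    using assms by simp
  moreover have "i - 1 + 3 \<le> n" using i by simp
  ultimately show ?thesis by (simp only: place_mult adj_lift3[OF i])
qed

lemma adj_far:
  fixes A B :: "('v::finite, 'a::comm_semiring_1) op"
  assumes "1 \<le> i" "i + 2 \<le> j" "j < n"
  shows "adj n i A \<star> adj n j B = adj n j B \<star> adj n i A"
  using assms by (auto simp: adj_eq_place mult.commute intro!: place_commute)

lemma monoid_End: "monoid (End n)"
  by (rule monoidI) (auto simp: End_def op_mult_in_ops op_mult_assoc op_one_left op_one_right)

lemma Units_End:
  assumes "A \<in> Units (End n)"
  shows "A \<in> ops n" "inv\<^bsub>End n\<^esub> A \<in> ops n" "A \<star> inv\<^bsub>End n\<^esub> A = op_one n" "inv\<^bsub>End n\<^esub> A \<star> A = op_one n"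
  using monoid.Units_inv_closed[OF monoid_End assms] monoid.Units_closed[OF monoid_End assms]
    monoid.Units_r_inv[OF monoid_End assms] monoid.Units_l_inv[OF monoid_End assms]
  by (simp_all add: End_def)

lemma op_mult_left_cong: "A \<star> B = C \<Longrightarrow> A \<star> (B \<star> Z) = C \<star> Z"
  by (simp flip: op_mult_assoc)

lemma conj_rel:
  fixes A B P P' :: "('v::finite, 'a::semiring_1) op"
  assumes "A \<star> P = P \<star> B" "P \<star> P' = op_one n" "P' \<star> P = op_one n" "A \<in> ops n" "B \<in> ops n" "P' \<in> ops n"
  shows "P' \<star> A = B \<star> P'"
proof -
  have "P' \<star> A = P' \<star> (A \<star> P) \<star> P'" using assms(2,4) by (simp only: op_mult_assoc op_one_right)
  also have "\<dots> = (P' \<star> P) \<star> B \<star> P'" by (simp only: assms(1) op_mult_assoc)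
  also have "\<dots> = B \<star> P'" using assms by (simp only: op_one_left)
  finally show ?thesis .
qed

lemma conj_swap:
  fixes A B U V U' V' :: "('v::finite, 'a::semiring_1) op"
  assumes "A \<star> U \<star> V = U \<star> V \<star> B" "U' \<star> U = op_one n" "V \<star> V' = op_one n" "U \<in> ops n" "V \<in> ops n" "B \<in> ops n"
  shows "U' \<star> A \<star> U = V \<star> B \<star> V'"
proof -
  have "U' \<star> A \<star> U = U' \<star> (A \<star> U \<star> V) \<star> V'"
    using assms(3,4) by (simp only: op_mult_assoc op_one_right)
  also have "\<dots> = (U' \<star> U) \<star> V \<star> B \<star> V'"
    by (simp only: assms(1)) (simp only: op_mult_assoc)
  finally show ?thesis by (simp only: assms op_one_left)
qed

lemma adj_inverse: "A \<star> B = op_one 2 \<Longrightarrow> 1 \<le> i \<Longrightarrow> i < n \<Longrightarrow> adj n i A \<star> adj n i B = op_one n"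
  by (metis adj_mult adj_one)

section \<open>Compatible pairs and the matrices M_bar\<close>

locale quantum_matrices =
  fixes R F :: "('v::finite, complex) op"
  assumes R: "R_matrix R" and F: "R_matrix F" and skew: "skew_invertible R" and comp: "compatible_pair R F"
begin

abbreviation "R' \<equiv> inv\<^bsub>End 2\<^esub> R"
abbreviation "F' \<equiv> inv\<^bsub>End 2\<^esub> F"

lemma inverses: "R \<in> ops 2" "R' \<in> ops 2" "R \<star> R' = op_one 2" "R' \<star> R = op_one 2"
  "F \<in> ops 2" "F' \<in> ops 2" "F \<star> F' = op_one 2" "F' \<star> F = op_one 2"
  using R F Units_End[of R 2] Units_End[of F 2] by (auto simp: R_matrix_def)

lemma D: "D_op R \<in> ops 1"
  using skew by (rule D_op_in_ops)

lemma artin: "adj 3 1 R \<star> adj 3 2 R \<star> adj 3 1 R = adj 3 2 R \<star> adj 3 1 R \<star> adj 3 2 R"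
  "adj 3 1 F \<star> adj 3 2 F \<star> adj 3 1 F = adj 3 2 F \<star> adj 3 1 F \<star> adj 3 2 F"
  using R F by (simp_all only: R_matrix_def)

text \<open>The Artin relation makes {R, R} a compatible pair and so supplies both conjugation
  identities; what commutes with R' commutes with R.\<close>

lemma tensor_power_2_commute: "tensor_power (D_op R) 2 \<star> R = R \<star> tensor_power (D_op R) 2"
proof -
  let ?T = "tensor_power (D_op R) 2"
  have T: "?T \<star> R' = R' \<star> ?T"
  proof (rule tensor_power_2_commute_inverse[OF skew])
    show "adj 3 2 R \<star> adj 3 1 R \<star> adj 3 2 R' = adj 3 1 R' \<star> adj 3 2 R \<star> adj 3 1 R"
      by (rule conj_swap[symmetric, of _ _ _ _ _ 3]; (rule artin(1)[symmetric] adj_inverse)?) (auto simp: inverses)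
    show "adj 3 2 R' \<star> adj 3 1 R \<star> adj 3 2 R = adj 3 1 R \<star> adj 3 2 R \<star> adj 3 1 R'"
      by (rule conj_swap[of _ _ _ _ _ 3]; (rule artin(1) adj_inverse)?) (auto simp: inverses)
  qed (use inverses in auto)
  show ?thesis
    by (rule conj_rel[OF T, of R 2, symmetric]) (use inverses in auto)
qed

abbreviation cop :: "('v, complex) op \<Rightarrow> ('v, 'v qfree) op" where
  "cop \<equiv> const_op"

text \<open>A may have entries in the noncommutative free algebra: D_R, F and F' have scalar
  entries, so the identity established over the complex numbers transfers through
  \<open>const\<close>.\<close>

lemma wtrace_F: 
  assumes "1 \<le> n" "A \<in> ops n"
  shows "wtrace (cop (D_op R)) (cop (adj (Suc n) n F) \<star> place (Suc n) 0 n A \<star> cop (adj (Suc n) n F')) =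
    place n 0 (n - 1) (wtrace (cop (D_op R)) A)"
proof -
  have "adj 3 2 F \<star> adj 3 1 R \<star> adj 3 2 F' = adj 3 1 F' \<star> adj 3 2 R \<star> adj 3 1 F"
  proof (rule conj_swap[symmetric, of _ _ _ _ _ 3])
    show "adj 3 2 R \<star> adj 3 1 F \<star> adj 3 2 F = adj 3 1 F \<star> adj 3 2 F \<star> adj 3 1 R"
      using comp by (simp only: compatible_pair_def)
    show "adj 3 1 F' \<star> adj 3 1 F = op_one 3" "adj 3 2 F \<star> adj 3 2 F' = op_one 3"
      by (rule adj_inverse; simp add: inverses)+
  qed auto
  note star = wtrace_star[OF skew inverses(5,6,8) this]
  show ?thesis
    unfolding const_op_leg
  proof (rule wtrace_conj[OF assms])
    fix c d c1 d1
    show "(\<Sum>a\<in>UNIV. \<Sum>b\<in>UNIV. \<Sum>e\<in>UNIV. cop (D_op R) [b] [a] * cop F [c, a] [c1, e] * cop F' [d1, e] [d, b]) =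
      (if c = d then cop (D_op R) [d1] [c1] else 0)"
      using arg_cong[OF star[of c c1 d1 d], of const]
      by (simp add: const_op_def const_simps const_sum split: if_splits)
  qed (simp add: const_op_central)
qed

abbreviation "r n i \<equiv> cop (adj n i R)"
abbreviation "f n i \<equiv> cop (adj n i F)"
abbreviation "f' n i \<equiv> cop (adj n i F')"

lemma cop_leg2_in_ops [simp]: "cop (leg2 n i j A) \<in> ops n"
  by (simp add: const_op_in_ops)

lemma ff': "1 \<le> i \<Longrightarrow> i < n \<Longrightarrow> f n i \<star> f' n i = op_one n" "1 \<le> i \<Longrightarrow> i < n \<Longrightarrow> f' n i \<star> f n i = op_one n"
  using inverses by (simp_all add: adj_inverse const_op_one flip: const_op_mult)

lemma
  assumes "1 \<le> i" "Suc i < n"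
  shows f_artin: "f n i \<star> f n (Suc i) \<star> f n i = f n (Suc i) \<star> f n i \<star> f n (Suc i)"
    and rff: "r n i \<star> f n (Suc i) \<star> f n i = f n (Suc i) \<star> f n i \<star> r n (Suc i)"
    and ffr: "f n i \<star> f n (Suc i) \<star> r n i = r n (Suc i) \<star> f n i \<star> f n (Suc i)"
  using adj_lift[OF _ assms, of F F F F F F] adj_lift[OF _ assms, of R F F F F R] adj_lift[OF _ assms, of F F R R F F]
    artin(2) comp
  unfolding compatible_pair_def by (simp_all only: flip: const_op_mult)

lemma far: "\<lbrakk>1 \<le> i; i + 2 \<le> j; j < n\<rbrakk> \<Longrightarrow> cop (adj n i A) \<star> cop (adj n j B) = cop (adj n j B) \<star> cop (adj n i A)"
  by (subst (1 2) const_op_mult[symmetric], subst adj_far) auto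

lemma f_cancel:
  assumes "A \<star> f n i = B \<star> f n i" "1 \<le> i" "i < n" "A \<in> ops n" "B \<in> ops n"
  shows "A = B"
proof -
  have "A \<star> f n i \<star> f' n i = B \<star> f n i \<star> f' n i" using assms by simp
  then show ?thesis by (simp only: op_mult_assoc ff'(1)[OF assms(2,3)] op_one_right assms(4,5))
qed

lemma M_bar_in_ops [simp]: "M_bar F n (Suc i) \<in> ops n"
  by (induction i) (auto intro!: op_mult_in_ops)

lemma M_bar_in_ops' [simp]: "1 \<le> i \<Longrightarrow> M_bar F n i \<in> ops n"
  by (cases i) auto

lemma M_bar_Suc: "1 \<le> i \<Longrightarrow> M_bar F n (Suc i) = f n i \<star> M_bar F n i \<star> f' n i"
  by (cases i) auto

declare M_bar.simps [simp del]

lemma f_M_bar: "1 \<le> i \<Longrightarrow> i < n \<Longrightarrow> f n i \<star> M_bar F n i = M_bar F n (Suc i) \<star> f n i"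
  by (simp add: M_bar_Suc op_mult_assoc ff' op_one_right)

lemma M_bar_place:
  assumes "m \<le> n"
  shows "1 \<le> i \<Longrightarrow> i \<le> m \<Longrightarrow> M_bar F n i = place n 0 m (M_bar F m i)"
proof (induction i rule: nat_induct_at_least)
  case base
  then show ?case using assms M_bar.simps(2)[of F] by (simp add: leg1_eq_place place_place)
next
  case (Suc i)
  have "cop (adj n i A) = place n 0 m (cop (adj m i A))" for A
    using Suc assms by (simp add: adj_eq_place const_op_place place_place)
  note this[of F] this[of F']
  then show ?case using Suc assms by (simp add: M_bar_Suc place_mult)
qed

text \<open>M_bar i acts in the first i factors only, A_j in the factors j and j + 1 with scalar
  entries.\<close>

lemma M_bar_commute_above:
  assumes "1 \<le> i" "i < j" "j < n"
  shows "cop (adj n j A) \<star> M_bar F n i = M_bar F n i \<star> cop (adj n j A)"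
proof -
  have "cop (adj n j A) = place n (j - 1) 2 (cop A)"
    using assms by (simp add: adj_eq_place const_op_place)
  moreover have "M_bar F n i = place n 0 i (M_bar F i i)"
    using assms by (intro M_bar_place) auto
  moreover have "place n 0 i (M_bar F i i) \<star> place n (j - 1) 2 (cop A) =
      place n (j - 1) 2 (cop A) \<star> place n 0 i (M_bar F i i)"
    using assms by (intro place_commute) (auto simp: const_op_central)
  ultimately show ?thesis by (simp only:)
qed

text \<open>Moving $Y_j$ past $F_{j+1} F_j$ in $M_{\overline{j+2}} = F_{j+1} F_j M_{\overline j} F_j^{-1} F_{j+1}^{-1}$ turns it into $Y_{j+1}$, which commutes with $M_{\overline j}$.\<close>

lemma M_bar_commute_below:
  assumes Y: "\<And>j. 1 \<le> j \<Longrightarrow> Suc j < n \<Longrightarrow> cop (adj n j Y) \<star> f n (Suc j) \<star> f n j = f n (Suc j) \<star> f n j \<star> cop (adj n (Suc j) Y)"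
    and j: "1 \<le> j" "j + 2 \<le> i" "i \<le> n"
  shows "cop (adj n j Y) \<star> M_bar F n i = M_bar F n i \<star> cop (adj n j Y)"
  using j(2,3)
proof (induction i rule: dec_induct)
  case base
  let ?y = "\<lambda>j. cop (adj n j Y)" and ?P = "f n (Suc j) \<star> f n j"
  have P: "?P \<star> M_bar F n j = M_bar F n (j + 2) \<star> ?P"
  proof -
    have 1: "f n j \<star> M_bar F n j = M_bar F n (Suc j) \<star> f n j"
      and 2: "f n (Suc j) \<star> M_bar F n (Suc j) = M_bar F n (Suc (Suc j)) \<star> f n (Suc j)"
      using j base by (auto intro!: f_M_bar)
    show ?thesis by (simp only: op_mult_assoc 1 op_mult_left_cong[OF 2] add_2_eq_Suc')
  qed
  have yP: "?y j \<star> ?P = ?P \<star> ?y (Suc j)" using Y[of j] j base by (simp add: op_mult_assoc)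
  have "?y j \<star> M_bar F n (j + 2) \<star> ?P = ?y j \<star> ?P \<star> M_bar F n j"
    by (simp only: op_mult_assoc P[unfolded op_mult_assoc])
  also have "\<dots> = ?P \<star> (?y (Suc j) \<star> M_bar F n j)"
    by (simp only: op_mult_assoc op_mult_left_cong[OF yP, unfolded op_mult_assoc])
  also have "\<dots> = ?P \<star> M_bar F n j \<star> ?y (Suc j)"
    using M_bar_commute_above[of j "Suc j" n Y] j base by (simp add: op_mult_assoc)
  also have "\<dots> = M_bar F n (j + 2) \<star> ?y j \<star> ?P"
    by (simp only: op_mult_assoc op_mult_left_cong[OF P, unfolded op_mult_assoc] yP[unfolded op_mult_assoc])
  finally have "?y j \<star> M_bar F n (j + 2) \<star> f n (Suc j) \<star> f n j = M_bar F n (j + 2) \<star> ?y j \<star> f n (Suc j) \<star> f n j"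
    by (simp only: op_mult_assoc)
  then have "?y j \<star> M_bar F n (j + 2) \<star> f n (Suc j) = M_bar F n (j + 2) \<star> ?y j \<star> f n (Suc j)"
    by (rule f_cancel) (use j base in \<open>auto intro!: op_mult_in_ops\<close>)
  then show ?case
    by (rule f_cancel) (use j base in \<open>auto intro!: op_mult_in_ops\<close>)
next
  case (step i)
  let ?y = "cop (adj n j Y)"
  \<comment> \<open>Beyond j + 2 the conjugating F_i is far from Y_j, so commutation is inherited
    from one M_bar to the next.\<close>
  have far: "?y \<star> f n i = f n i \<star> ?y" using step j by (intro far) auto
  have IH: "?y \<star> M_bar F n i = M_bar F n i \<star> ?y" using step by simp
  have fM: "f n i \<star> M_bar F n i = M_bar F n (Suc i) \<star> f n i" using step j by (intro f_M_bar) auto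
  have "?y \<star> M_bar F n (Suc i) \<star> f n i = ?y \<star> f n i \<star> M_bar F n i"
    by (simp only: op_mult_assoc fM)
  also have "\<dots> = f n i \<star> M_bar F n i \<star> ?y"
    by (simp only: op_mult_assoc op_mult_left_cong[OF far] IH)
  also have "\<dots> = M_bar F n (Suc i) \<star> ?y \<star> f n i"
    by (simp only: op_mult_assoc op_mult_left_cong[OF fM] far)
  finally show ?case
    by (rule f_cancel) (use step j in \<open>auto intro!: op_mult_in_ops\<close>)
qed

lemma M_bar_commute:
  assumes "1 \<le> j" "j < n" "1 \<le> i" "i \<le> n" "i < j \<or> j + 2 \<le> i"
  shows "r n j \<star> M_bar F n i = M_bar F n i \<star> r n j" "f n j \<star> M_bar F n i = M_bar F n i \<star> f n j"
  using M_bar_commute_below[of n R j i] M_bar_commute_below[of n F j i] rff[of _ n] f_artin[of _ n]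
    M_bar_commute_above[of i j n] assms by auto

end

section \<open>Linearity of products, placements and traces\<close>

lemma op_mult_add:
  "(\<lambda>xs ys. A xs ys + B xs ys) \<star> C = (\<lambda>xs ys. (A \<star> C) xs ys + (B \<star> C) xs ys)"
  "C \<star> (\<lambda>xs ys. A xs ys + B xs ys) = (\<lambda>xs ys. (C \<star> A) xs ys + (C \<star> B) xs ys)"
  by (intro ext; simp add: op_mult_def algebra_simps sum.distrib)+

lemma op_mult_scale:
  "(\<lambda>xs ys. c * A xs ys) \<star> B = (\<lambda>xs ys. c * (A \<star> B) xs ys)"
  "(\<And>x. x * c = c * x) \<Longrightarrow> B \<star> (\<lambda>xs ys. c * A xs ys) = (\<lambda>xs ys. c * (B \<star> A) xs ys)"
proof -
  show "(\<lambda>xs ys. c * A xs ys) \<star> B = (\<lambda>xs ys. c * (A \<star> B) xs ys)"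
    by (intro ext; simp add: op_mult_def sum_distrib_left mult.assoc)
  assume c: "\<And>x. x * c = c * x"
  have "x * (c * y) = c * (x * y)" for x y by (metis c mult.assoc)
  then show "B \<star> (\<lambda>xs ys. c * A xs ys) = (\<lambda>xs ys. c * (B \<star> A) xs ys)"
    by (intro ext) (simp add: op_mult_def sum_distrib_left)
qed

lemma place_add: "place n k p (\<lambda>xs ys. A xs ys + B xs ys) = (\<lambda>xs ys. place n k p A xs ys + (place n k p B xs ys :: 'a::monoid_add))"
  by (intro ext) (simp add: place_def)

lemma place_scale: "place n k p (\<lambda>xs ys. c * A xs ys) = (\<lambda>xs ys. c * (place n k p A xs ys :: 'a::mult_zero))"
  "place n k p (\<lambda>xs ys. A xs ys * c) = (\<lambda>xs ys. (place n k p A xs ys :: 'a::mult_zero) * c)"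
  by (intro ext; simp add: place_def)+

lemma const_op_add: "const_op (\<lambda>xs ys. A xs ys + B xs ys) = (\<lambda>xs ys. const_op A xs ys + const_op B xs ys)"
  and const_op_scale: "const_op (\<lambda>xs ys. c * A xs ys) = (\<lambda>xs ys. const c * const_op A xs ys)"
  by (intro ext; simp add: const_op_def const_simps)+

lemma wtrace_scale_right: "(wtrace D ^^ n) (\<lambda>xs ys. A xs ys * s) = (\<lambda>xs ys. (wtrace D ^^ n) A xs ys * s)"
proof (induction n)
  case (Suc n)
  then show ?case
    by (intro ext) (simp add: wtrace_def sum_distrib_right mult.assoc)
qed simp

lemma wtrace_pow_in_ops: "A \<in> ops (k + n) \<Longrightarrow> (wtrace D ^^ n) A \<in> ops k"
proof (induction n arbitrary: A)
  case (Suc n)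
  then show ?case using wtrace_in_ops[of A "k + n" D] by (simp add: funpow_swap1)
qed simp

lemma wtrace_pow_left:
  fixes A B :: "('v::finite, 'a::semiring_1) op"
  assumes "A \<in> ops k" and comm: "\<And>xs ys c d. D c d * A xs ys = A xs ys * D c d"
  shows "B \<in> ops (k + n) \<Longrightarrow> (wtrace D ^^ n) (place (k + n) 0 k A \<star> B) = A \<star> (wtrace D ^^ n) B"
proof (induction n arbitrary: B)
  case 0
  then show ?case using assms by (simp add: place_all)
next
  case (Suc n)
  have "wtrace D (place (Suc (k + n)) 0 (k + n) (place (k + n) 0 k A) \<star> B) = place (k + n) 0 k A \<star> wtrace D B"
  proof (rule wtrace_left)
    show "D c d * place (k + n) 0 k A xs ys = place (k + n) 0 k A xs ys * D c d" for c d xs ys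
      using comm by (simp add: place_def)
  qed (use Suc in auto)
  moreover have "wtrace D B \<in> ops (k + n)"
    using Suc.prems by (intro wtrace_in_ops) simp
  ultimately show ?case
    using Suc.IH by (simp add: place_place funpow_swap1)
qed

section \<open>The algebra of the R_i and multiplicativity of the R-trace\<close>

context quantum_matrices
begin

text \<open>Generators are the R_i alone; for BMW-type R the inverses belong to it as polynomials in
  R_i, see \<open>adj_R'_alg\<close>.\<close>

inductive_set alg :: "nat \<Rightarrow> ('v, complex) op set" for n where
  scalar: "(\<lambda>xs ys. c * op_one n xs ys) \<in> alg n"
| gen: "\<lbrakk>1 \<le> i; i < n\<rbrakk> \<Longrightarrow> adj n i R \<in> alg n"
| add: "\<lbrakk>A \<in> alg n; B \<in> alg n\<rbrakk> \<Longrightarrow> (\<lambda>xs ys. A xs ys + B xs ys) \<in> alg n"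
| mult: "\<lbrakk>A \<in> alg n; B \<in> alg n\<rbrakk> \<Longrightarrow> A \<star> B \<in> alg n"

lemma alg_in_ops: "A \<in> alg n \<Longrightarrow> A \<in> ops n"
proof (induction rule: alg.induct)
  case (mult A B)
  then show ?case by (simp add: op_mult_in_ops)
qed (auto simp: ops_def op_one_def leg2_def)

lemma place_r: "\<lbrakk>1 \<le> i; i < m; k + m \<le> n\<rbrakk> \<Longrightarrow> place n k m (cop (adj m i A)) = cop (adj n (k + i) A)"
  by (simp add: adj_eq_place const_op_place place_place)

text \<open>What intertwines the generators intertwines all words in them. It is applied with b = a
  + 1 to \<open>shift\<close>, and with a = b = 0 as a commutation rule for
  \<open>M_seg\<close>.\<close>

lemma alg_intertwine:
  assumes Z: "Z \<in> ops n" "\<And>i. 1 \<le> i \<Longrightarrow> i < m \<Longrightarrow> Z \<star> r n (a + i) = r n (b + i) \<star> Z"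
    and mn: "a + m \<le> n" "b + m \<le> n"
  shows "A \<in> alg m \<Longrightarrow> Z \<star> place n a m (cop A) = place n b m (cop A) \<star> Z"
proof (induction rule: alg.induct)
  case (scalar c)
  have "place n k m (cop (\<lambda>xs ys. c * op_one m xs ys)) = (\<lambda>xs ys. const c * op_one n xs ys)" if "k + m \<le> n" for k
    using that by (simp add: const_op_scale place_scale const_op_one place_one)
  moreover have "Z \<star> (\<lambda>xs ys. const c * op_one n xs ys) = (\<lambda>xs ys. const c * (Z \<star> op_one n) xs ys)"
    by (rule op_mult_scale(2)) (rule const_central[symmetric])
  ultimately show ?case
    using mn Z by (simp add: op_mult_scale(1) op_one_left op_one_right)
next
  case (gen i)
  then show ?case using Z(2)[of i] mn by (simp add: place_r)
next
  case (add A B)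
  then show ?case by (simp add: const_op_add place_add op_mult_add)
next
  case (mult A B)
  have "Z \<star> place n a m (cop (A \<star> B)) = Z \<star> place n a m (cop A) \<star> place n a m (cop B)"
    using mn by (simp add: const_op_mult place_mult op_mult_assoc)
  also have "\<dots> = place n b m (cop A) \<star> (Z \<star> place n a m (cop B))"
    by (simp only: mult op_mult_assoc)
  also have "\<dots> = place n b m (cop (A \<star> B)) \<star> Z"
    using mn by (simp add: mult const_op_mult place_mult op_mult_assoc)
  finally show ?case .
qed

text \<open>Conjugation by $F_{k+1} \cdots F_{k+m}$ moves the factors $k+1, \dots, k+m$ one step to the right.\<close>

fun shift :: "nat \<Rightarrow> nat \<Rightarrow> nat \<Rightarrow> ('v, 'v qfree) op" where
  "shift n k 0 = op_one n"
| "shift n k (Suc m) = shift n k m \<star> f n (Suc (k + m))"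

fun shift' :: "nat \<Rightarrow> nat \<Rightarrow> nat \<Rightarrow> ('v, 'v qfree) op" where
  "shift' n k 0 = op_one n"
| "shift' n k (Suc m) = f' n (Suc (k + m)) \<star> shift' n k m"

lemma shift_in_ops [simp]: "shift n k m \<in> ops n" "shift' n k m \<in> ops n"
  by (induction m) (auto intro: op_mult_in_ops)

lemma shift_shift': "k + m < n \<Longrightarrow> shift n k m \<star> shift' n k m = op_one n"
proof (induction m)
  case (Suc m)
  have "shift n k (Suc m) \<star> shift' n k (Suc m) = shift n k m \<star> (f n (Suc (k + m)) \<star> f' n (Suc (k + m))) \<star> shift' n k m"
    by (simp add: op_mult_assoc)
  then show ?case using Suc by (simp add: ff' op_one_right)
qed (simp add: op_one_left)

lemma place_shift: "k + m < p \<Longrightarrow> p \<le> n \<Longrightarrow> place n 0 p (shift p k m) = shift n k m"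
  "k + m < p \<Longrightarrow> p \<le> n \<Longrightarrow> place n 0 p (shift' p k m) = shift' n k m"
  by (induction m) (auto simp: place_one place_mult place_r[of _ _ 0, simplified])

lemma shift_commute:
  "\<lbrakk>Z \<in> ops n; \<And>l. k < l \<Longrightarrow> l \<le> k + m \<Longrightarrow> Z \<star> f n l = f n l \<star> Z\<rbrakk> \<Longrightarrow> Z \<star> shift n k m = shift n k m \<star> Z"
proof (induction m)
  case (Suc m)
  then have IH: "Z \<star> shift n k m = shift n k m \<star> Z" and f: "Z \<star> f n (Suc (k + m)) = f n (Suc (k + m)) \<star> Z"
    by auto
  show ?case by (simp only: shift.simps op_mult_assoc op_mult_left_cong[OF IH] f)
qed (simp add: op_one_left op_one_right)

text \<open>Only F_j acts: the F_l with l > j commute with M_bar j, F_j turns it into M_bar (j + 1),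
  and the F_l with l < j commute with the latter.\<close>

lemma shift_M_bar:
  "\<lbrakk>k < j; j \<le> k + m; k + m < n\<rbrakk> \<Longrightarrow> shift n k m \<star> M_bar F n j = M_bar F n (Suc j) \<star> shift n k m"
proof (induction m)
  case (Suc m)
  show ?case
  proof (cases "j = Suc (k + m)")
    case True
    have "M_bar F n (Suc j) \<star> shift n k m = shift n k m \<star> M_bar F n (Suc j)"
      using Suc.prems True by (intro shift_commute) (auto simp: M_bar_commute)
    then show ?thesis
      using f_M_bar[of j n] Suc.prems True by (simp add: op_mult_assoc) (simp flip: op_mult_assoc)
  next
    case False
    then have "f n (Suc (k + m)) \<star> M_bar F n j = M_bar F n j \<star> f n (Suc (k + m))"
      using Suc.prems by (intro M_bar_commute) auto
    moreover have "shift n k m \<star> M_bar F n j = M_bar F n (Suc j) \<star> shift n k m"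
      using Suc False by simp
    ultimately show ?thesis by (simp add: op_mult_assoc) (simp flip: op_mult_assoc)
  qed
qed auto

text \<open>The pair F_i F_{i+1} turns R_i into R_{i+1} by compatibility; F_l with l > i + 1 is far
  from R_i, and F_l with l < i is far from R_{i+1}.\<close>

lemma shift_r:
  "\<lbrakk>k < i; i < k + m; k + m < n\<rbrakk> \<Longrightarrow> shift n k m \<star> r n i = r n (Suc i) \<star> shift n k m"
proof (induction m)
  case (Suc m)
  show ?case
  proof (cases "i = k + m")
    case True
    then obtain l where m: "m = Suc l" using Suc.prems by (cases m) auto
    have 1: "r n (Suc i) \<star> shift n k l = shift n k l \<star> r n (Suc i)"
      using Suc.prems True m by (intro shift_commute far[symmetric]) auto
    have 2: "f n i \<star> f n (Suc i) \<star> r n i = r n (Suc i) \<star> f n i \<star> f n (Suc i)"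
      using Suc.prems True by (intro ffr) auto
    have i: "Suc (k + l) = i" using True m by simp
    have "shift n k (Suc m) \<star> r n i = shift n k l \<star> r n (Suc i) \<star> f n i \<star> f n (Suc i)"
      unfolding m shift.simps i using 2 by (simp add: op_mult_assoc i)
    then show ?thesis
      unfolding m shift.simps i by (simp add: 1[symmetric] i op_mult_assoc)
  next
    case False
    then have "r n i \<star> f n (Suc (k + m)) = f n (Suc (k + m)) \<star> r n i"
      using Suc.prems by (intro far) auto
    moreover have "shift n k m \<star> r n i = r n (Suc i) \<star> shift n k m"
      using Suc False by simp
    ultimately show ?thesis
      by (simp add: op_mult_assoc flip: \<open>r n i \<star> f n (Suc (k + m)) = _\<close>) (simp flip: op_mult_assoc)
  qed
qed auto

lemma shift_alg:
  assumes "A \<in> alg m" "k + m < n"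
  shows "shift n k m \<star> place n k m (cop A) = place n (Suc k) m (cop A) \<star> shift n k m"
  by (rule alg_intertwine[OF _ _ _ _ assms(1)]) (use assms in \<open>auto simp: shift_r\<close>)

abbreviation tr :: "('v, 'v qfree) op \<Rightarrow> ('v, 'v qfree) op" where
  "tr \<equiv> wtrace (cop (D_op R))"

lemma tr_left: "A \<in> ops n \<Longrightarrow> B \<in> ops (Suc n) \<Longrightarrow> tr (place (Suc n) 0 n A \<star> B) = A \<star> tr B"
  by (rule wtrace_left, assumption, assumption, rule const_op_central)

lemma tr_pow_left: "A \<in> ops k \<Longrightarrow> B \<in> ops (k + n) \<Longrightarrow> (tr ^^ n) (place (k + n) 0 k A \<star> B) = A \<star> (tr ^^ n) B"
  by (rule wtrace_pow_left, assumption, rule const_op_central, assumption)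

text \<open>The innermost conjugation is the one by the last F. The trace over the last factor
  absorbs it by \<open>wtrace_F\<close>, and what is left is the same statement for
  \<open>tr A\<close> with m lowered by one.\<close>

lemma tr_shift:
  "A \<in> ops (k + m) \<Longrightarrow>
   (tr ^^ m) (shift (Suc (k + m)) k m \<star> place (Suc (k + m)) 0 (k + m) A \<star> shift' (Suc (k + m)) k m) =
     place (Suc k) 0 k ((tr ^^ m) A)"
proof (induction m arbitrary: A)
  case 0
  then show ?case by (simp add: op_one_left op_one_right)
next
  case (Suc m)
  let ?n = "Suc (k + m)"
  let ?c = "f (Suc ?n) ?n \<star> place (Suc ?n) 0 ?n A \<star> f' (Suc ?n) ?n"
  have 1: "shift (Suc ?n) k (Suc m) \<star> place (Suc ?n) 0 ?n A \<star> shift' (Suc ?n) k (Suc m) =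
    place (Suc ?n) 0 ?n (shift ?n k m) \<star> ?c \<star> place (Suc ?n) 0 ?n (shift' ?n k m)"
    by (simp add: place_shift op_mult_assoc)
  have 2: "tr (place (Suc ?n) 0 ?n (shift ?n k m) \<star> ?c \<star> place (Suc ?n) 0 ?n (shift' ?n k m)) =
      tr (place (Suc ?n) 0 ?n (shift ?n k m) \<star> ?c) \<star> shift' ?n k m"
    by (rule wtrace_right) (auto intro!: op_mult_in_ops)
  have 3: "tr (place (Suc ?n) 0 ?n (shift ?n k m) \<star> ?c) = shift ?n k m \<star> tr ?c"
    by (rule tr_left) (auto intro!: op_mult_in_ops)
  have 4: "tr ?c = place ?n 0 (k + m) (tr A)"
    using wtrace_F[of ?n A] Suc.prems by simp
  have "(tr ^^ Suc m) (shift (Suc ?n) k (Suc m) \<star> place (Suc ?n) 0 ?n A \<star> shift' (Suc ?n) k (Suc m)) =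
      (tr ^^ m) (shift ?n k m \<star> place ?n 0 (k + m) (tr A) \<star> shift' ?n k m)"
    by (simp only: funpow_Suc_right o_apply 1 2 3 4)
  also have "\<dots> = place (Suc k) 0 k ((tr ^^ m) (tr A))"
    using Suc.prems by (intro Suc.IH wtrace_in_ops) simp
  finally show ?case by (simp add: funpow_swap1)
qed

definition M_seg :: "nat \<Rightarrow> nat \<Rightarrow> nat \<Rightarrow> ('v, 'v qfree) op" where
  "M_seg n k m = op_prod n (map (M_bar F n) [Suc k..<Suc (k + m)])"

lemma M_seg_in_ops [simp]: "M_seg n k m \<in> ops n"
  unfolding M_seg_def by (intro op_prod_in_ops) auto

lemma place_M_seg: "k + m \<le> p \<Longrightarrow> p \<le> n \<Longrightarrow> place n 0 p (M_seg p k m) = M_seg n k m"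
proof -
  assume *: "k + m \<le> p" "p \<le> n"
  have "map (M_bar F n) [Suc k..<Suc (k + m)] = map (place n 0 p) (map (M_bar F p) [Suc k..<Suc (k + m)])"
    using * by (auto simp: M_bar_place[of p n] simp del: upt_Suc)
  then show ?thesis using * by (simp only: M_seg_def op_prod_place add_0)
qed

lemma M_seg_add: "M_seg n 0 (k + m) = M_seg n 0 k \<star> M_seg n k m"
proof -
  have "[Suc 0..<Suc (0 + (k + m))] = [Suc 0..<Suc (0 + k)] @ [Suc k..<Suc (k + m)]"
    by (metis add_0 le_add1 not_less_eq_eq upt_add_eq_append add_Suc le_SucI Suc_le_mono)
  then show ?thesis
    unfolding M_seg_def by (simp only: map_append) (rule op_prod_append, auto)
qed

lemma M_prod_eq: "M_prod F n = M_seg n 0 n"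
  by (simp add: M_prod_def M_seg_def)

lemma shift_M_seg:
  assumes "k + m < n"
  shows "shift n k m \<star> M_seg n k m = M_seg n (Suc k) m \<star> shift n k m"
proof -
  have "shift n k m \<star> op_prod n (map (M_bar F n) js) = op_prod n (map (\<lambda>j. M_bar F n (Suc j)) js) \<star> shift n k m"
    if "set js \<subseteq> {k<..k + m}" for js
    using that
  proof (induction js)
    case Nil
    then show ?case by (simp add: op_prod_def op_one_left op_one_right)
  next
    case (Cons j js)
    have 1: "shift n k m \<star> M_bar F n j = M_bar F n (Suc j) \<star> shift n k m"
      using Cons.prems assms by (intro shift_M_bar) auto
    show ?case using Cons
      by (simp add: op_prod_Cons op_mult_assoc op_mult_left_cong[OF 1])
  qed
  from this[of "[Suc k..<Suc (k + m)]"] have "shift n k m \<star> M_seg n k m =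
      op_prod n (map (M_bar F n) (map Suc [Suc k..<Suc (k + m)])) \<star> shift n k m"
    by (simp add: M_seg_def o_def atLeastLessThanSuc_atLeastAtMost subset_iff del: upt_Suc)
  then show ?thesis by (simp add: map_Suc_upt M_seg_def del: upt_Suc)
qed

definition \<tau> :: "nat \<Rightarrow> ('v, complex) op \<Rightarrow> 'v qfree" where
  "\<tau> n A = R_trace R n (M_prod F n \<star> cop A)"

lemma R_trace_tr: "R_trace R n A = (tr ^^ n) A [] []"
  using op_trace_wtrace[of "cop (D_op R)" n A] D
  by (simp add: R_trace_def tensor_power_def const_op_leg const_op_in_ops del: upt_Suc)

text \<open>Induction on the offset k: conjugation by \<open>shift\<close> moves the block M_{k+1}
  ... M_{k+m} together with Y one factor to the right, and \<open>tr_shift\<close> shows that the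
  trace only gains one more identity factor. So tracing out a block does not depend on its
  position.\<close>

lemma tr_M_seg:
  assumes Y: "Y \<in> alg m"
  shows "(tr ^^ m) (M_seg (k + m) k m \<star> place (k + m) k m (cop Y)) = (\<lambda>xs ys. op_one k xs ys * \<tau> m Y)"
proof (induction k)
  case 0
  let ?A = "M_seg m 0 m \<star> place m 0 m (cop Y)"
  have "(tr ^^ m) ?A \<in> ops 0"
    by (rule wtrace_pow_in_ops) (simp add: op_mult_in_ops)
  moreover have "?A = M_prod F m \<star> cop Y"
    using Y by (simp add: M_prod_eq place_all const_op_in_ops alg_in_ops)
  ultimately show ?case
    by (intro ext) (auto simp: op_one_def ops_def \<tau>_def R_trace_tr)
next
  case (Suc k)
  let ?n = "Suc (k + m)" and ?B = "M_seg (k + m) k m \<star> place (k + m) k m (cop Y)"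
  let ?B' = "M_seg ?n (Suc k) m \<star> place ?n (Suc k) m (cop Y)"
  have B: "place ?n 0 (k + m) ?B = M_seg ?n k m \<star> place ?n k m (cop Y)"
    by (simp add: place_mult place_M_seg place_place)
  have 1: "shift ?n k m \<star> place ?n k m (cop Y) = place ?n (Suc k) m (cop Y) \<star> shift ?n k m"
    using Y by (intro shift_alg) auto
  have 2: "shift ?n k m \<star> M_seg ?n k m = M_seg ?n (Suc k) m \<star> shift ?n k m"
    by (rule shift_M_seg) simp
  have "shift ?n k m \<star> place ?n 0 (k + m) ?B = ?B' \<star> shift ?n k m"
    unfolding B by (simp only: op_mult_assoc op_mult_left_cong[OF 2] 1)
  then have "shift ?n k m \<star> place ?n 0 (k + m) ?B \<star> shift' ?n k m = ?B'"
    by (simp only: op_mult_assoc shift_shift'[OF lessI] op_one_right[OF place_in_ops])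
  moreover have "(tr ^^ m) (shift ?n k m \<star> place ?n 0 (k + m) ?B \<star> shift' ?n k m) = place (Suc k) 0 k ((tr ^^ m) ?B)"
    by (rule tr_shift) (auto intro!: op_mult_in_ops)
  ultimately have "(tr ^^ m) ?B' = place (Suc k) 0 k (\<lambda>xs ys. op_one k xs ys * \<tau> m Y)"
    by (simp add: Suc)
  then show ?case by (simp add: place_scale place_one)
qed

text \<open>A commutes with M_{k+1} ... M_{k+m}, so the operator splits into one on the first k
  factors followed by the block on the last m. Tracing out that block leaves \<tau> m B times the
  identity, on the right, since the entries do not commute. The relations of the algebra are not
  invoked: the equality holds in the free algebra.\<close>

theorem \<tau>_mult:
  assumes A: "A \<in> alg k" and B: "B \<in> alg m"
  shows "\<tau> (k + m) (place (k + m) 0 k A \<star> place (k + m) k m B) = \<tau> k A * \<tau> m B"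
proof -
  let ?n = "k + m"
  let ?A = "place ?n 0 k (cop A)" and ?B = "place ?n k m (cop B)" and ?C = "M_seg k 0 k \<star> cop A"
  have 1: "M_seg ?n k m \<star> ?A = ?A \<star> M_seg ?n k m"
  proof (rule alg_intertwine[OF _ _ _ _ A])
    fix i assume i: "1 \<le> i" "i < k"
    show "M_seg ?n k m \<star> r ?n (0 + i) = r ?n (0 + i) \<star> M_seg ?n k m"
      unfolding M_seg_def
      by (rule op_prod_commute[symmetric]) (use i in \<open>auto intro!: M_bar_commute\<close>)
  qed auto
  have C: "?C \<in> ops k" using A by (auto intro!: op_mult_in_ops const_op_in_ops alg_in_ops)
  have "M_seg ?n 0 k \<star> ?A = place ?n 0 k ?C"
    by (simp add: place_mult place_M_seg)
  then have "M_prod F ?n \<star> cop (place ?n 0 k A \<star> place ?n k m B) = place ?n 0 k ?C \<star> (M_seg ?n k m \<star> ?B)"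
    by (simp add: M_prod_eq M_seg_add const_op_mult const_op_place op_mult_assoc op_mult_left_cong[OF 1])
       (simp flip: op_mult_assoc)
  then have "\<tau> ?n (place ?n 0 k A \<star> place ?n k m B) = (tr ^^ k) ((tr ^^ m) (place ?n 0 k ?C \<star> (M_seg ?n k m \<star> ?B))) [] []"
    by (simp add: \<tau>_def R_trace_tr funpow_add)
  also have "(tr ^^ m) (place ?n 0 k ?C \<star> (M_seg ?n k m \<star> ?B)) = ?C \<star> (tr ^^ m) (M_seg ?n k m \<star> ?B)"
    by (rule tr_pow_left[OF C]) (auto intro: op_mult_in_ops)
  also have "\<dots> = (\<lambda>xs ys. ?C xs ys * \<tau> m B)"
  proof -
    have "D \<star> (\<lambda>xs ys. op_one k xs ys * s) = (\<lambda>xs ys. (D \<star> op_one k) xs ys * s)" for D :: "('v, 'v qfree) op" and s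
      by (intro ext) (simp add: op_mult_def sum_distrib_right mult.assoc)
    then show ?thesis by (simp only: tr_M_seg[OF B] op_one_right[OF C])
  qed
  also have "(tr ^^ k) \<dots> [] [] = \<tau> k A * \<tau> m B"
    by (simp add: wtrace_scale_right \<tau>_def R_trace_tr M_prod_eq)
  finally show ?thesis .
qed

end

section \<open>The quotient by the quadratic relations and cyclicity of the R-trace\<close>

lemma ring_of_type_algebra_ring: "ring (ring_of_type_algebra :: 'a::ring_1 ring)"
proof -
  have "\<exists>y. x + y = 0" for x :: 'a
    using add.right_inverse by blast
  then show ?thesis
    unfolding ring_of_type_algebra_def using add.right_inverse
    by unfold_locales (auto simp: algebra_simps Units_def)
qed

lemma ring_of_type_algebra_simps [simp]:
  "carrier (ring_of_type_algebra :: 'a::ring_1 ring) = UNIV"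
  "x \<otimes>\<^bsub>ring_of_type_algebra\<^esub> y = x * y" "x \<oplus>\<^bsub>ring_of_type_algebra\<^esub> y = x + y"
  "\<one>\<^bsub>ring_of_type_algebra\<^esub> = (1 :: 'a)" "\<zero>\<^bsub>ring_of_type_algebra\<^esub> = (0 :: 'a)"
  by (simp_all add: ring_of_type_algebra_def)

lemma op_trace_commute:
  assumes "\<And>xs ys x. A xs ys * x = x * A xs ys"
  shows "op_trace n (A \<star> B) = op_trace n (B \<star> A)"
proof -
  have "op_trace n (A \<star> B) = (\<Sum>xs | length xs = n. \<Sum>ys | length ys = n. B ys xs * A xs ys)"
    by (simp add: op_trace_def op_mult_def assms)
  also have "\<dots> = op_trace n (B \<star> A)"
    by (subst sum.swap) (simp add: op_trace_def op_mult_def)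
  finally show ?thesis .
qed

context quantum_matrices
begin

abbreviation "J \<equiv> qma_ideal R F"

lemma ideal_J: "ideal J ring_of_type_algebra"
  unfolding qma_ideal_def by (rule ring.genideal_ideal[OF ring_of_type_algebra_ring]) simp

lemma relations_J: "qma_relations R F \<subseteq> J"
  unfolding qma_ideal_def by (rule ring.genideal_self[OF ring_of_type_algebra_ring]) simp

lemma J_add: "x \<in> J \<Longrightarrow> y \<in> J \<Longrightarrow> x + y \<in> J"
  using additive_subgroup.a_closed[OF ideal.axioms(1)[OF ideal_J]] by simp

lemma J_0: "0 \<in> J"
  using additive_subgroup.zero_closed[OF ideal.axioms(1)[OF ideal_J]] by simp

lemma J_mult_left: "x \<in> J \<Longrightarrow> y * x \<in> J"
  using ideal.I_l_closed[OF ideal_J, of x y] by simp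

lemma J_mult_right: "x \<in> J \<Longrightarrow> x * y \<in> J"
  using ideal.I_r_closed[OF ideal_J, of x y] by simp

lemma J_minus: "x \<in> J \<Longrightarrow> - x \<in> J"
  using J_mult_left[of x "-1"] by simp

lemma J_sum: "(\<And>i. i \<in> I \<Longrightarrow> h i \<in> J) \<Longrightarrow> sum h I \<in> J"
  by (induction I rule: infinite_finite_induct) (auto intro: J_0 J_add)

definition cong_J :: "('v, 'v qfree) op \<Rightarrow> ('v, 'v qfree) op \<Rightarrow> bool" (infix \<open>\<approx>\<close> 50) where
  "A \<approx> B \<longleftrightarrow> (\<forall>xs ys. A xs ys - B xs ys \<in> J)"

lemma cong_J_mult: "A \<approx> B \<Longrightarrow> C \<star> A \<star> E \<approx> C \<star> B \<star> E"
proof -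
  assume AB: "A \<approx> B"
  have "(C \<star> A) xs ys - (C \<star> B) xs ys \<in> J" for xs ys
    using AB unfolding cong_J_def op_mult_def
    by (simp flip: sum_subtractf right_diff_distrib) (intro J_sum J_mult_left, simp)
  then show ?thesis
    unfolding cong_J_def op_mult_def[of _ E]
    by (simp flip: sum_subtractf left_diff_distrib) (intro allI J_sum J_mult_right, simp)
qed

text \<open>The defining relation is the case i = 1. Conjugation by F_i F_{i+1} takes R_i to R_{i+1}
  and M_i M_{i+1} to M_{i+1} M_{i+2}, hence the relation at i to the relation at i + 1.\<close>

lemma M_bar_rel:
  "1 \<le> i \<Longrightarrow> i < n \<Longrightarrow> r n i \<star> M_bar F n i \<star> M_bar F n (Suc i) \<approx> M_bar F n i \<star> M_bar F n (Suc i) \<star> r n i"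
proof (induction i rule: nat_induct_at_least)
  case base
  let ?A = "r 2 1 \<star> M_bar F 2 1 \<star> M_bar F 2 2" and ?B = "M_bar F 2 1 \<star> M_bar F 2 2 \<star> r 2 1"
  have A: "?A \<in> ops 2" "?B \<in> ops 2" by (auto intro!: op_mult_in_ops)
  have J: "?A xs ys - ?B xs ys \<in> J" for xs ys
  proof (cases "length xs = 2 \<and> length ys = 2")
    case True
    then show ?thesis using relations_J unfolding qma_relations_def by blast
  next
    case False
    then show ?thesis using A J_0 by (auto simp: ops_def)
  qed
  have "place n 0 2 ?A \<approx> place n 0 2 ?B"
    unfolding cong_J_def place_def using J J_0 by auto
  moreover have "M_bar F n 1 = place n 0 2 (M_bar F 2 1)" "M_bar F n (Suc 1) = place n 0 2 (M_bar F 2 2)"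
    using base M_bar_place[of 2 n 1] M_bar_place[of 2 n 2] by (auto simp: numeral_2_eq_2)
  moreover have "r n 1 = place n 0 2 (r 2 1)"
    using place_r[of 1 2 0 n R] base by simp
  ultimately show ?case using base by (simp only: place_mult)
next
  case (Suc i)
  let ?Q = "f n i \<star> f n (Suc i)" and ?Q' = "f' n (Suc i) \<star> f' n i"
  let ?L = "r n (Suc i) \<star> M_bar F n (Suc i) \<star> M_bar F n (Suc (Suc i))"
  let ?N = "M_bar F n (Suc i) \<star> M_bar F n (Suc (Suc i)) \<star> r n (Suc i)"
  have i: "1 \<le> i" "Suc i < n" using Suc by auto
  have r: "?Q \<star> r n i = r n (Suc i) \<star> ?Q"
    using ffr[OF i] by (simp add: op_mult_assoc)
  have f1: "f n i \<star> M_bar F n i = M_bar F n (Suc i) \<star> f n i"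
    and f2: "f n (Suc i) \<star> M_bar F n (Suc i) = M_bar F n (Suc (Suc i)) \<star> f n (Suc i)"
    using i by (auto intro!: f_M_bar)
  have c1: "f n (Suc i) \<star> M_bar F n i = M_bar F n i \<star> f n (Suc i)"
    and c2: "f n i \<star> M_bar F n (Suc (Suc i)) = M_bar F n (Suc (Suc i)) \<star> f n i"
    using i by (auto intro!: M_bar_commute)
  have M: "?Q \<star> (M_bar F n i \<star> M_bar F n (Suc i)) = M_bar F n (Suc i) \<star> M_bar F n (Suc (Suc i)) \<star> ?Q"
    by (simp only: op_mult_assoc op_mult_left_cong[OF c1] op_mult_left_cong[OF f1] f2 op_mult_left_cong[OF c2])
  have QQ: "?Q \<star> ?Q' = op_one n"
    using i by (simp only: op_mult_assoc op_mult_left_cong[OF ff'(1)[of "Suc i" n]])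
      (simp add: op_one_left ff')
  have "?Q \<star> (r n i \<star> M_bar F n i \<star> M_bar F n (Suc i)) \<star> ?Q' \<approx> ?Q \<star> (M_bar F n i \<star> M_bar F n (Suc i) \<star> r n i) \<star> ?Q'"
    using Suc i by (intro cong_J_mult) simp
  also have "?Q \<star> (r n i \<star> M_bar F n i \<star> M_bar F n (Suc i)) \<star> ?Q' = ?L \<star> (?Q \<star> ?Q')"
    by (simp only: op_mult_assoc op_mult_left_cong[OF r, unfolded op_mult_assoc] op_mult_left_cong[OF M, unfolded op_mult_assoc])
  also have "?Q \<star> (M_bar F n i \<star> M_bar F n (Suc i) \<star> r n i) \<star> ?Q' = ?N \<star> (?Q \<star> ?Q')"
    by (simp only: op_mult_assoc op_mult_left_cong[OF M, unfolded op_mult_assoc] op_mult_left_cong[OF r, unfolded op_mult_assoc])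
  finally show ?case
    unfolding QQ by (simp add: op_one_right op_mult_in_ops)
qed

lemma upt_split: "\<lbrakk>1 \<le> i; i < n\<rbrakk> \<Longrightarrow> [1..<Suc n] = [1..<i] @ [i, Suc i] @ [Suc (Suc i)..<Suc n]"
proof -
  assume i: "1 \<le> i" "i < n"
  have "[1..<Suc n] = [1..<i] @ [i..<Suc n]"
    using i upt_add_eq_append[of 1 i "Suc n - i"] by simp
  also have "[i..<Suc n] = [i, Suc i] @ [Suc (Suc i)..<Suc n]"
    using i by (simp add: upt_conv_Cons del: upt_Suc)
  finally show ?thesis .
qed

lemma M_prod_rel:
  assumes "1 \<le> i" "i < n"
  shows "M_prod F n \<star> r n i \<approx> r n i \<star> M_prod F n"
proof -
  let ?A = "op_prod n (map (M_bar F n) [1..<i])" and ?B = "op_prod n (map (M_bar F n) [Suc (Suc i)..<Suc n])"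
  let ?M = "M_bar F n i \<star> M_bar F n (Suc i)"
  have M: "M_prod F n = ?A \<star> ?M \<star> ?B"
    unfolding M_prod_def upt_split[OF assms] map_append
    by (subst op_prod_append) (use assms in \<open>auto simp: op_prod_Cons op_mult_assoc\<close>)
  have A: "r n i \<star> ?A = ?A \<star> r n i" and B: "r n i \<star> ?B = ?B \<star> r n i"
    using assms by (auto intro!: op_prod_commute M_bar_commute)
  have "?A \<star> (r n i \<star> M_bar F n i \<star> M_bar F n (Suc i)) \<star> ?B \<approx> ?A \<star> (?M \<star> r n i) \<star> ?B"
    by (rule cong_J_mult[OF M_bar_rel[OF assms]])
  also have "?A \<star> (r n i \<star> M_bar F n i \<star> M_bar F n (Suc i)) \<star> ?B = r n i \<star> M_prod F n"
    unfolding M by (simp only: op_mult_assoc op_mult_left_cong[OF A])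
  also have "?A \<star> (?M \<star> r n i) \<star> ?B = M_prod F n \<star> r n i"
    unfolding M by (simp only: op_mult_assoc B)
  finally show ?thesis
    unfolding cong_J_def using J_minus by (metis minus_diff_eq)
qed

lemma tensor_power_r:
  assumes "1 \<le> i" "i < n"
  shows "tensor_power (D_op R) n \<star> adj n i R = adj n i R \<star> tensor_power (D_op R) n"
proof -
  let ?L = "\<lambda>i. leg1 n i (D_op R)"
  let ?A = "op_prod n (map ?L [1..<i])" and ?B = "op_prod n (map ?L [Suc (Suc i)..<Suc n])"
  have T: "tensor_power (D_op R) n = ?A \<star> (?L i \<star> ?L (Suc i)) \<star> ?B"
    unfolding tensor_power_def upt_split[OF assms] map_append
    by (subst op_prod_append) (auto simp: op_prod_Cons op_mult_assoc)
  have "[1..<Suc 2] = [1, 2]" by (simp add: numeral_2_eq_2)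
  then have "tensor_power (D_op R) 2 = leg1 2 1 (D_op R) \<star> leg1 2 2 (D_op R)"
    by (simp add: tensor_power_def op_prod_def op_one_right del: upt_Suc)
  then have 2: "?L i \<star> ?L (Suc i) = place n (i - 1) 2 (tensor_power (D_op R) 2)"
    using assms by (simp add: leg1_eq_place place_mult place_place)
  have adj: "adj n i R = place n (i - 1) 2 R" using assms by (rule adj_eq_place)
  have C: "adj n i R \<star> (?L i \<star> ?L (Suc i)) = (?L i \<star> ?L (Suc i)) \<star> adj n i R"
    unfolding 2 adj using assms by (simp add: tensor_power_2_commute flip: place_mult)
  have L: "adj n i R \<star> ?L j = ?L j \<star> adj n i R" if "1 \<le> j" "j \<le> n" "j < i \<or> Suc i < j" for j
  proof (cases "j < i")
    case True
    have "place n (j - 1) 1 (D_op R) \<star> place n (i - 1) 2 R = place n (i - 1) 2 R \<star> place n (j - 1) 1 (D_op R)"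
      using True assms that by (intro place_commute) (auto simp: mult.commute)
    then show ?thesis using that assms unfolding adj by (simp add: leg1_eq_place)
  next
    case False
    have "place n (i - 1) 2 R \<star> place n (j - 1) 1 (D_op R) = place n (j - 1) 1 (D_op R) \<star> place n (i - 1) 2 R"
      using False assms that by (intro place_commute) (auto simp: mult.commute)
    then show ?thesis using that assms unfolding adj by (simp add: leg1_eq_place)
  qed
  have A: "adj n i R \<star> ?A = ?A \<star> adj n i R" and B: "adj n i R \<star> ?B = ?B \<star> adj n i R"
    using assms L by (auto intro!: op_prod_commute)
  show ?thesis
    unfolding T by (simp only: op_mult_assoc op_mult_left_cong[OF A] op_mult_left_cong[OF C, unfolded op_mult_assoc] B)
qed

lemma \<tau>_add: "\<tau> n (\<lambda>xs ys. A xs ys + B xs ys) = \<tau> n A + \<tau> n B"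
  by (simp add: \<tau>_def R_trace_def const_op_add op_mult_add op_trace_def sum.distrib)

lemma \<tau>_scale: "\<tau> n (\<lambda>xs ys. c * A xs ys) = const c * \<tau> n A"
proof -
  have "B \<star> (\<lambda>xs ys. const c * A xs ys) = (\<lambda>xs ys. const c * (B \<star> A) xs ys)" for A B :: "('v, 'v qfree) op"
    by (rule op_mult_scale(2)) (rule const_central[symmetric])
  then show ?thesis
    by (simp add: \<tau>_def R_trace_def const_op_scale op_trace_def sum_distrib_left)
qed

lemma R_trace_eq: "R_trace R n A = op_trace n (cop (tensor_power (D_op R) n) \<star> A)"
proof -
  have "op_prod n (map cop As) = cop (op_prod n As)" for As
    by (induction As) (simp_all add: op_prod_def const_op_one const_op_mult)
  from this[of "map (\<lambda>i. leg1 n i (D_op R)) [1..<Suc n]"] show ?thesis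
    by (simp add: R_trace_def tensor_power_def o_def del: upt_Suc)
qed

text \<open>R_i passes the product of the M_bar modulo the ideal and passes the tensor power of D_R
  exactly. Then it is the outermost factor, and since its entries are central,
  \<open>op_trace_commute\<close> takes it to the other end.\<close>

lemma \<tau>_commute: "A \<in> alg n \<Longrightarrow> B \<in> ops n \<Longrightarrow> \<tau> n (A \<star> B) - \<tau> n (B \<star> A) \<in> J"
proof (induction arbitrary: B rule: alg.induct)
  case (scalar c)
  then show ?case by (simp add: op_mult_scale mult.commute op_one_left op_one_right J_0)
next
  case (gen i)
  let ?T = "cop (tensor_power (D_op R) n)" and ?M = "M_prod F n"
  have T: "?T \<star> r n i = r n i \<star> ?T"
    using tensor_power_r[OF gen(1,2)] by (simp flip: const_op_mult)
  have "?T \<star> (?M \<star> r n i) \<star> cop B \<approx> ?T \<star> (r n i \<star> ?M) \<star> cop B"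
    by (rule cong_J_mult[OF M_prod_rel[OF gen(1,2)]])
  then have "op_trace n (?T \<star> (?M \<star> r n i) \<star> cop B) - op_trace n (?T \<star> (r n i \<star> ?M) \<star> cop B) \<in> J"
    unfolding op_trace_def cong_J_def by (simp flip: sum_subtractf) (intro J_sum, simp)
  also have "?T \<star> (r n i \<star> ?M) \<star> cop B = r n i \<star> (?T \<star> ?M \<star> cop B)"
    by (simp only: op_mult_assoc op_mult_left_cong[OF T])
  also have "op_trace n \<dots> = op_trace n (?T \<star> ?M \<star> cop B \<star> r n i)"
    by (rule op_trace_commute) (rule const_op_central)
  finally show ?case
    by (simp add: \<tau>_def R_trace_eq const_op_mult op_mult_assoc)
next
  case (add A A')
  have "(\<tau> n (A \<star> B) - \<tau> n (B \<star> A)) + (\<tau> n (A' \<star> B) - \<tau> n (B \<star> A')) \<in> J"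
    using add by (intro J_add) auto
  then show ?case by (simp add: op_mult_add \<tau>_add algebra_simps)
next
  case (mult A A')
  \<comment> \<open>A is rotated first and A' second. The partners A' B and B A are why B has to be
    arbitrary in the induction.\<close>
  have "(\<tau> n (A \<star> (A' \<star> B)) - \<tau> n (A' \<star> B \<star> A)) + (\<tau> n (A' \<star> (B \<star> A)) - \<tau> n (B \<star> A \<star> A')) \<in> J"
    using mult by (intro J_add) (auto intro: op_mult_in_ops alg_in_ops)
  then show ?case by (simp add: op_mult_assoc)
qed

abbreviation "cls \<equiv> qma_class R F"

lemma cls_eq_iff: "cls x = cls y \<longleftrightarrow> x - y \<in> J"
proof -
  have "x \<ominus>\<^bsub>ring_of_type_algebra\<^esub> y = x - y"
  proof -
    interpret ring "ring_of_type_algebra :: 'v qfree ring" by (rule ring_of_type_algebra_ring)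
    have "\<ominus>\<^bsub>ring_of_type_algebra\<^esub> y = - y"
      using minus_equality[of "- y" y] by simp
    then show ?thesis by (simp add: a_minus_def)
  qed
  then show ?thesis
    using ring.quotient_eq_iff_same_a_r_cos[OF ring_of_type_algebra_ring ideal_J, of x y]
    by (simp add: qma_class_def)
qed

lemma cls_add: "cls x \<oplus>\<^bsub>QMA R F\<^esub> cls y = cls (x + y)"
  using ideal.a_rcos_sum[OF ideal_J, of x y]
  by (simp add: QMA_def FactRing_def qma_class_def)

lemma cls_mult: "cls x \<otimes>\<^bsub>QMA R F\<^esub> cls y = cls (x * y)"
  using ideal.rcoset_mult_add[OF ideal_J, of x y] by (simp add: QMA_def FactRing_def qma_class_def)

lemma cls_one: "\<one>\<^bsub>QMA R F\<^esub> = cls 1"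
  by (simp add: QMA_def FactRing_def qma_class_def)

lemma carrier_QMA: "carrier (QMA R F) = range cls"
  by (auto simp: QMA_def FactRing_def A_RCOSETS_def RCOSETS_def a_r_coset_def qma_class_def)

lemma ring_QMA: "ring (QMA R F)"
  unfolding QMA_def by (rule ideal.quotient_is_ring[OF ideal_J])

lemma cls_zero: "\<zero>\<^bsub>QMA R F\<^esub> = cls 0"
  by (simp add: QMA_def FactRing_def qma_class_def a_r_coset_def r_coset_def)

lemma cls_minus: "inv\<^bsub>add_monoid (QMA R F)\<^esub> (cls x) = cls (- x)"
proof -
  interpret ring "QMA R F" by (rule ring_QMA)
  have "\<ominus>\<^bsub>QMA R F\<^esub> (cls x) = cls (- x)"
    by (rule minus_equality) (simp_all add: cls_add cls_zero carrier_QMA)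
  then show ?thesis by (simp add: a_inv_def)
qed

lemma subalgebra_cls_image:
  assumes zero: "0 \<in> E" and add: "\<And>x y. x \<in> E \<Longrightarrow> y \<in> E \<Longrightarrow> x + y \<in> E"
    and scale: "\<And>c x. x \<in> E \<Longrightarrow> const c * x \<in> E"
  shows "subalgebra (qma_scalars R F) (cls ` E) (QMA R F)"
proof -
  have "const (-1) * x = - x" for x :: "'v qfree"
  proof -
    have "const (-1) = (-1 :: 'v qfree)"
      using const_simps(3)[of "-1" 1] by (simp add: const_simps eq_neg_iff_add_eq_0)
    then show ?thesis by simp
  qed
  then have "- x \<in> E" if "x \<in> E" for x using scale[OF that, of "-1"] by simp
  then have "inv\<^bsub>add_monoid (QMA R F)\<^esub> y \<in> cls ` E" if "y \<in> cls ` E" for y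
    using that unfolding image_iff by (metis cls_minus)
  then have "subgroup (cls ` E) (add_monoid (QMA R F))"
    by (intro subgroup.intro) (auto simp: carrier_QMA cls_add cls_zero intro: add zero)
  then show ?thesis
    by (auto simp: subalgebra_def subalgebra_axioms_def qma_scalars_def cls_mult intro: scale)
qed

lemma subalgebra_cls:
  assumes "subalgebra (qma_scalars R F) W (QMA R F)"
  shows "cls 0 \<in> W" "cls x \<in> W \<Longrightarrow> cls y \<in> W \<Longrightarrow> cls (x + y) \<in> W" "cls x \<in> W \<Longrightarrow> cls (const c * x) \<in> W"
proof -
  have W: "subgroup W (add_monoid (QMA R F))"
    using assms by (simp add: subalgebra_def)
  show "cls 0 \<in> W" using subgroup.one_closed[OF W] by (simp add: cls_zero)
  show "cls x \<in> W \<Longrightarrow> cls y \<in> W \<Longrightarrow> cls (x + y) \<in> W"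
    using subgroup.m_closed[OF W] by (simp flip: cls_add)
  show "cls x \<in> W \<Longrightarrow> cls (const c * x) \<in> W"
    using subalgebra.smult_closed[OF assms, of "cls (const c)"] by (auto simp: qma_scalars_def simp flip: cls_mult)
qed

lemma subring_cls_image:
  assumes "subalgebra (qma_scalars R F) (cls ` E) (QMA R F)" "1 \<in> E" "\<And>x y. x \<in> E \<Longrightarrow> y \<in> E \<Longrightarrow> x * y \<in> E"
  shows "subring (cls ` E) (QMA R F)"
  using assms unfolding subring_def submonoid_def
  by (auto simp: subalgebra_def carrier_QMA cls_mult cls_one)

lemma subring_cls:
  assumes "subring A (QMA R F)"
  shows "cls 1 \<in> A" "cls x \<in> A \<Longrightarrow> cls y \<in> A \<Longrightarrow> cls (x * y) \<in> A"
  using submonoid.one_closed[of A "QMA R F"] submonoid.m_closed[of A "QMA R F"] assms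
  by (auto simp: subring_def simp flip: cls_mult cls_one)

section \<open>Braid words and their images\<close>

lemma rho_word_Nil: "rho_word R n [] = op_one n"
  by (simp add: rho_word_def op_prod_def)

lemma rho_word_Cons: "rho_word R n ((i, e) # w) = adj n i (if e then R else R') \<star> rho_word R n w"
  by (simp add: rho_word_def op_prod_def)

lemma rho_word_in_ops [simp]: "rho_word R n w \<in> ops n"
  unfolding rho_word_def by (intro op_prod_in_ops) auto

lemma rho_word_append: "rho_word R n (u @ v) = rho_word R n u \<star> rho_word R n v"
  unfolding rho_word_def map_append by (rule op_prod_append) auto

lemma place_rho_word:
  "w \<in> braid_words m \<Longrightarrow> k + m \<le> n \<Longrightarrow> place n k m (rho_word R m w) = rho_word R n (map (\<lambda>(i, e). (k + i, e)) w)"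
proof (induction w)
  case Nil
  then show ?case by (simp add: rho_word_Nil place_one)
next
  case (Cons a w)
  obtain i e where a: "a = (i, e)" by (cases a)
  then have "1 \<le> i" "i < m" "w \<in> braid_words m" using Cons.prems by (auto simp: braid_words_def)
  moreover then have "place n k m (adj m i A) = adj n (k + i) A" for A :: "('v, complex) op"
    using Cons.prems by (simp add: adj_eq_place place_place)
  ultimately show ?case
    using Cons by (simp add: a rho_word_Cons place_mult)
qed

lemma rho_word_step:
  "braid_step u v \<Longrightarrow> u \<in> braid_words n \<Longrightarrow> v \<in> braid_words n \<Longrightarrow> rho_word R n u = rho_word R n v"
proof (induction rule: braid_step.induct)
  case (cancel u i e v)
  have "rho_word R n [(i, e), (i, \<not> e)] = op_one n"
    using cancel inverses by (auto simp: braid_words_def rho_word_Cons rho_word_Nil op_one_right adj_inverse)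
  then show ?case by (simp only: rho_word_append op_one_left[OF rho_word_in_ops])
next
  case (far i j u v)
  then have "1 \<le> i" "i + 2 \<le> j" "j < n" by (auto simp: braid_words_def)
  then have "rho_word R n [(i, True), (j, True)] = rho_word R n [(j, True), (i, True)]"
    using adj_far[of i j n R R] by (simp add: rho_word_Cons rho_word_Nil op_one_right)
  then show ?case by (simp only: rho_word_append)
next
  case (artin u i v)
  then have "1 \<le> i" "Suc i < n" by (auto simp: braid_words_def)
  then have "rho_word R n [(i, True), (Suc i, True), (i, True)] = rho_word R n [(Suc i, True), (i, True), (Suc i, True)]"
    using adj_lift[OF conjunct2[OF R[unfolded R_matrix_def]], of i n] by (simp add: rho_word_Cons rho_word_Nil op_one_right op_mult_assoc)
  then show ?case by (simp only: rho_word_append)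
qed

lemma rho_word_braid_eq: "(u, v) \<in> braid_eq n \<Longrightarrow> rho_word R n u = rho_word R n v"
proof -
  assume "(u, v) \<in> braid_eq n"
  then have "(u, v) \<in> {(u, v). u \<in> braid_words n \<and> v \<in> braid_words n \<and> (braid_step u v \<or> braid_step v u)}\<^sup>*"
    by (simp add: braid_eq_def)
  then show ?thesis
    by (induction rule: rtrancl_induct) (auto dest: rho_word_step)
qed

text \<open>The image of a braid class is a singleton, so \<open>the_elem\<close> in
  \<open>rho\<close> returns the value at any representative.\<close>

lemma rho_word_braid:
  assumes "w \<in> braid_words n"
  shows "the_elem (rho_word R n ` braid n w) = rho_word R n w"
proof -
  have "w \<in> braid n w" using assms by (simp add: braid_def braid_eq_def)
  then have "rho_word R n ` braid n w = {rho_word R n w}"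
    by (auto simp: braid_def dest: rho_word_braid_eq)
  then show ?thesis by simp
qed

lemma braid_group_cases: "b \<in> braid_group n \<Longrightarrow> (\<And>w. w \<in> braid_words n \<Longrightarrow> b = braid n w \<Longrightarrow> thesis) \<Longrightarrow> thesis"
  by (auto simp: braid_group_def braid_def quotient_def)

lemma ch_eq: "ch R F n \<alpha> = cls (\<tau> n (rho R n \<alpha>))"
  by (simp add: ch_def \<tau>_def)

lemma rho_single: "w \<in> braid_words n \<Longrightarrow> rho R n (Poly_Mapping.single (braid n w) 1) = rho_word R n w"
  by (intro ext) (simp add: rho_def rho_word_braid)

lemma \<tau>_0: "\<tau> n (\<lambda>_ _. 0) = 0"
  using \<tau>_scale[of n 0 "\<lambda>_ _. 0"] by (simp add: const_simps)

lemma \<tau>_rho: "\<tau> n (rho R n \<alpha>) =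
    (\<Sum>b\<in>Poly_Mapping.keys \<alpha>. const (Poly_Mapping.lookup \<alpha> b) * \<tau> n (the_elem (rho_word R n ` b)))"
proof -
  have "\<tau> n (\<lambda>xs ys. \<Sum>b\<in>B. Poly_Mapping.lookup \<alpha> b * the_elem (rho_word R n ` b) xs ys) =
      (\<Sum>b\<in>B. const (Poly_Mapping.lookup \<alpha> b) * \<tau> n (the_elem (rho_word R n ` b)))" if "finite B" for B
    using that by (induction B) (simp_all add: \<tau>_0 \<tau>_add \<tau>_scale)
  from this[of "Poly_Mapping.keys \<alpha>"] show ?thesis
    by (simp add: rho_def[abs_def])
qed

end

section \<open>Traces on the BMW algebra\<close>

text \<open>
  The BMW relations on \<open>n\<close> strands, with \<open>sc c\<close> for \<open>c\<close> times the identity: \<open>sc 1\<close> need not be a unit of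
  the whole ring, so that the algebras for all \<open>n\<close> can live in a single type.
\<close>

locale bmw_rep =
  fixes n :: nat and sc :: "complex \<Rightarrow> 'b::ring" and R K :: "nat \<Rightarrow> 'b" and lam mu eta :: complex
  assumes nz: "lam \<noteq> 0" "mu \<noteq> 0" "eta \<noteq> 0"
    and eta_eq: "eta * lam * mu = 1 + lam * mu - mu * mu"
    and sc_add: "sc (a + b) = sc a + sc b"
    and sc_mult: "sc (a * b) = sc a * sc b"
    and R_unit: "\<lbrakk>1 \<le> i; i < n\<rbrakk> \<Longrightarrow> sc 1 * R i = R i"
    and R_sc: "\<lbrakk>1 \<le> i; i < n\<rbrakk> \<Longrightarrow> R i * sc a = sc a * R i"
    and R_sq: "\<lbrakk>1 \<le> i; i < n\<rbrakk> \<Longrightarrow> R i * R i = sc 1 + sc lam * R i - sc (lam * mu) * K i"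
    and K_unit: "\<lbrakk>1 \<le> i; i < n\<rbrakk> \<Longrightarrow> sc 1 * K i = K i"
    and RK: "\<lbrakk>1 \<le> i; i < n\<rbrakk> \<Longrightarrow> R i * K i = sc mu * K i"
    and far: "\<lbrakk>1 \<le> i; i + 2 \<le> j; j < n\<rbrakk> \<Longrightarrow> R i * R j = R j * R i"
    and artin: "\<lbrakk>1 \<le> i; Suc i < n\<rbrakk> \<Longrightarrow> R i * R (Suc i) * R i = R (Suc i) * R i * R (Suc i)"
    and KK: "\<lbrakk>1 \<le> i; Suc i < n\<rbrakk> \<Longrightarrow> K (Suc i) * K i = R i * R (Suc i) * K i"
    and RRKK: "\<lbrakk>1 \<le> i; Suc i < n\<rbrakk> \<Longrightarrow> R (Suc i) * R i * K (Suc i) * K i = K i"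
    and KKK: "\<lbrakk>1 \<le> i; Suc i < n\<rbrakk> \<Longrightarrow> K i * K (Suc i) * K i = K i"
begin

section \<open>Relations on a single pair of strands\<close>

lemma sc_0 [simp]: "sc 0 = 0"
  using sc_add[of 0 0] by simp

lemma sc_minus: "sc (- a) = - sc a"
  using sc_add[of a "- a"] by (simp add: eq_neg_iff_add_eq_0 add.commute)

lemma sc_sc: "sc a * (sc b * x) = sc (a * b) * x"
  by (simp add: sc_mult mult.assoc)

lemma K_eq:
  assumes "1 \<le> i" "i < n"
  shows "K i = sc (1 / (lam * mu)) * (sc 1 + sc lam * R i - R i * R i)"
proof -
  have "sc (1 / (lam * mu)) * (sc (lam * mu) * K i) = K i"
    using nz by (simp add: sc_sc K_unit[OF assms, simplified])
  then show ?thesis by (simp add: R_sq[OF assms])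
qed

lemma K_sc:
  assumes "1 \<le> i" "i < n"
  shows "K i * sc a = sc a * K i"
proof -
  have "sc b * sc a = sc a * sc b" for b
    by (simp flip: sc_mult add: mult.commute)
  moreover have "sc b * R i * sc a = sc a * (sc b * R i)" for b
    using calculation by (metis R_sc assms mult.assoc)
  moreover have "R i * R i * sc a = sc a * (R i * R i)"
    by (metis R_sc assms mult.assoc)
  ultimately have "(sc 1 + sc lam * R i - R i * R i) * sc a = sc a * (sc 1 + sc lam * R i - R i * R i)"
    by (simp add: algebra_simps)
  moreover have "sc b * x * sc a = sc a * (sc b * x)" if "x * sc a = sc a * x" for b x
    using that by (metis mult.assoc mult.commute sc_mult)
  ultimately show ?thesis
    unfolding K_eq[OF assms] by blast
qed

lemma KR:
  assumes "1 \<le> i" "i < n"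
  shows "K i * R i = sc mu * K i"
proof -
  have *: "(sc 1 + sc lam * R i - R i * R i) * R i = R i * (sc 1 + sc lam * R i - R i * R i)"
    using R_sc[OF assms] by (simp add: algebra_simps flip: mult.assoc)
  have "K i * R i = R i * K i"
    by (metis (no_types, lifting) K_eq[OF assms] R_sc[OF assms] * mult.assoc)
  then show ?thesis by (simp add: RK[OF assms])
qed

text \<open>K_i is a polynomial in R_i, with the same coefficients for every i.\<close>

lemma intertwine_K:
  assumes i: "1 \<le> i" "i < n" and j: "1 \<le> j" "j < n"
    and x: "\<And>a. x * sc a = sc a * x" and R: "x * R i = R j * x"
  shows "x * K i = K j * x"
proof -
  have "x * (sc lam * R i) = sc lam * R j * x" "x * (R i * R i) = R j * R j * x"
    using x R by (metis mult.assoc)+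
  then have *: "x * (sc 1 + sc lam * R i - R i * R i) = (sc 1 + sc lam * R j - R j * R j) * x"
    using x by (simp add: algebra_simps)
  show ?thesis
    unfolding K_eq[OF i] K_eq[OF j] using * x by (metis mult.assoc)
qed

lemma far_gen:
  assumes "1 \<le> i" "i < n" "1 \<le> j" "j < n" "i + 2 \<le> j \<or> j + 2 \<le> i"
  shows "R i * R j = R j * R i" "R i * K j = K j * R i" "K i * K j = K j * K i"
proof -
  show *: "R i * R j = R j * R i" using assms far by metis
  then show "R i * K j = K j * R i" using assms by (metis intertwine_K R_sc)
  have "K j * R i = R i * K j" using * assms by (metis intertwine_K R_sc)
  then show "K i * K j = K j * K i" using assms by (metis intertwine_K K_sc)
qed

text \<open>The inverse of R_i. It is obtained from the quadratic expression for R_i R_i on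
  multiplying by the inverse, which acts on K_i as 1 / mu.\<close>

definition Ri :: "nat \<Rightarrow> 'b" where
  "Ri i = R i - sc lam + sc lam * K i"

lemma Ri:
  assumes "1 \<le> i" "i < n"
  shows "Ri i * R i = sc 1" "R i * Ri i = sc 1"
proof -
  have "sc lam * K i * R i = sc (lam * mu) * K i" "R i * (sc lam * K i) = sc (lam * mu) * K i"
    using KR[OF assms] RK[OF assms] R_sc[OF assms] by (metis mult.assoc sc_mult)+
  then show "Ri i * R i = sc 1" "R i * Ri i = sc 1"
    by (simp_all add: Ri_def algebra_simps R_sc[OF assms] R_sq[OF assms])
qed

text \<open>Since R_i acts on K_i as mu, the polynomial defining (lam mu) K_i acts as 1 + lam mu -
  mu^2, and \<open>eta_eq\<close> identifies this number as eta lam mu.\<close>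

lemma K_sq:
  assumes "1 \<le> i" "i < n"
  shows "K i * K i = sc eta * K i"
proof -
  have "sc (lam * mu) * (K i * K i) = (sc 1 + sc lam * R i - R i * R i) * K i"
    by (simp add: R_sq[OF assms] mult.assoc)
  also have "\<dots> = sc (1 + lam * mu - mu * mu) * K i"
  proof -
    have "sc lam * R i * K i = sc (lam * mu) * K i" "R i * R i * K i = sc (mu * mu) * K i"
      by (simp_all add: mult.assoc RK[OF assms] sc_sc)
        (simp add: R_sc[OF assms] RK[OF assms] sc_sc flip: mult.assoc, simp add: mult.assoc RK[OF assms] sc_sc)
    then show ?thesis
      by (simp add: algebra_simps sc_add sc_minus K_unit[OF assms, simplified] diff_conv_add_uminus
          del: add_uminus_conv_diff)
  qed
  also have "\<dots> = sc (lam * mu) * (sc eta * K i)"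
    by (simp add: sc_sc mult.commute mult.left_commute flip: eta_eq)
  finally have "sc (1 / (lam * mu)) * (sc (lam * mu) * (K i * K i)) = sc (1 / (lam * mu)) * (sc (lam * mu) * (sc eta * K i))"
    by simp
  then have "sc 1 * (K i * K i) = sc 1 * (sc eta * K i)"
    using nz by (simp add: sc_sc)
  then show ?thesis
    by (simp add: sc_sc) (simp add: K_unit[OF assms] flip: mult.assoc)
qed

section \<open>Relations between neighbouring strands\<close>

context
  fixes i assumes i: "1 \<le> i" "Suc i < n"
begin

lemma Suc_i: "i < n" "1 \<le> Suc i"
  using i by auto

text \<open>The Artin relation says that R_i R_{i+1} intertwines R_i with R_{i+1};
  \<open>intertwine_K\<close> passes this on to the K's.\<close>

lemma RRK: "R i * R (Suc i) * K i = K (Suc i) * (R i * R (Suc i))"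
  "R (Suc i) * R i * K (Suc i) = K i * (R (Suc i) * R i)"
proof -
  have "R i * R (Suc i) * sc a = sc a * (R i * R (Suc i))"
    "R (Suc i) * R i * sc a = sc a * (R (Suc i) * R i)" for a
    using R_sc i Suc_i by (metis mult.assoc)+
  then show "R i * R (Suc i) * K i = K (Suc i) * (R i * R (Suc i))"
    "R (Suc i) * R i * K (Suc i) = K i * (R (Suc i) * R i)"
    using i Suc_i artin[OF i] by (intro intertwine_K; simp add: mult.assoc)+
qed

lemma KRK: "sc mu * (K i * R (Suc i) * K i) = K i"
  using KKK[OF i] KK[OF i] KR[OF i(1) Suc_i(1)] by (metis mult.assoc)

lemma K2_unit: "K (Suc i) * sc 1 = K (Suc i)"
  by (simp add: K_sc i Suc_i K_unit)

text \<open>The mirror image of the assumed relation \<open>KKK\<close>. With u = R_i R_{i+1}, which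
  carries K_i to K_{i+1}, the left side times u reduces to K_{i+1} u by \<open>KRK\<close>; then u
  is cancelled by means of its inverse ?v.\<close>

lemma KKK': "K (Suc i) * K i * K (Suc i) = K (Suc i)"
proof -
  let ?u = "R i * R (Suc i)" and ?v = "Ri (Suc i) * Ri i"
  have uv: "K (Suc i) * (?u * ?v) = K (Suc i)"
    using Ri i Suc_i by (metis (no_types, lifting) R_sc R_unit K2_unit mult.assoc)
  have "K (Suc i) * K i * K (Suc i) * ?u = K (Suc i) * (K i * R i * R (Suc i) * K i)"
    using RRK by (metis mult.assoc)
  also have "\<dots> = K (Suc i) * (sc mu * (K i * R (Suc i) * K i))"
    using KR i Suc_i by (metis mult.assoc)
  also have "\<dots> = K (Suc i) * ?u"
    using KRK KK[OF i] RRK by simp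
  finally show ?thesis using uv by (metis mult.assoc)
qed

lemma KK': "K i * K (Suc i) = R (Suc i) * R i * K (Suc i)"
  using KKK' RRKK[OF i] by (metis mult.assoc)

lemma RK_up: "R (Suc i) * K i = Ri i * K (Suc i) * K i"
  using KK[OF i] Ri R_unit i Suc_i by (metis mult.assoc)

lemma RKR: "R (Suc i) * K i * R (Suc i) = Ri i * K (Suc i) * Ri i"
proof -
  have "K i * R (Suc i) = K i * K (Suc i) * Ri i"
  proof -
    have "K i * K (Suc i) * Ri i = K i * R (Suc i) * (R i * Ri i)"
      unfolding KK' RRK by (simp add: mult.assoc)
    also have "\<dots> = K i * (sc 1 * R (Suc i))"
      using R_sc[OF Suc_i(2) i(2)] by (simp add: Ri(2)[OF i(1) Suc_i(1)] mult.assoc)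
    finally show ?thesis by (simp add: R_unit[OF Suc_i(2) i(2)])
  qed
  then have "R (Suc i) * K i * R (Suc i) = Ri i * (K (Suc i) * K i * K (Suc i)) * Ri i"
    unfolding mult.assoc by (simp add: RK_up flip: mult.assoc)
  then show ?thesis
    by (simp only: KKK')
qed

lemma RKK: "R (Suc i) * K i * K (Suc i) = Ri i * K (Suc i)"
  using KKK' by (simp add: RK_up mult.assoc)

lemma KRK': "sc mu * (K (Suc i) * R i * K (Suc i)) = K (Suc i)"
  using KK' KR KKK' i Suc_i by (metis mult.assoc)

end


section \<open>The algebras on the first k of the n strands\<close>

inductive_set W :: "nat \<Rightarrow> 'b set" for k where
  scalar: "sc c \<in> W k"
| gen: "\<lbrakk>1 \<le> i; i < k\<rbrakk> \<Longrightarrow> R i \<in> W k"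
| add: "\<lbrakk>x \<in> W k; y \<in> W k\<rbrakk> \<Longrightarrow> x + y \<in> W k"
| mult: "\<lbrakk>x \<in> W k; y \<in> W k\<rbrakk> \<Longrightarrow> x * y \<in> W k"

lemma W_mono: "\<lbrakk>x \<in> W k; k \<le> l\<rbrakk> \<Longrightarrow> x \<in> W l"
  by (induction rule: W.induct) (auto intro: W.intros)

lemma W_minus: "\<lbrakk>x \<in> W k; y \<in> W k; sc 1 * y = y\<rbrakk> \<Longrightarrow> x - y \<in> W k"
  using W.add[OF _ W.mult[OF W.scalar[of "-1"]], of x k y] by (simp add: sc_minus)

lemma K_in_W: "\<lbrakk>1 \<le> i; i < k; k \<le> n\<rbrakk> \<Longrightarrow> K i \<in> W k"
  using R_unit[of i] by (subst K_eq) (auto intro!: W_minus W.intros simp flip: mult.assoc)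

lemma Ri_in_W: "\<lbrakk>1 \<le> i; i < k; k \<le> n\<rbrakk> \<Longrightarrow> Ri i \<in> W k"
  unfolding Ri_def by (intro W_minus W.add W.mult K_in_W W.scalar W.gen) (auto simp flip: sc_mult)

lemma W_unit: "x \<in> W k \<Longrightarrow> k \<le> n \<Longrightarrow> sc 1 * x = x"
proof (induction rule: W.induct)
  case (mult x y)
  then show ?case by (metis mult.assoc)
qed (auto simp: algebra_simps R_unit simp flip: sc_mult)

lemma W_sc: "x \<in> W k \<Longrightarrow> k \<le> n \<Longrightarrow> x * sc c = sc c * x"
proof (induction rule: W.induct)
  case (mult x y)
  then show ?case by (metis mult.assoc)
qed (auto simp: algebra_simps R_sc mult.commute simp flip: sc_mult)

lemma W_unit_right: "x \<in> W k \<Longrightarrow> k \<le> n \<Longrightarrow> x * sc 1 = x"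
  by (simp add: W_sc W_unit)

lemma W_commute_R: "\<lbrakk>x \<in> W k; k < j; j < n\<rbrakk> \<Longrightarrow> R j * x = x * R j"
proof (induction rule: W.induct)
  case (mult x y)
  then show ?case by (metis mult.assoc)
next
  case (gen i)
  then show ?case using far_gen(1)[of j i] by simp
qed (auto simp: algebra_simps R_sc)

lemma W_commute_K: "\<lbrakk>x \<in> W k; k < j; j < n\<rbrakk> \<Longrightarrow> K j * x = x * K j"
  using intertwine_K[of j j x] W_sc[of x k] W_commute_R[of x k j] by simp

lemma W_one: "k \<le> 1 \<Longrightarrow> x \<in> W k \<Longrightarrow> \<exists>c. x = sc c"
  by (rotate_tac, induction rule: W.induct) (auto simp flip: sc_add sc_mult)

text \<open>Sums of words with at most one letter of index k. \<open>W_Suc\<close> shows that they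
  exhaust \<open>W (Suc k)\<close>.\<close>

inductive_set S :: "nat \<Rightarrow> 'b set" for k where
  base: "x \<in> W k \<Longrightarrow> x \<in> S k"
| R: "\<lbrakk>x \<in> W k; y \<in> W k\<rbrakk> \<Longrightarrow> x * R k * y \<in> S k"
| K: "\<lbrakk>x \<in> W k; y \<in> W k\<rbrakk> \<Longrightarrow> x * K k * y \<in> S k"
| add: "\<lbrakk>x \<in> S k; y \<in> S k\<rbrakk> \<Longrightarrow> x + y \<in> S k"

lemma S_left: "\<lbrakk>s \<in> S k; x \<in> W k\<rbrakk> \<Longrightarrow> x * s \<in> S k"
  by (induction rule: S.induct)
    (auto simp: distrib_left simp flip: mult.assoc intro: S.intros W.mult)

lemma S_right: "\<lbrakk>s \<in> S k; x \<in> W k\<rbrakk> \<Longrightarrow> s * x \<in> S k"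
proof (induction rule: S.induct)
  case (R y z)
  then show ?case using S.R[of y k "z * x"] by (simp add: mult.assoc W.mult)
next
  case (K y z)
  then show ?case using S.K[of y k "z * x"] by (simp add: mult.assoc W.mult)
qed (auto simp: distrib_right intro: S.intros W.mult)

lemma S_R: "1 \<le> k \<Longrightarrow> k < n \<Longrightarrow> R k \<in> S k"
  using S.R[OF W.scalar W.scalar, of 1 k 1] by (simp add: R_unit[simplified] R_sc[simplified])

lemma S_K: "1 \<le> k \<Longrightarrow> k < n \<Longrightarrow> K k \<in> S k"
  using S.K[OF W.scalar W.scalar, of 1 k 1] by (simp add: K_unit[simplified] K_sc[simplified])

lemma S_minus: "\<lbrakk>x \<in> S k; y \<in> S k; sc 1 * y = y\<rbrakk> \<Longrightarrow> x - y \<in> S k"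
  using S.add[OF _ S_left[OF _ W.scalar[of "-1"]], of x k y] by (simp add: sc_minus)

lemma S_RZ:
  assumes k: "1 \<le> k" "k < n" and Z: "Z \<in> {R k, K k}"
  shows "R k * Z \<in> S k"
proof -
  have "R k * R k \<in> S k"
    unfolding R_sq[OF k] using k
    by (intro S_minus S.add S_left S_K S_R) (auto intro: S.base W.scalar simp flip: sc_mult simp: sc_sc)
  then show ?thesis
    using Z k by (auto simp: RK[OF k, simplified] intro: S_left[OF S_K W.scalar, simplified])
qed

text \<open>Each of the four words with two letters of index k + 1 around one of index k is
  rewritten with a single letter of index k + 1: by \<open>artin\<close>, \<open>KK'\<close>,
  \<open>RKR\<close> and \<open>RKK\<close>.\<close>

lemma S_RYZ:
  assumes k: "1 \<le> k" "Suc k < n" and Y: "Y \<in> {R k, K k}" and Z: "Z \<in> {R (Suc k), K (Suc k)}"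
  shows "R (Suc k) * Y * Z \<in> S (Suc k)"
proof -
  have in_W: "R k \<in> W (Suc k)" "K k \<in> W (Suc k)" "Ri k \<in> W (Suc k)"
    using k by (auto intro: W.gen K_in_W Ri_in_W)
  have "R (Suc k) * R k * R (Suc k) \<in> S (Suc k)"
    using k in_W by (auto simp: simp flip: artin intro!: S.R)
  moreover have "R (Suc k) * R k * K (Suc k) \<in> S (Suc k)"
    using k in_W S_left[OF S_K, of "Suc k" "K k"] by (simp flip: KK')
  moreover have "R (Suc k) * K k * R (Suc k) \<in> S (Suc k)"
    using k in_W by (auto simp: RKR[OF k] intro!: S.K)
  moreover have "R (Suc k) * K k * K (Suc k) \<in> S (Suc k)"
    using k in_W by (auto simp: RKK[OF k] intro!: S_left S_K)
  ultimately show ?thesis using Y Z by auto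
qed

text \<open>Every x in \<open>W (Suc k)\<close> is x * sc 1, so closure of \<open>S k\<close> under
  left multiplication by generators suffices. The only new generator is R_k, and meeting a second
  letter of index k is what \<open>RbZ\<close> deals with.\<close>

lemma W_Suc_step:
  assumes k: "1 \<le> k" "k < n"
    and RbZ: "\<And>b Z. \<lbrakk>b \<in> W k; Z \<in> {R k, K k}\<rbrakk> \<Longrightarrow> R k * b * Z \<in> S k"
  shows "x \<in> W (Suc k) \<Longrightarrow> x \<in> S k"
proof -
  have R: "R k * s \<in> S k" if "s \<in> S k" for s
    using that
  proof (induction rule: S.induct)
    case (base x)
    then show ?case using S.R[OF W.scalar, of x k 1] R_unit[OF k] by simp
  next
    case (R x y)
    then show ?case using S_right[OF RbZ, of x "R k" y] by (simp add: mult.assoc)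
  next
    case (K x y)
    then show ?case using S_right[OF RbZ, of x "K k" y] by (simp add: mult.assoc)
  qed (auto simp: distrib_left intro: S.add)
  have left: "x * s \<in> S k" if "x \<in> W (Suc k)" "s \<in> S k" for x s
    using that
  proof (induction arbitrary: s rule: W.induct)
    case (gen i)
    then show ?case using R S_left[OF _ W.gen, of s k i] by (cases "i = k") auto
  qed (auto simp: distrib_right mult.assoc intro: S.add S_left W.scalar)
  assume x: "x \<in> W (Suc k)"
  then have "x * sc 1 \<in> S k"
    by (intro left S.base W.scalar)
  then show "x \<in> S k" using W_unit_right[OF x] k by simp
qed

text \<open>To treat R_{k+1} b Z with b in W_{k+1}, the induction hypothesis writes b as a sum of
  terms in W_k and terms b' Y c with b', c in W_k. These outer parts commute with letters of index k
  + 1 and move out of the way, leaving the words of \<open>S_RZ\<close> and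
  \<open>S_RYZ\<close>.\<close>

lemma W_Suc: "1 \<le> k \<Longrightarrow> k < n \<Longrightarrow> x \<in> W (Suc k) \<Longrightarrow> x \<in> S k"
proof (induction k arbitrary: x rule: nat_induct_at_least)
  case base
  have "R 1 * b * Z \<in> S 1" if b: "b \<in> W 1" and Z: "Z \<in> {R 1, K 1}" for b Z
  proof -
    obtain c where "b = sc c" using W_one[OF _ b] by auto
    then show ?thesis
      using S_left[OF S_RZ[OF _ base(1) Z] W.scalar, of c] R_sc[OF _ base(1)]
      by (simp add: mult.assoc[symmetric])
  qed
  then show ?case using W_Suc_step[of 1] base by (metis One_nat_def order_refl)
next
  case (Suc k)
  have "R (Suc k) * b * Z \<in> S (Suc k)" if b: "b \<in> W (Suc k)" and Z: "Z \<in> {R (Suc k), K (Suc k)}" for b Z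
  proof -
    have comm: "R (Suc k) * b = b * R (Suc k)" "Z * b = b * Z" if "b \<in> W k" for b
      using W_commute_R[OF that, of "Suc k"] W_commute_K[OF that, of "Suc k"] Suc Z by auto
    have YZ: "R (Suc k) * (b * Y * c) * Z \<in> S (Suc k)" if "b \<in> W k" "c \<in> W k" "Y \<in> {R k, K k}" for b c Y
    proof -
      have "R (Suc k) * (b * Y * c) * Z = b * (R (Suc k) * Y * (c * Z))"
        by (simp add: comm(1)[OF that(1)] flip: mult.assoc)
      also have "\<dots> = b * (R (Suc k) * Y * Z * c)"
        by (simp add: comm(2)[OF that(2), symmetric] mult.assoc)
      finally show ?thesis
        using S_left[OF S_right[OF S_RYZ[OF Suc(1) Suc.prems(1) that(3) Z], of c], of b] that(1,2)
        by (simp add: W_mono)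
    qed
    have "b \<in> S k" using Suc b by simp
    then show ?thesis
    proof (induction rule: S.induct)
      case (base x)
      then show ?case using S_RZ[OF _ Suc.prems(1) Z] comm(1)[OF base] W_mono[OF base, of "Suc k"]
        by (auto simp: mult.assoc intro: S_left)
    next
      case (add x y)
      then show ?case by (auto simp: distrib_left distrib_right intro: S.add)
    qed (use YZ in auto)
  qed
  then show ?case using W_Suc_step[of "Suc k"] Suc by simp
qed

text \<open>\<open>Rs k m\<close> is the descending product $R_{k+m-1} \cdots R_{k+1} R_k$.\<close>

fun Rs :: "nat \<Rightarrow> nat \<Rightarrow> 'b" where
  "Rs k 0 = sc 1"
| "Rs k (Suc m) = R (k + m) * Rs k m"

lemma Rs_in_W: "1 \<le> k \<Longrightarrow> k + m \<le> l \<Longrightarrow> Rs k m \<in> W l"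
  by (induction m) (auto intro!: W.intros)

lemma Rs_Suc_bottom: "1 \<le> k \<Longrightarrow> k + m < n \<Longrightarrow> Rs k (Suc m) = Rs (Suc k) m * R k"
  by (induction m) (auto simp: mult.assoc R_sc)

lemma Rs_commute: "\<lbrakk>x \<in> W j; j < k; k + m \<le> n\<rbrakk> \<Longrightarrow> Rs k m * x = x * Rs k m"
proof (induction m)
  case 0
  then show ?case by (simp add: W_sc)
next
  case (Suc m)
  then have "Rs k (Suc m) * x = R (k + m) * x * Rs k m"
    by (simp add: mult.assoc)
  then show ?case
    using W_commute_R[OF Suc.prems(1), of "k + m"] Suc.prems by (simp add: mult.assoc)
qed

section \<open>Reduction of words under a cyclic predicate\<close>

lemma KZK:
  assumes "1 \<le> k" "Suc k < n" "Z \<in> {R k, K k}"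
  shows "\<exists>c. K (Suc k) * Z * K (Suc k) = sc c * K (Suc k)"
proof (cases "Z = K k")
  case True
  then show ?thesis using KKK'[OF assms(1,2)] K_unit[of "Suc k"] assms by (intro exI[of _ 1]) simp
next
  case False
  \<comment> \<open>Here Z is R_k, and the constant is 1 / mu by \<open>KRK'\<close>.\<close>
  have "sc (1 / mu) * (sc mu * (K (Suc k) * R k * K (Suc k))) = K (Suc k) * R k * K (Suc k)"
    using nz K_unit[of "Suc k"] assms unfolding sc_sc by (simp flip: mult.assoc)
  then have "K (Suc k) * R k * K (Suc k) = sc (1 / mu) * K (Suc k)"
    by (simp add: KRK'[OF assms(1,2)])
  then show ?thesis using False assms by blast
qed

text \<open>\<open>T\<close> is to be read as "the value of a fixed trace at x lies in a given
  subalgebra". A predicate serves better than the trace itself, since the values to be controlled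
  are products of unknown elements of that subalgebra.\<close>

context
  fixes T :: "'b \<Rightarrow> bool"
  assumes T_add: "\<And>x y. T x \<Longrightarrow> T y \<Longrightarrow> T (x + y)"
    and T_sc: "\<And>x c. T x \<Longrightarrow> T (sc c * x)"
    and T_cyc: "\<And>x y. x \<in> W n \<Longrightarrow> y \<in> W n \<Longrightarrow> T (x * y) \<Longrightarrow> T (y * x)"
begin

lemma T_K:
  assumes n: "2 \<le> n" and K1: "n = 2 \<Longrightarrow> T (K 1)"
    and Kn: "\<And>y. 3 \<le> n \<Longrightarrow> y \<in> W (n - 2) \<Longrightarrow> T (K (n - 1) * y)"
    and y: "y \<in> W (n - 1)"
  shows "T (K (n - 1) * y)"
proof (cases "n = 2")
  case True
  then obtain c where "y = sc c" using W_one y by fastforce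
  then show ?thesis using K1 T_sc[of "K 1" c] K_sc[of 1 c] True by simp
next
  case False
  \<comment> \<open>Now n - 1 is k + 2 and n - 2 is k + 1, so \<open>W_Suc\<close> at k + 1 splits y
    along the letters next to K_{n-1}.\<close>
  define k where "k = n - 3"
  have k: "n = Suc (Suc (Suc k))" using n False by (simp add: k_def)
  let ?K = "K (Suc (Suc k))"
  have K: "?K \<in> W n" by (rule K_in_W) (auto simp: k)
  have KK: "?K * ?K = sc eta * ?K" by (rule K_sq) (auto simp: k)
  have Wn: "x \<in> W n" if "x \<in> W (Suc k)" for x using that by (rule W_mono) (simp add: k)
  have Kc: "?K * x = x * ?K" if "x \<in> W (Suc k)" for x
    using that by (rule W_commute_K) (auto simp: k)
  have Kn': "T (?K * x)" if "x \<in> W (Suc k)" for x using that Kn[of x] k by simp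
  have KZK: "T (?K * (a * Z * b) * ?K)" if abZ: "a \<in> W (Suc k)" "b \<in> W (Suc k)" "Z \<in> {R (Suc k), K (Suc k)}" for a b Z
  proof -
    obtain c where c: "?K * Z * ?K = sc c * ?K"
      using KZK[of "Suc k" Z] abZ k by auto
    have "?K * (a * Z * b) * ?K = a * (?K * Z * ?K) * b"
      by (simp add: Kc[OF abZ(1)] mult.assoc) (simp add: Kc[OF abZ(1)] Kc[OF abZ(2)] flip: mult.assoc)
    also have "\<dots> = a * sc c * ?K * b"
      by (simp only: c) (simp only: mult.assoc)
    also have "\<dots> = sc c * (?K * (a * b))"
      using Kc[OF abZ(1)] W_sc[OF abZ(1)] k by (simp add: mult.assoc[symmetric])
    finally show ?thesis using T_sc Kn' abZ by (simp add: W.mult)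
  qed
  have "y \<in> S (Suc k)" using W_Suc[of "Suc k" y] y k by simp
  then have "T (?K * y * ?K)"
  proof (induction rule: S.induct)
    case (base x)
    have "?K * x * ?K = sc eta * (?K * x)"
      by (simp add: mult.assoc flip: Kc[OF base]) (simp add: KK flip: mult.assoc)
    then show ?case using T_sc Kn' base by simp
  next
    case (add x y)
    then show ?case by (auto simp: distrib_left distrib_right intro: T_add)
  qed (use KZK in auto)
  moreover have "y \<in> W n" using y W_mono by force
  ultimately have "T (?K * (?K * y))"
    using K T_cyc[of "?K * y" ?K] by (simp add: W.mult)
  then have "T (sc eta * (?K * y))"
    by (simp add: KK flip: mult.assoc)
  then have "T (sc (1 / eta) * (sc eta * (?K * y)))"
    by (rule T_sc)
  then show ?thesis using nz K_unit[of "Suc (Suc k)"] k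
    unfolding sc_sc by (simp flip: mult.assoc)
qed

text \<open>Induction on the number m of letters R before K_k. In R_{k+1} K_k = R_k^{-1} K_{k+1} K_k
  the inverse commutes with R_{k+2}, ..., R_{n-1}, so it can be rotated to the end, where K_k y
  R_k^{-1} is an element of W_{k+1}. The word now has K_{k+1} with one letter less before
  it.\<close>

lemma T_RK:
  assumes K: "\<And>y. y \<in> W (n - 1) \<Longrightarrow> T (K (n - 1) * y)"
  shows "\<lbrakk>1 \<le> k; n = Suc (k + m); y \<in> W k\<rbrakk> \<Longrightarrow> T (Rs (Suc k) m * K k * y)"
proof (induction m arbitrary: k y)
  case 0
  then show ?case using K[of y] K_unit[of k] by simp
next
  case (Suc m)
  let ?x = "Rs (Suc (Suc k)) m * K (Suc k) * K k * y"
  have k: "1 \<le> k" "Suc k < n" using Suc.prems by auto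
  have in_W: "Ri k \<in> W (Suc k)" "K k \<in> W (Suc k)" "y \<in> W (Suc k)"
    using Ri_in_W[of k "Suc k"] K_in_W[of k "Suc k"] k Suc.prems W_mono[of y k "Suc k"] by auto
  have x: "?x \<in> W n"
    using Suc.prems k in_W[THEN W_mono, of n] by (intro W.mult Rs_in_W K_in_W) auto
  have "T (Rs (Suc (Suc k)) m * K (Suc k) * (K k * y * Ri k))"
    using Suc.prems in_W by (intro Suc.IH) (auto intro: W.mult)
  then have "T (?x * Ri k)"
    by (simp add: mult.assoc)
  then have "T (Ri k * ?x)"
    using x in_W(1)[THEN W_mono, of n] k T_cyc[of ?x "Ri k"] by simp
  moreover have "Rs (Suc k) (Suc m) * K k * y = Rs (Suc (Suc k)) m * (R (Suc k) * K k) * y"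
    using Suc.prems by (subst Rs_Suc_bottom) (auto simp: mult.assoc)
  moreover have "Ri k * ?x = Rs (Suc (Suc k)) m * (R (Suc k) * K k) * y"
    using Rs_commute[OF in_W(1), of "Suc (Suc k)" m] Suc.prems
    unfolding RK_up[OF k] by (simp add: mult.assoc[symmetric])
  ultimately show ?case by simp
qed

text \<open>Induction on k for the words R_{n-1} ... R_k y with y in W_k; at k = n the prefix is the
  identity and y is arbitrary. At k = 1, y is a scalar and the word is that of a power sum. In the
  step to k + 1, y is split by \<open>W_Suc\<close>: a part in W_k falls under \<open>Rn\<close>, a
  part a R_k b rotates to R_{n-1} ... R_k b a, which is the previous case, and a part a K_k b
  rotates to the form of \<open>T_RK\<close>.\<close>

lemma T_all:
  assumes n: "1 \<le> n"
    and power: "T (Rs 1 (n - 1))"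
    and K1: "n = 2 \<Longrightarrow> T (K 1)"
    and Kn: "\<And>y. 3 \<le> n \<Longrightarrow> y \<in> W (n - 2) \<Longrightarrow> T (K (n - 1) * y)"
    and Rn: "\<And>k y. \<lbrakk>1 \<le> k; k < n; y \<in> W k\<rbrakk> \<Longrightarrow> T (Rs (Suc k) (n - Suc k) * y)"
    and y: "y \<in> W n"
  shows "T y"
proof -
  have RK: "T (Rs (Suc k) (n - Suc k) * K k * y)" if "1 \<le> k" "k < n" "y \<in> W k" for k y
    using that T_K[OF _ K1 Kn] by (intro T_RK) auto
  have "T (Rs k (n - k) * y)" if "1 \<le> k" "k \<le> n" "y \<in> W k" for k y
    using that
  proof (induction k arbitrary: y rule: nat_induct_at_least)
    case base
    then obtain c where "y = sc c" using W_one by blast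
    moreover have "Rs 1 (n - 1) * sc c = sc c * Rs 1 (n - 1)"
      using n by (intro W_sc[of _ n] Rs_in_W) auto
    ultimately show ?case using T_sc[OF power] by simp
  next
    case (Suc k)
    have RZ: "T (Rs (Suc k) (n - Suc k) * (a * Z * b))"
      if "a \<in> W k" "b \<in> W k" "Z \<in> {R k, K k}" for a b Z
    proof -
      have ab: "b * a \<in> W k" "a \<in> W n" "b \<in> W n"
        using that Suc.prems W_mono[of _ k n] by (auto intro: W.mult)
      have Z: "Rs (Suc k) (n - Suc k) \<in> W n" "Z \<in> W n"
        using that Suc by (auto intro!: Rs_in_W K_in_W W.gen)
      have "T (Rs (Suc k) (n - Suc k) * Z * (b * a))"
      proof (cases "Z = K k")
        case True
        then show ?thesis using RK ab Suc by simp
      next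
        case False
        have "Rs k (n - k) = Rs (Suc k) (n - Suc k) * R k"
          using Rs_Suc_bottom[of k "n - Suc k"] Suc by (simp add: Suc_diff_Suc)
        then show ?thesis using False that Suc.IH[of "b * a"] ab Suc.prems by simp
      qed
      then have "T (a * (Rs (Suc k) (n - Suc k) * Z * b))"
        using ab Z T_cyc[of "Rs (Suc k) (n - Suc k) * Z * b" a] by (simp add: mult.assoc W.mult)
      then show ?thesis
        using Rs_commute[OF that(1), of "Suc k" "n - Suc k"] Suc.prems by (simp flip: mult.assoc)
    qed
    have "y \<in> S k" using W_Suc Suc by simp
    then show ?case
    proof (induction rule: S.induct)
      case (base x)
      then show ?case using Rn Suc by simp
    next
      case (add x y)
      then show ?case by (simp add: distrib_left T_add)
    qed (use RZ in auto)
  qed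
  from this[of n y] show ?thesis using n y W_unit by simp
qed

end

end

section \<open>The characteristic subalgebra\<close>

text \<open>A ring type into which the operators on all tensor powers embed, as the BMW reduction is
  stated for a type of class \<open>ring\<close>. That class asks for no unit, and
  \<open>op_one n\<close> is neutral on \<open>ops n\<close> only.\<close>

typedef 'v mat = "UNIV :: ('v::finite, complex) op set"
  morphisms entries Mat by simp

lemmas mat_simps [simp] = Mat_inverse[OF UNIV_I] entries_inverse

instantiation mat :: (finite) ring
begin

definition "0 = Mat (\<lambda>_ _. 0)"
definition "A + B = Mat (\<lambda>xs ys. entries A xs ys + entries B xs ys)"
definition "- A = Mat (\<lambda>xs ys. - entries A xs ys)"
definition "A - B = Mat (\<lambda>xs ys. entries A xs ys - entries B xs ys)"
definition "A * B = Mat (entries A \<star> entries B)"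

instance
  by standard (simp_all add: zero_mat_def plus_mat_def uminus_mat_def minus_mat_def times_mat_def
      op_mult_assoc op_mult_add add_ac)

end

lemma entries_add: "entries (A + B) = (\<lambda>xs ys. entries A xs ys + entries B xs ys)"
  and entries_mult: "entries (A * B) = entries A \<star> entries B"
  by (simp_all add: plus_mat_def times_mat_def)

lemma Mat_arith:
  "Mat A + Mat B = Mat (\<lambda>xs ys. A xs ys + B xs ys)" "Mat A - Mat B = Mat (\<lambda>xs ys. A xs ys - B xs ys)"
  "Mat A * Mat B = Mat (A \<star> B)"
  by (simp_all add: plus_mat_def minus_mat_def times_mat_def)

section \<open>R-matrices of BMW-type satisfy the BMW relations\<close>

locale bmw_quantum_matrices = quantum_matrices R F for R F :: "('v::finite, complex) op" +
  fixes q \<mu> :: complex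
  assumes q: "q \<noteq> 0" "q \<noteq> 1" "q \<noteq> -1" and \<mu>: "\<mu> \<noteq> 0" "\<mu> \<noteq> q" "\<mu> \<noteq> - inverse q"
    and BMW: "BMW_type q \<mu> R"
begin

abbreviation "K \<equiv> BMW_K q \<mu> R"

definition lam :: complex where "lam = q - inverse q"

lemma lam: "lam \<noteq> 0"
proof
  assume "lam = 0"
  then have "q * q = 1" using q by (simp add: lam_def field_simps)
  then show False using q by (simp add: square_eq_1_iff)
qed

text \<open>That eta is nonzero comes from mu being different from q and -1/q. It permits both K =
  K^2 / eta and the recovery of ch(K) from the 2-contraction.\<close>

lemma eta: "BMW_eta q \<mu> \<noteq> 0" "BMW_eta q \<mu> * lam * \<mu> = 1 + lam * \<mu> - \<mu> * \<mu>"
proof -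
  have "inverse q + \<mu> \<noteq> 0" using \<mu> by (metis add.commute add_eq_0_iff)
  then show "BMW_eta q \<mu> \<noteq> 0" using \<mu> lam by (simp add: BMW_eta_def lam_def)
  have "BMW_eta q \<mu> * lam * \<mu> = (q - \<mu>) * (inverse q + \<mu>)"
    using \<mu> lam by (simp add: BMW_eta_def lam_def)
  also have "\<dots> = 1 + lam * \<mu> - \<mu> * \<mu>"
    using q by (simp add: lam_def algebra_simps)
  finally show "BMW_eta q \<mu> * lam * \<mu> = 1 + lam * \<mu> - \<mu> * \<mu>" .
qed

lemma K_index: "K xs ys = (op_one 2 xs ys + lam * R xs ys - (R \<star> R) xs ys) / (lam * \<mu>)"
proof -
  have *: "(\<lambda>xs ys. q * op_one 2 xs ys - R xs ys) \<star> (\<lambda>xs ys. inverse q * op_one 2 xs ys + R xs ys) =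
    (\<lambda>xs ys. op_one 2 xs ys + lam * R xs ys - (R \<star> R) xs ys)"
  proof -
    have neg: "(\<lambda>xs ys. q * op_one 2 xs ys - R xs ys) = (\<lambda>xs ys. q * op_one 2 xs ys + (-1) * R xs ys)"
      by (intro ext) simp
    show ?thesis
      unfolding neg op_mult_add op_mult_scale
      using q inverses(1)
      by (intro ext) (simp add: op_mult_scale mult.commute op_one_left op_one_right lam_def algebra_simps)
  qed
  show ?thesis
    unfolding BMW_K_def * by (simp add: divide_inverse lam_def[symmetric] inverse_mult_distrib mult_ac)
qed

lemma K_in_ops: "K \<in> ops 2"
  using inverses(1) op_mult_in_ops[OF inverses(1) inverses(1)] by (auto simp: K_index ops_def op_one_def)

lemma cubic: "(R \<star> (R \<star> R)) xs ys = (\<mu> + lam) * (R \<star> R) xs ys + (1 - lam * \<mu>) * R xs ys - \<mu> * op_one 2 xs ys"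
proof -
  let ?p = "[:q, -1:] * [:inverse q, 1:] * [:\<mu>, -1:]"
  \<comment> \<open>The first two factors multiply to 1 + lam x - x^2, the polynomial that also
    defines K.\<close>
  have p: "?p = [:\<mu>, lam * \<mu> - 1, - (\<mu> + lam), 1:]"
    using q by (simp add: lam_def algebra_simps)
  have End: "A \<otimes>\<^bsub>End 2\<^esub> B = A \<star> B" "\<one>\<^bsub>End 2\<^esub> = (op_one 2 :: ('v, complex) op)" for A B :: "('v, complex) op"
    by (simp_all add: End_def)
  have "poly_op 2 ?p R xs ys = 0"
    using BMW by (simp add: BMW_type_def is_minimal_poly_def)
  then show ?thesis
    unfolding p poly_op_def
    using inverses(1) by (simp add: numeral_3_eq_3 End op_one_left op_mult_assoc algebra_simps)
qed

text \<open>K is a multiple of the first two factors of the minimal polynomial, so the third factor,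
  mu - R, annihilates it.\<close>

lemma RK: "R \<star> K = (\<lambda>xs ys. \<mu> * K xs ys)"
proof -
  define c where "c = 1 / (lam * \<mu>)"
  have K: "K = (\<lambda>xs ys. (c * op_one 2 xs ys + (c * lam) * R xs ys) + (- c) * (R \<star> R) xs ys)"
    by (intro ext) (simp add: K_index c_def diff_divide_distrib add_divide_distrib)
  have "R \<star> K = (\<lambda>xs ys. (c * R xs ys + (c * lam) * (R \<star> R) xs ys) + (- c) * (R \<star> (R \<star> R)) xs ys)"
    unfolding K op_mult_add op_mult_scale(2)[OF mult.commute] using inverses(1) by (simp only: op_one_right)
  then show ?thesis
    by (intro ext) (simp add: K cubic algebra_simps)
qed

lemma K_rel: "adj 3 2 K \<star> adj 3 1 K = adj 3 1 R \<star> adj 3 2 R \<star> adj 3 1 K"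
  "adj 3 2 K \<star> adj 3 1 K = adj 3 1 R' \<star> adj 3 2 R' \<star> adj 3 1 K"
  "adj 3 1 K \<star> adj 3 2 K \<star> adj 3 1 K = adj 3 1 K"
  using BMW unfolding BMW_type_def Let_def by blast+

lemma adj_RR:
  assumes "1 \<le> i" "i < n"
  shows "adj n i R \<star> adj n i R = (\<lambda>xs ys. op_one n xs ys + lam * adj n i R xs ys - lam * \<mu> * adj n i K xs ys)"
  using \<mu> lam
  by (intro ext) (auto simp: leg2_def K_index simp flip: adj_mult[OF assms] adj_one[OF assms])

lemma adj_RK:
  assumes "1 \<le> i" "i < n"
  shows "adj n i R \<star> adj n i K = (\<lambda>xs ys. \<mu> * adj n i K xs ys)"
  by (intro ext) (auto simp: leg2_def RK simp flip: adj_mult[OF assms])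

lemma adj_K_rel:
  assumes i: "1 \<le> i" "Suc i < n"
  shows "adj n (Suc i) K \<star> adj n i K = adj n i R \<star> adj n (Suc i) R \<star> adj n i K"
    and "adj n (Suc i) K \<star> adj n i K = adj n i R' \<star> adj n (Suc i) R' \<star> adj n i K"
    and "adj n i K \<star> adj n (Suc i) K \<star> adj n i K = adj n i K"
proof -
  have "i - 1 + 3 \<le> n" using i by simp
  note lift = place_mult[OF this] adj_lift3[OF i]
  show "adj n (Suc i) K \<star> adj n i K = adj n i R \<star> adj n (Suc i) R \<star> adj n i K"
    using arg_cong[OF K_rel(1), of "place n (i - 1) 3"] by (simp only: lift)
  show "adj n (Suc i) K \<star> adj n i K = adj n i R' \<star> adj n (Suc i) R' \<star> adj n i K"
    using arg_cong[OF K_rel(2), of "place n (i - 1) 3"] by (simp only: lift)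
  show "adj n i K \<star> adj n (Suc i) K \<star> adj n i K = adj n i K"
    using arg_cong[OF K_rel(3), of "place n (i - 1) 3"] by (simp only: lift)
qed

text \<open>The relation with inverse R-matrices, rewritten so that no inverse occurs; in this form
  it is an assumption of \<open>bmw_rep\<close>.\<close>

lemma adj_RRKK:
  assumes i: "1 \<le> i" "Suc i < n"
  shows "adj n (Suc i) R \<star> adj n i R \<star> adj n (Suc i) K \<star> adj n i K = adj n i K"
proof -
  have 1: "adj n i R \<star> adj n i R' = op_one n" and 2: "adj n (Suc i) R \<star> adj n (Suc i) R' = op_one n"
    using i inverses by (auto intro!: adj_inverse)
  show ?thesis
    using adj_K_rel(2)[OF i]
    by (simp add: op_mult_assoc op_mult_left_cong[OF 1] op_mult_left_cong[OF 2] op_one_left op_mult_in_ops)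
qed

definition sc :: "nat \<Rightarrow> complex \<Rightarrow> 'v mat" where
  "sc n c = Mat (\<lambda>xs ys. c * op_one n xs ys)"

lemma entries_sc: "entries (sc n c) = (\<lambda>xs ys. c * op_one n xs ys)"
  by (simp add: sc_def)

lemma sc_mult: "sc n c * Mat A = Mat (\<lambda>xs ys. c * (op_one n \<star> A) xs ys)"
  "Mat A * sc n c = Mat (\<lambda>xs ys. c * (A \<star> op_one n) xs ys)"
  by (simp_all add: sc_def times_mat_def op_mult_scale mult.commute)

text \<open>One instance for each n, all in the same ring type, because the final induction runs
  over the number of strands.\<close>

sublocale bmw: bmw_rep n "sc n" "\<lambda>i. Mat (adj n i R)" "\<lambda>i. Mat (adj n i K)" lam \<mu> "BMW_eta q \<mu>" for n
proof
  show "lam \<noteq> 0" "\<mu> \<noteq> 0" "BMW_eta q \<mu> \<noteq> 0" "BMW_eta q \<mu> * lam * \<mu> = 1 + lam * \<mu> - \<mu> * \<mu>"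
    by (fact lam \<mu>(1) eta)+
  fix a b
  show "sc n (a + b) = sc n a + sc n b"
    by (simp add: sc_def plus_mat_def algebra_simps)
  show "sc n (a * b) = sc n a * sc n b"
    by (simp add: sc_def[of n b] sc_mult op_mult_scale op_one_left) (simp add: sc_def mult.assoc)
next
  fix i a assume i: "1 \<le> i" "i < n"
  show "sc n 1 * Mat (adj n i R) = Mat (adj n i R)" "Mat (adj n i R) * sc n a = sc n a * Mat (adj n i R)"
    "sc n 1 * Mat (adj n i K) = Mat (adj n i K)"
    by (simp_all add: sc_mult op_one_left op_one_right)
  show "Mat (adj n i R) * Mat (adj n i R) = sc n 1 + sc n lam * Mat (adj n i R) - sc n (lam * \<mu>) * Mat (adj n i K)"
    by (simp add: sc_mult op_one_left Mat_arith adj_RR[OF i]) (simp add: sc_def Mat_arith)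
  show "Mat (adj n i R) * Mat (adj n i K) = sc n \<mu> * Mat (adj n i K)"
    by (simp add: sc_mult op_one_left Mat_arith adj_RK[OF i])
next
  fix i j assume "1 \<le> i" "i + 2 \<le> j" "j < n"
  then show "Mat (adj n i R) * Mat (adj n j R) = Mat (adj n j R) * Mat (adj n i R)"
    unfolding Mat_arith using adj_far[of i j n R R] by simp
next
  fix i assume i: "1 \<le> i" "Suc i < n"
  show "Mat (adj n i R) * Mat (adj n (Suc i) R) * Mat (adj n i R) = Mat (adj n (Suc i) R) * Mat (adj n i R) * Mat (adj n (Suc i) R)"
    unfolding Mat_arith using adj_lift[OF artin(1) i] by simp
  show "Mat (adj n (Suc i) K) * Mat (adj n i K) = Mat (adj n i R) * Mat (adj n (Suc i) R) * Mat (adj n i K)"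
    unfolding Mat_arith using adj_K_rel(1)[OF i] by simp
  show "Mat (adj n (Suc i) R) * Mat (adj n i R) * Mat (adj n (Suc i) K) * Mat (adj n i K) = Mat (adj n i K)"
    unfolding Mat_arith using adj_RRKK[OF i] by simp
  show "Mat (adj n i K) * Mat (adj n (Suc i) K) * Mat (adj n i K) = Mat (adj n i K)"
    unfolding Mat_arith using adj_K_rel(3)[OF i] by simp
qed

lemma place_adj: "\<lbrakk>1 \<le> i; i < m; k + m \<le> n\<rbrakk> \<Longrightarrow> place n k m (adj m i A) = adj n (k + i) A"
  by (simp add: adj_eq_place place_place)

lemma alg_W: "A \<in> alg n \<Longrightarrow> Mat A \<in> bmw.W n n"
proof (induction rule: alg.induct)
  case (scalar c)
  then show ?case unfolding sc_def[symmetric] by (rule bmw.W.scalar)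
next
  case (add A B)
  then show ?case using bmw.W.add[OF add.IH] by (simp only: Mat_arith)
next
  case (mult A B)
  then show ?case using bmw.W.mult[OF mult.IH] by (simp only: Mat_arith)
qed (auto intro: bmw.W.gen)

text \<open>An element of W_k inside the n-strand algebra is read as an operator on k tensor
  factors, so that the product formula and the induction hypothesis for k apply to it.\<close>

lemma W_alg: "x \<in> bmw.W n k \<Longrightarrow> k \<le> n \<Longrightarrow> \<exists>A\<in>alg k. entries x = place n 0 k A"
proof (induction rule: bmw.W.induct)
  case (scalar c)
  then show ?case
    by (intro bexI[OF _ alg.scalar[of c]]) (simp add: sc_def place_scale place_one)
next
  case (gen i)
  then show ?case by (intro bexI[OF _ alg.gen[of i]]) (simp_all add: place_adj)
next
  case (add x y)
  then obtain A B where "A \<in> alg k" "B \<in> alg k" "entries x = place n 0 k A" "entries y = place n 0 k B" by blast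
  then show ?case by (intro bexI[OF _ alg.add[of A k B]]) (simp_all add: entries_add place_add)
next
  case (mult x y)
  then obtain A B where "A \<in> alg k" "B \<in> alg k" "entries x = place n 0 k A" "entries y = place n 0 k B" by blast
  then show ?case using mult.prems by (intro bexI[OF _ alg.mult[of A k B]]) (simp_all add: entries_mult place_mult)
qed

lemma entries_W: "x \<in> bmw.W n n \<Longrightarrow> entries x \<in> alg n"
  using W_alg[of x n n] by (auto simp: place_all alg_in_ops)

text \<open>Inverses are unique, so R_i^{-1} is the element \<open>bmw.Ri n i\<close>, which is a
  polynomial in R_i.\<close>

lemma adj_R'_alg: "1 \<le> i \<Longrightarrow> i < n \<Longrightarrow> adj n i R' \<in> alg n"
proof -
  assume i: "1 \<le> i" "i < n"
  have "adj n i R \<star> adj n i R' = op_one n" using i inverses by (intro adj_inverse) auto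
  then have "Mat (adj n i R) * Mat (adj n i R') = sc n 1"
    by (simp add: Mat_arith sc_def)
  then have "bmw.Ri n i * Mat (adj n i R) * Mat (adj n i R') = bmw.Ri n i * sc n 1"
    by (simp add: mult.assoc)
  then have "Mat (adj n i R') = bmw.Ri n i"
    using bmw.Ri(1)[OF i] bmw.W_unit_right[OF bmw.Ri_in_W[OF i]] by (simp add: sc_mult op_one_left)
  then have "entries (bmw.Ri n i) = adj n i R'"
    by (metis mat_simps(1))
  then show ?thesis
    using entries_W[OF bmw.Ri_in_W[OF i order_refl]] by simp
qed

lemma op_one_alg: "op_one n \<in> alg n"
  using alg.scalar[of 1 n] by simp

lemma rho_word_alg: "w \<in> braid_words n \<Longrightarrow> rho_word R n w \<in> alg n"
  by (induction w) (auto simp: rho_word_Nil rho_word_Cons op_one_alg braid_words_def intro!: alg.mult alg.gen adj_R'_alg)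

lemma K_alg: "K \<in> alg 2"
proof -
  have "Mat (adj 2 1 K) \<in> bmw.W 2 2" by (rule bmw.K_in_W) auto
  moreover have "adj 2 1 K = K" using adj_eq_place[of 1 2 K] K_in_ops by (simp add: place_all)
  ultimately show ?thesis using entries_W[of "Mat (adj 2 1 K)" 2] by simp
qed

text \<open>The braid word of the n-th power sum. It is empty for n = 1, so that p_1 = Tr_R M obeys
  the same formula.\<close>

definition coxeter :: "nat \<Rightarrow> braid_word" where
  "coxeter n = map (\<lambda>k. (k, True)) (rev [1..<n])"

lemma coxeter_words: "coxeter n \<in> braid_words n"
  by (auto simp: coxeter_def braid_words_def)

text \<open>The m letters R_k, ..., R_{k+m-1} occupy the m + 1 strands k, ..., k + m, hence
  \<open>Suc m\<close> strands placed after the first k - 1.\<close>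

lemma entries_Rs:
  "\<lbrakk>1 \<le> k; k + m \<le> n\<rbrakk> \<Longrightarrow> entries (bmw.Rs n k m) = place n (k - 1) (Suc m) (rho_word R (Suc m) (coxeter (Suc m)))"
proof (induction m)
  case 0
  then show ?case by (simp add: entries_sc coxeter_def rho_word_Nil place_one)
next
  case (Suc m)
  have "map (\<lambda>(i, e). (0 + i, e)) w = w" for w :: braid_word by (induction w) auto
  then have "rho_word R (Suc (Suc m)) (coxeter (Suc m)) = place (Suc (Suc m)) 0 (Suc m) (rho_word R (Suc m) (coxeter (Suc m)))"
    using place_rho_word[OF coxeter_words, of 0 "Suc m" "Suc (Suc m)"] by simp
  moreover have "coxeter (Suc (Suc m)) = (Suc m, True) # coxeter (Suc m)"
    by (simp add: coxeter_def)
  ultimately show ?case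
    using Suc place_adj[of "Suc m" "Suc (Suc m)" "k - 1" n R]
    by (simp add: entries_mult rho_word_Cons place_mult place_place)
qed

text \<open>Lifts to the free algebra of the elements of the characteristic subalgebra.\<close>

inductive_set charfree :: "'v qfree set" where
  one: "1 \<in> charfree"
| word: "\<lbrakk>1 \<le> n; w \<in> braid_words n\<rbrakk> \<Longrightarrow> \<tau> n (rho_word R n w) \<in> charfree"
| add: "\<lbrakk>x \<in> charfree; y \<in> charfree\<rbrakk> \<Longrightarrow> x + y \<in> charfree"
| scale: "x \<in> charfree \<Longrightarrow> const c * x \<in> charfree"

lemma charfree_0: "0 \<in> charfree"
  using charfree.scale[OF charfree.one, of 0] by (simp add: const_simps)

text \<open>The product of two traces of words is the trace of the first word followed by the second
  one moved n strands to the right, by \<open>\<tau>_mult\<close>. The rest is bilinearity and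
  centrality of the scalars.\<close>

lemma charfree_mult: "x \<in> charfree \<Longrightarrow> y \<in> charfree \<Longrightarrow> x * y \<in> charfree"
proof (induction arbitrary: y rule: charfree.induct)
  case (word n w)
  from word(3) show ?case
  proof (induction rule: charfree.induct)
    case one
    then show ?case using word by (simp add: charfree.word)
  next
    case (word m v)
    let ?v = "map (\<lambda>(i, e). (n + i, e)) v"
    have n: "1 \<le> n" "w \<in> braid_words n" by fact+
    have "map (\<lambda>(i, e). (0 + i, e)) w = w" by (induction w) auto
    then have "place (n + m) 0 n (rho_word R n w) = rho_word R (n + m) w"
      using place_rho_word[OF n(2), of 0 "n + m"] by simp
    moreover have "place (n + m) n m (rho_word R m v) = rho_word R (n + m) ?v"
      using place_rho_word[OF word(2), of n "n + m"] by simp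
    moreover have "w @ ?v \<in> braid_words (n + m)"
      using n word by (fastforce simp: braid_words_def)
    ultimately show ?case
      using \<tau>_mult[OF rho_word_alg[OF n(2)] rho_word_alg[OF word(2)]] charfree.word[of "n + m" "w @ ?v"] n
      by (simp add: rho_word_append)
  next
    case (scale y c)
    have "\<tau> n (rho_word R n w) * (const c * y) = const c * (\<tau> n (rho_word R n w) * y)"
      by (metis const_central mult.assoc)
    then show ?case using scale by (simp add: charfree.scale)
  qed (simp add: distrib_left charfree.add)
qed (auto simp: distrib_right mult.assoc intro: charfree.add charfree.scale)

lemma subalgebra_charfree: "subalgebra (qma_scalars R F) (cls ` charfree) (QMA R F)"
  by (rule subalgebra_cls_image) (auto intro: charfree_0 charfree.add charfree.scale)

lemma subring_charfree: "subring (cls ` charfree) (QMA R F)"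
  by (rule subring_cls_image[OF subalgebra_charfree]) (auto intro: charfree.one charfree_mult)

lemma \<tau>_rho_charfree:
  assumes "1 \<le> n" "\<alpha> \<in> braid_algebra n"
  shows "\<tau> n (rho R n \<alpha>) \<in> charfree"
proof -
  have sum: "sum h B \<in> charfree" if "\<And>b. b \<in> B \<Longrightarrow> h b \<in> charfree" for h :: "braid_word set \<Rightarrow> 'v qfree" and B
    using that by (induction B rule: infinite_finite_induct) (auto intro: charfree_0 charfree.add)
  show ?thesis
    unfolding \<tau>_rho
  proof (intro sum charfree.scale)
    fix b assume "b \<in> Poly_Mapping.keys \<alpha>"
    then have "b \<in> braid_group n" using assms by (auto simp: braid_algebra_def)
    then show "\<tau> n (the_elem (rho_word R n ` b)) \<in> charfree"
      by (rule braid_group_cases) (use assms in \<open>auto simp: rho_word_braid intro: charfree.word\<close>)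
  qed
qed

lemma charfree_induct_cls:
  assumes W: "subalgebra (qma_scalars R F) W (QMA R F)" and one: "cls 1 \<in> W"
    and word: "\<And>n w. 1 \<le> n \<Longrightarrow> w \<in> braid_words n \<Longrightarrow> cls (\<tau> n (rho_word R n w)) \<in> W"
  shows "cls ` charfree \<subseteq> W"
proof -
  have "cls x \<in> W" if "x \<in> charfree" for x
    using that by (induction rule: charfree.induct) (auto intro: one word subalgebra_cls[OF W])
  then show ?thesis by blast
qed

lemma single_braid_algebra: "w \<in> braid_words n \<Longrightarrow> Poly_Mapping.single (braid n w) 1 \<in> braid_algebra n"
  by (auto simp: braid_algebra_def braid_group_def braid_def quotient_def)

text \<open>The span is defined as an intersection of subspaces; its description as an image makes
  closure under multiplication accessible.\<close>

lemma char_subalgebra_eq: "char_subalgebra R F = cls ` charfree"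
proof
  show "char_subalgebra R F \<subseteq> cls ` charfree"
    unfolding char_subalgebra_def qma_span_def
  proof (rule Inter_lower, intro CollectI conjI subalgebra_charfree)
    show "insert \<one>\<^bsub>QMA R F\<^esub> {ch R F n \<alpha> |n \<alpha>. 1 \<le> n \<and> \<alpha> \<in> braid_algebra n} \<subseteq> cls ` charfree"
      by (auto simp: cls_one ch_eq intro!: imageI charfree.one \<tau>_rho_charfree[simplified])
  qed
  show "cls ` charfree \<subseteq> char_subalgebra R F"
    unfolding char_subalgebra_def qma_span_def
  proof (rule Inter_greatest, elim CollectE conjE)
    fix W assume W: "subalgebra (qma_scalars R F) W (QMA R F)"
      and S: "insert \<one>\<^bsub>QMA R F\<^esub> {ch R F n \<alpha> |n \<alpha>. 1 \<le> n \<and> \<alpha> \<in> braid_algebra n} \<subseteq> W"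
    show "cls ` charfree \<subseteq> W"
    proof (rule charfree_induct_cls[OF W])
      show "cls 1 \<in> W" using S by (simp add: cls_one)
      fix n w assume nw: "(1::nat) \<le> n" "w \<in> braid_words n"
      then have "ch R F n (Poly_Mapping.single (braid n w) 1) \<in> W"
        using S single_braid_algebra by blast
      then show "cls (\<tau> n (rho_word R n w)) \<in> W"
        using nw by (simp add: ch_eq rho_single)
    qed
  qed
qed

section \<open>The generators, and generation by induction on the number of strands\<close>

lemma power_sum_eq: "1 \<le> n \<Longrightarrow> power_sum R F n = cls (\<tau> n (rho_word R n (coxeter n)))"
proof (cases "n = 1")
  case True
  have "(M_op :: ('v, 'v qfree) op) \<in> ops 1" by (auto simp: ops_def M_op_def)
  then have "M_op \<star> op_one 1 = (M_op :: ('v, 'v qfree) op)" "M_prod F 1 = M_op"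
    using M_bar.simps(2)[of F 1] place_all[of "M_op :: ('v, 'v qfree) op" 1]
    by (simp_all add: M_prod_def op_prod_def leg1_eq_place op_one_right)
  then show ?thesis
    using True by (simp add: power_sum_def \<tau>_def coxeter_def rho_word_Nil const_op_one)
next
  case False
  assume "1 \<le> n"
  then show ?thesis
    using False coxeter_words[of n] by (simp add: power_sum_def ch_eq rho_single coxeter_def)
qed

lemma two_contraction_eq: "two_contraction q \<mu> R F = cls (const (inverse (BMW_eta q \<mu>)) * \<tau> 2 K)"
proof -
  have "adj 2 1 K = K" using adj_eq_place[of 1 2 K] K_in_ops by (simp add: place_all)
  moreover have "M_prod F 2 = M_bar F 2 1 \<star> M_bar F 2 2"
    by (simp add: M_prod_def op_prod_def op_one_right upt_rec numeral_2_eq_2)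
  ultimately show ?thesis by (simp add: two_contraction_def \<tau>_def)
qed

text \<open>p_0 is the trace of D_R, a complex multiple of 1.\<close>

lemma R_trace_one_charfree: "R_trace R 1 (op_one 1) \<in> charfree"
proof -
  have "R_trace R 1 (op_one 1) = const (op_trace 1 (tensor_power (D_op R) 1))"
    by (simp add: R_trace_eq op_one_right const_op_in_ops) (simp add: op_trace_def const_op_def const_sum)
  then show ?thesis using charfree.scale[OF charfree.one] by simp
qed

text \<open>K is a combination of 1, R and R^2, the images of three braids on two strands.\<close>

lemma \<tau>_K_charfree: "\<tau> 2 K \<in> charfree"
proof -
  define c where "c = 1 / (lam * \<mu>)"
  have K: "K = (\<lambda>xs ys. (c * op_one 2 xs ys + (c * lam) * R xs ys) + (- c) * (R \<star> R) xs ys)"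
    by (intro ext) (simp add: K_index c_def diff_divide_distrib add_divide_distrib)
  have "adj 2 1 R = R" using adj_eq_place[of 1 2 R] inverses(1) by (simp add: place_all)
  then have "rho_word R 2 [(1, True)] = R" "rho_word R 2 [(1, True), (1, True)] = R \<star> R" "rho_word R 2 [] = op_one 2"
    using inverses(1) by (simp_all add: rho_word_Cons rho_word_Nil op_one_right numeral_2_eq_2)
  then have "\<tau> 2 (op_one 2) \<in> charfree" "\<tau> 2 R \<in> charfree" "\<tau> 2 (R \<star> R) \<in> charfree"
    using charfree.word[of 2 "[]"] charfree.word[of 2 "[(1, True)]"] charfree.word[of 2 "[(1, True), (1, True)]"]
    by (simp_all add: braid_words_def)
  then show ?thesis
    by (subst K) (simp only: \<tau>_add \<tau>_scale charfree.add charfree.scale)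
qed

lemma generators_charfree: "insert (two_contraction q \<mu> R F) (range (power_sum R F)) \<subseteq> cls ` charfree"
proof -
  have "power_sum R F i \<in> cls ` charfree" for i
  proof (cases "i = 0")
    case True
    then show ?thesis using R_trace_one_charfree by (simp add: power_sum_def)
  next
    case False
    then show ?thesis using power_sum_eq[of i] charfree.word[of i, OF _ coxeter_words] by simp
  qed
  moreover have "two_contraction q \<mu> R F \<in> cls ` charfree"
    unfolding two_contraction_eq using \<tau>_K_charfree charfree.scale by blast
  ultimately show ?thesis by blast
qed

lemma \<tau>_unit: "\<tau> n (op_one n \<star> A) = \<tau> n A"
proof -
  have "M_prod F n \<star> (op_one n \<star> cop A) = M_prod F n \<star> cop A"
    by (simp add: M_prod_eq op_one_right flip: op_mult_assoc)
  then show ?thesis by (simp add: \<tau>_def const_op_mult const_op_one)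
qed

text \<open>\<open>T_all\<close> is applied with T x saying that the class of the trace of x lies in
  A. Apart from the power sum and, for n = 2, K itself, the words it asks for are products of
  operators on disjoint factors, where \<open>\<tau>_mult\<close> leads to fewer strands.\<close>

lemma ch_in_generated:
  assumes ring: "subring A (QMA R F)" and alg: "subalgebra (qma_scalars R F) A (QMA R F)"
    and gens: "insert (two_contraction q \<mu> R F) (range (power_sum R F)) \<subseteq> A"
  shows "1 \<le> n \<Longrightarrow> Y \<in> alg n \<Longrightarrow> cls (\<tau> n Y) \<in> A"
proof (induction n arbitrary: Y rule: less_induct)
  case (less n)
  note A = subalgebra_cls[OF alg] subring_cls[OF ring]
  define T where "T x \<longleftrightarrow> cls (\<tau> n (entries x)) \<in> A" for x
  have power: "cls (\<tau> k (rho_word R k (coxeter k))) \<in> A" if "1 \<le> k" for k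
    using that gens power_sum_eq[of k] by auto
  have K: "cls (\<tau> 2 K) \<in> A"
  proof -
    have "cls (const (inverse (BMW_eta q \<mu>)) * \<tau> 2 K) \<in> A"
      using gens by (simp add: two_contraction_eq)
    from A(3)[OF this, of "BMW_eta q \<mu>"]
    have "cls (const (BMW_eta q \<mu> * inverse (BMW_eta q \<mu>)) * \<tau> 2 K) \<in> A"
      by (simp only: const_simps(4) mult.assoc)
    then show ?thesis using eta by (simp add: const_simps(2))
  qed
  \<comment> \<open>The induction hypothesis is spent on the first factor B. The second will be K or
    the word of a power sum, whose class is in A by \<open>K\<close> or
    \<open>power\<close>.\<close>
  have prod: "cls (\<tau> n (place n 0 k B \<star> place n k m C)) \<in> A"
    if "n = k + m" "1 \<le> k" "k < n" "B \<in> alg k" "C \<in> alg m" "cls (\<tau> m C) \<in> A" for k m B C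
    using that less.IH[of k B] \<tau>_mult[of B k C m] A(5) by simp
  \<comment> \<open>\<open>T_all\<close> writes the operator on the last factors first,
    \<open>\<tau>_mult\<close> expects it second.\<close>
  have commute: "place n 0 k B \<star> place n k m C = place n k m C \<star> place n 0 k B" if "n = k + m"
    for k m and B C :: "('v, complex) op"
    using that by (intro place_commute) (auto simp: mult.commute)
  have "T (Mat Y)"
  proof (rule bmw.T_all[of T n])
    show "T (x + y)" if "T x" "T y" for x y
      using that A(2) by (simp add: T_def entries_add \<tau>_add)
    show "T (sc n c * x)" if "T x" for x c
      using that A(3) by (simp add: T_def sc_def entries_mult op_mult_scale \<tau>_scale \<tau>_unit)
    show "T (y * x)" if "x \<in> bmw.W n n" "y \<in> bmw.W n n" "T (x * y)" for x y
    proof -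
      have "\<tau> n (entries x \<star> entries y) - \<tau> n (entries y \<star> entries x) \<in> J"
        using that entries_W by (intro \<tau>_commute) (auto intro: alg_in_ops)
      then show ?thesis using that by (simp add: T_def entries_mult flip: cls_eq_iff)
    qed
    show "T (bmw.Rs n 1 (n - 1))"
      using less.prems power[of n] by (simp add: T_def entries_Rs place_all)
    show "T (Mat (adj n 1 K))" if "n = 2"
    proof -
      have "adj 2 1 K = K" using adj_eq_place[of 1 2 K] K_in_ops by (simp add: place_all)
      then show ?thesis using K that by (simp add: T_def)
    qed
    show "T (Mat (adj n (n - 1) K) * y)" if n: "3 \<le> n" and y: "y \<in> bmw.W n (n - 2)" for y
    proof -
      obtain B where B: "B \<in> alg (n - 2)" "entries y = place n 0 (n - 2) B"
        using W_alg[OF y] by auto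
      have "adj n (n - 1) K = place n (n - 1 - 1) 2 K"
        by (rule adj_eq_place) (use n in auto)
      moreover have "n - 1 - 1 = n - 2" by simp
      ultimately have "entries (Mat (adj n (n - 1) K) * y) = place n (n - 2) 2 K \<star> place n 0 (n - 2) B"
        by (simp only: entries_mult mat_simps B(2))
      then show ?thesis
        using prod[of "n - 2" 2 B K] commute[of "n - 2" 2 B K] B n K K_alg by (simp add: T_def)
    qed
    show "T (bmw.Rs n (Suc k) (n - Suc k) * y)" if k: "1 \<le> k" "k < n" and y: "y \<in> bmw.W n k" for k y
    proof -
      obtain B where B: "B \<in> alg k" "entries y = place n 0 k B"
        using W_alg[OF y] k by auto
      have "entries (bmw.Rs n (Suc k) (n - Suc k)) = place n k (n - k) (rho_word R (n - k) (coxeter (n - k)))"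
        using entries_Rs[of "Suc k" "n - Suc k" n] k by (simp add: Suc_diff_Suc)
      then show ?thesis
        using prod[of k "n - k" B] commute[of k "n - k" B] B k power[of "n - k"] rho_word_alg[OF coxeter_words]
        by (simp add: T_def entries_mult)
    qed
    show "Mat Y \<in> bmw.W n n" using less.prems by (intro alg_W)
  qed (use less.prems in auto)
  then show ?case by (simp add: T_def)
qed

theorem char_subalgebra_generated:
  "char_subalgebra R F = qma_generated R F (insert (two_contraction q \<mu> R F) (range (power_sum R F)))"
proof
  show "char_subalgebra R F \<subseteq> qma_generated R F (insert (two_contraction q \<mu> R F) (range (power_sum R F)))"
    unfolding qma_generated_def
  proof (rule Inter_greatest, elim CollectE conjE)
    fix A assume A: "subring A (QMA R F)" "subalgebra (qma_scalars R F) A (QMA R F)"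
      "insert (two_contraction q \<mu> R F) (range (power_sum R F)) \<subseteq> A"
    show "char_subalgebra R F \<subseteq> A"
      unfolding char_subalgebra_eq
      by (rule charfree_induct_cls[OF A(2) subring_cls(1)[OF A(1)]]) (intro ch_in_generated[OF A] rho_word_alg)
  qed
  show "qma_generated R F (insert (two_contraction q \<mu> R F) (range (power_sum R F))) \<subseteq> char_subalgebra R F"
    unfolding qma_generated_def char_subalgebra_eq
    by (rule Inter_lower) (simp add: subring_charfree subalgebra_charfree generators_charfree[simplified])
qed

end

theorem proposition4p7:
  fixes R F :: "('v::finite, complex) op" and q \<mu> :: complex
  assumes "q \<notin> {0, 1, -1}" and "\<mu> \<notin> {0, q, - inverse q}"
    and "R_matrix R" and "R_matrix F"
    and "strict_skew_invertible R" and "strict_skew_invertible F"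
    and "compatible_pair R F"
    and "BMW_type q \<mu> R"
  shows "char_subalgebra R F =
    qma_generated R F (insert (two_contraction q \<mu> R F) (range (power_sum R F)))"
proof -
  interpret bmw_quantum_matrices R F q \<mu>
    using assms by unfold_locales (auto simp: strict_skew_invertible_def)
  show ?thesis by (rule char_subalgebra_generated)
qed

end
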